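(* Let $P$ be a finite poset with $n\geq 3$ elements. Then $\Delta(\hat{\mathcal O}(P))$ is homotopy equivalent to a wedge of spheres of dimension $n-3$. Write $s_O(P)$ for the number of these spheres, and let $a$ be a minimal element of $P$. If $n>3$, then $$s_O(P)=\sum_{b} s_O(\pi_{a,b}),$$ where the sum runs over all $b\in P$, $b\neq a$, such that $\pi_{a,b}$ is an order-preserving partition of $P$, and $\pi_{a,b}$ is regarded as an $(n-1)$-element poset with its quotient order.
   Context: For a poset $(P,\leq)$ and an equivalence relation $\rho$ on $P$, a $\rho$-sequence is a sequence $x_0,\dots,x_m\in P$ such that for each $i$ either $(x_{i-1},x_i)\in\rho$ or $x_{i-1}<x_i$; if $x_0=x_m$ it is a $\rho$-circle. $\rho$ is an order-congruence if for every $\rho$-circle all classes $\rho[x_0],\dots,\rho[x_m]$ coincide. An order-preserving partition is the class partition $P/\rho$ of an order-congruence $\rho$; it is a poset under the quotient order: $\rho[x]\leq\rho[y]$ iff there is a $\rho$-sequence from $x$ to $y$. $\mathcal O(P)$ is the set of order-preserving partitions ordered by refinement, and $\hat{\mathcal O}(P)$ is $\mathcal O(P)$ with its bottom (partition into singletons) and top (one-block partition) removed. $\Delta(Q)$ denotes the order complex (simplicial complex of all chains) of a finite poset $Q$. For distinct $a,b\in P$, $\pi_{a,b}=\{\{a,b\}\}\cup\{\{x\}: x\in P\setminus\{a,b\}\}$; it is order-preserving iff $a\prec b$, $b\prec a$ (covering), or $a,b$ incomparable. *)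

theory Defs
  imports "HOL-Analysis.Analysis" "HOL-Library.Disjoint_Sets"
begin

section \<open>Order-preserving partitions\<close>

text \<open>A poset is given by a carrier \<open>P\<close> and a relation \<open>r\<close> with \<open>partial_order_on P r\<close>;
  the strict order is \<open>r - Id\<close>. A sequence \<open>x\<^sub>0, \<dots>, x\<^sub>m\<close> is a nonempty list.\<close>

definition rho_sequence :: "'a set \<Rightarrow> 'a rel \<Rightarrow> 'a rel \<Rightarrow> 'a list \<Rightarrow> bool" where
  "rho_sequence P r \<rho> xs \<longleftrightarrow>
     xs \<noteq> [] \<and> set xs \<subseteq> P \<and> successively (\<lambda>x y. (x, y) \<in> \<rho> \<or> (x, y) \<in> r - Id) xs"

definition rho_circle :: "'a set \<Rightarrow> 'a rel \<Rightarrow> 'a rel \<Rightarrow> 'a list \<Rightarrow> bool" where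
  "rho_circle P r \<rho> xs \<longleftrightarrow> rho_sequence P r \<rho> xs \<and> hd xs = last xs"

definition order_congruence :: "'a set \<Rightarrow> 'a rel \<Rightarrow> 'a rel \<Rightarrow> bool" where
  "order_congruence P r \<rho> \<longleftrightarrow>
     equiv P \<rho> \<and>
     (\<forall>xs. rho_circle P r \<rho> xs \<longrightarrow> (\<forall>x\<in>set xs. \<forall>y\<in>set xs. \<rho> `` {x} = \<rho> `` {y}))"

definition order_preserving_partitions :: "'a set \<Rightarrow> 'a rel \<Rightarrow> 'a set set set" where
  "order_preserving_partitions P r = {P // \<rho> | \<rho>. order_congruence P r \<rho>}"

definition quotient_order :: "'a set \<Rightarrow> 'a rel \<Rightarrow> 'a rel \<Rightarrow> 'a set rel" where
  "quotient_order P r \<rho> =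
     {(\<rho> `` {x}, \<rho> `` {y}) | x y. \<exists>xs. rho_sequence P r \<rho> xs \<and> hd xs = x \<and> last xs = y}"

definition partition_rel :: "'a set set \<Rightarrow> 'a rel" where
  "partition_rel \<pi> = {(x, y). \<exists>B\<in>\<pi>. x \<in> B \<and> y \<in> B}"

definition proper_order_preserving_partitions :: "'a set \<Rightarrow> 'a rel \<Rightarrow> 'a set set set" where
  "proper_order_preserving_partitions P r =
     order_preserving_partitions P r - {(\<lambda>x. {x}) ` P, {P}}"

definition pair_partition :: "'a set \<Rightarrow> 'a \<Rightarrow> 'a \<Rightarrow> 'a set set" where
  "pair_partition P a b = insert {a, b} ((\<lambda>x. {x}) ` (P - {a, b}))"


section \<open>Order complexes and their geometric realization\<close>

definition order_complex :: "'q set \<Rightarrow> 'q rel \<Rightarrow> 'q set set" where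
  "order_complex Q le = {\<sigma>. finite \<sigma> \<and> \<sigma> \<subseteq> Q \<and> \<sigma> \<in> Chains le}"

text \<open>Points are given by barycentric coordinates, extended by \<open>0\<close> to the whole type.
  The topology is that of pointwise convergence, which for a finite complex is the usual
  (coherent) one. The empty simplex, if present, contributes no point.\<close>

definition geometric_realization :: "'v set set \<Rightarrow> ('v \<Rightarrow> real) topology" where
  "geometric_realization K =
     subtopology (powertop_real UNIV)
       {f. (\<forall>v. 0 \<le> f v) \<and> {v. f v \<noteq> 0} \<in> K \<and> (\<Sum>v | f v \<noteq> 0. f v) = 1}"

definition partition_complex :: "'a set \<Rightarrow> 'a rel \<Rightarrow> ('a set set \<Rightarrow> real) topology" where
  "partition_complex P r =
     geometric_realization
       (order_complex (proper_order_preserving_partitions P r) {(\<pi>, \<tau>). refines P \<pi> \<tau>})"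


section \<open>Wedges of spheres\<close>

text \<open>The wedge of the pointed spaces \<open>(X i, p i)\<close>, \<open>i \<in> I\<close>: the common base point is \<open>None\<close>,
  and the topology is the final one with respect to the inclusions \<open>wedge_inj p i\<close>, that is,
  the quotient topology from the disjoint union. The empty wedge is a point.\<close>

definition wedge_inj :: "('i \<Rightarrow> 'b) \<Rightarrow> 'i \<Rightarrow> 'b \<Rightarrow> ('i \<times> 'b) option" where
  "wedge_inj p i x = (if x = p i then None else Some (i, x))"

definition wedge_space :: "'i set \<Rightarrow> ('i \<Rightarrow> 'b topology) \<Rightarrow> ('i \<Rightarrow> 'b) \<Rightarrow> ('i \<times> 'b) option topology" where
  "wedge_space I X p =
     topology (\<lambda>U. U \<subseteq> insert None (\<Union>i\<in>I. wedge_inj p i ` topspace (X i)) \<and>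
                   (\<forall>i\<in>I. openin (X i) {x \<in> topspace (X i). wedge_inj p i x \<in> U}))"

lemma openin_wedge_space:
  "openin (wedge_space I X p) U \<longleftrightarrow>
     U \<subseteq> insert None (\<Union>i\<in>I. wedge_inj p i ` topspace (X i)) \<and>
     (\<forall>i\<in>I. openin (X i) {x \<in> topspace (X i). wedge_inj p i x \<in> U})"
proof -
  let ?A = "insert None (\<Union>i\<in>I. wedge_inj p i ` topspace (X i))"
  let ?f = "\<lambda>i U. {x \<in> topspace (X i). wedge_inj p i x \<in> U}"
  have 1: "?f i (S \<inter> T) = ?f i S \<inter> ?f i T" for i S T
    by auto
  have 2: "?f i (\<Union>\<K>) = \<Union> (?f i ` \<K>)" for i \<K>
    by auto
  have "istopology (\<lambda>U. U \<subseteq> ?A \<and> (\<forall>i\<in>I. openin (X i) (?f i U)))"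
    unfolding istopology_def
  proof (intro conjI allI impI ballI)
    fix S T i
    assume S: "S \<subseteq> ?A \<and> (\<forall>i\<in>I. openin (X i) (?f i S))"
      and T: "T \<subseteq> ?A \<and> (\<forall>i\<in>I. openin (X i) (?f i T))"
    show "S \<inter> T \<subseteq> ?A"
      using S by (meson inf.coboundedI1)
    show "openin (X i) (?f i (S \<inter> T))" if "i \<in> I"
      unfolding 1 using S T that by (intro openin_Int) simp_all
  next
    fix \<K> i
    assume K: "\<forall>K\<in>\<K>. K \<subseteq> ?A \<and> (\<forall>i\<in>I. openin (X i) (?f i K))"
    show "\<Union>\<K> \<subseteq> ?A"
      using K by (intro Union_least) simp
    show "openin (X i) (?f i (\<Union>\<K>))" if "i \<in> I"
      unfolding 2 using K that by (intro openin_Union) (elim imageE, simp)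
  qed
  from topology_inverse'[OF this] show ?thesis
    unfolding wedge_space_def by simp
qed

lemma topspace_wedge_space:
  "topspace (wedge_space I X p) = insert None (\<Union>i\<in>I. wedge_inj p i ` topspace (X i))"
  (is "_ = ?A")
proof (rule subset_antisym)
  show "topspace (wedge_space I X p) \<subseteq> ?A"
    using openin_topspace[of "wedge_space I X p"] unfolding openin_wedge_space by (rule conjunct1)
  have "{x \<in> topspace (X i). wedge_inj p i x \<in> ?A} = topspace (X i)" if "i \<in> I" for i
    using that by blast
  then have "openin (wedge_space I X p) ?A"
    unfolding openin_wedge_space by simp
  then show "?A \<subseteq> topspace (wedge_space I X p)"
    by (rule openin_subset)
qed

definition wedge_of_spheres :: "nat \<Rightarrow> nat \<Rightarrow> (nat \<times> (nat \<Rightarrow> real)) option topology" where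
  "wedge_of_spheres k d =
     wedge_space {..<k} (\<lambda>_. nsphere d) (\<lambda>_ j. if j = 0 then 1 else 0)"

text \<open>The number \<open>k\<close> is determined by the homotopy type.
  Subtraction does not truncate when \<open>card P \<ge> 3\<close>.\<close>

definition num_spheres :: "'a set \<Rightarrow> 'a rel \<Rightarrow> nat" where
  "num_spheres P r =
     (THE k. partition_complex P r homotopy_equivalent_space wedge_of_spheres k (card P - 3))"

end

theory Submission
  imports Defs "HOL-Homology.Homology"
begin

text \<open>Let \<open>a\<close> be minimal and let \<open>s\<close> be the order congruence with classes \<open>{a}\<close> and \<open>P - {a}\<close>.
  The proper order congruences \<open>\<rho>\<close> with \<open>\<rho> \<inter> s\<close> trivial are exactly the atoms identifying \<open>a\<close>
  with one other element \<open>b\<close>. Without them the order complex collapses along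
  \<open>\<rho> \<supseteq> \<rho> \<inter> s \<subseteq> s\<close>, and each of them puts back a cone over the complex of its strict upper
  interval, which is the partition complex of the quotient. By induction one can delete some set of
  maximal faces so that a collapsible complex remains, and the sizes of these sets satisfy
  the recursion. Contracting the collapsible part turns each deleted face into a sphere. The number
  of spheres is then the rank of the top homology group of the wedge, up to a correction
  in dimension \<open>0\<close>.\<close>

section \<open>Collapsible complexes and finite chains\<close>

text \<open>A homotopy type is an awkward induction invariant, since a cone over a complex known
  only up to homotopy has to be glued in. Deleting facets down to a collapsible complex is
  combinatorial instead: it passes to cones face by face, and the numbers of deleted facets add. The
  price is that such a number is not visibly determined by the complex. It is identified with
  \<open>num_spheres\<close> only through homology, and this identification turns the additive count
  into the recursion. Minimality of \<open>a\<close> is what makes \<open>s\<close> a congruence: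
  nothing else lies below \<open>a\<close>, so no circle can leave the class \<open>{a}\<close> and
  come back. A quotient by an atom is needed in two guises: on the carrier \<open>P - {a}\<close>,
  so that the induction stays within one type, and as the partition
  \<open>pair_partition P a b\<close> of the recursion. Quotients are therefore described by an
  arbitrary surjection with a given kernel. The induction passes through two-element quotients,
  whose complex is \<open>{{}}\<close> and whose count is purely combinatorial. The recursion for
  \<open>num_spheres\<close> is restricted to more than three elements, so that every quotient still
  has at least three.\<close>

text \<open>The collapse ends at the void complex \<open>{}\<close>, so its last step removes the empty simplex together
  with a vertex. With this convention \<open>{{}}\<close> is not collapsible, and removing its only face leaves a
  collapsible complex; hence the induction can start with two-element posets.\<close>

inductive collapsible :: "'v set set \<Rightarrow> bool" where
  void: "collapsible {}"
| collapse: "\<lbrakk>collapsible (K - {\<sigma>, insert w \<sigma>}); \<sigma> \<in> K; insert w \<sigma> \<in> K; w \<notin> \<sigma>;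
    \<And>\<tau>. \<lbrakk>\<tau> \<in> K; \<sigma> \<subseteq> \<tau>\<rbrakk> \<Longrightarrow> \<tau> = \<sigma> \<or> \<tau> = insert w \<sigma>\<rbrakk> \<Longrightarrow> collapsible K"

text \<open>Adding \<open>v\<close> to both faces of a collapse of \<open>L\<close> gives a collapse
  of the union, because every face containing \<open>v\<close> comes from \<open>L\<close>. Once
  \<open>L\<close> is used up, \<open>D\<close> is left.\<close>

lemma collapsible_Un_cone:
  assumes "collapsible L" "collapsible D"
    and "\<And>\<sigma>. \<sigma> \<in> L \<Longrightarrow> v \<notin> \<sigma>" "\<And>\<sigma>. \<sigma> \<in> D \<Longrightarrow> v \<notin> \<sigma>"
  shows "collapsible (D \<union> insert v ` L)"
  using assms
proof (induction rule: collapsible.induct)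
  case void
  then show ?case by simp
next
  case (collapse L \<sigma> w)
  have vs: "v \<notin> \<sigma>" and vw: "v \<noteq> w"
    using collapse.hyps collapse.prems by blast+
  let ?K = "D \<union> insert v ` L"
  have inj: "inj_on (insert v) L"
    using collapse.prems by (auto simp: inj_on_def insert_ident)
  have "?K - {insert v \<sigma>, insert w (insert v \<sigma>)} = D \<union> insert v ` (L - {\<sigma>, insert w \<sigma>})"
    using inj collapse.hyps collapse.prems
    by (subst inj_on_image_set_diff[OF inj]) (auto simp: insert_commute)
  moreover have "collapsible (D \<union> insert v ` (L - {\<sigma>, insert w \<sigma>}))"
    using collapse.IH collapse.prems by auto
  ultimately have c: "collapsible (?K - {insert v \<sigma>, insert w (insert v \<sigma>)})" by simp
  show ?case
  proof (rule collapsible.collapse[OF c])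
    show "insert v \<sigma> \<in> ?K" using collapse.hyps by blast
    show "insert w (insert v \<sigma>) \<in> ?K"
      using collapse.hyps by (subst insert_commute) blast
    show "w \<notin> insert v \<sigma>" using vw collapse.hyps by auto
    fix \<tau> assume \<tau>: "\<tau> \<in> ?K" "insert v \<sigma> \<subseteq> \<tau>"
    then obtain \<tau>' where \<tau>': "\<tau>' \<in> L" "\<tau> = insert v \<tau>'"
      using collapse.prems by blast
    then have "\<sigma> \<subseteq> \<tau>'" using \<tau> vs by blast
    then show "\<tau> = insert v \<sigma> \<or> \<tau> = insert w (insert v \<sigma>)"
      using collapse.hyps(5)[OF \<tau>'(1)] \<tau>'(2) by (auto simp: insert_commute)
  qed
qed

text \<open>Each face \<sigma> is removed together with \<open>insert v \<sigma>\<close>, always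
  taking \<sigma> maximal among the remaining faces of \<open>L\<close>. Since \<open>L\<close> is
  an arbitrary finite set of faces, the induction can delete faces freely.\<close>

lemma collapsible_cone:
  assumes "finite L" "\<And>\<sigma>. \<sigma> \<in> L \<Longrightarrow> v \<notin> \<sigma>"
  shows "collapsible (L \<union> insert v ` L)"
  using assms
proof (induction "card L" arbitrary: L)
  case 0
  then show ?case by (simp add: collapsible.void)
next
  case (Suc n)
  then have "L \<noteq> {}" by auto
  with Suc.prems obtain \<sigma> where \<sigma>: "\<sigma> \<in> L" "\<And>\<tau>. \<tau> \<in> L \<Longrightarrow> \<sigma> \<subseteq> \<tau> \<Longrightarrow> \<tau> = \<sigma>"
    using finite_has_maximal[of L] by blast
  let ?K = "L \<union> insert v ` L"
  have inj: "inj_on (insert v) L"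
    using Suc.prems by (auto simp: inj_on_def insert_ident)
  have "?K - {\<sigma>, insert v \<sigma>} = (L - {\<sigma>}) \<union> insert v ` (L - {\<sigma>})"
    using Suc.prems(2) \<sigma>(1) by (subst inj_on_image_set_diff[OF inj]) auto
  moreover have "collapsible ((L - {\<sigma>}) \<union> insert v ` (L - {\<sigma>}))"
    using Suc.hyps(2) Suc.prems \<sigma>(1) by (intro Suc.hyps(1)) auto
  ultimately have c: "collapsible (?K - {\<sigma>, insert v \<sigma>})" by simp
  show ?case
  proof (rule collapsible.collapse[OF c])
    fix \<tau> assume \<tau>: "\<tau> \<in> ?K" "\<sigma> \<subseteq> \<tau>"
    then consider "\<tau> \<in> L" | \<tau>' where "\<tau>' \<in> L" "\<tau> = insert v \<tau>'" by blast
    then show "\<tau> = \<sigma> \<or> \<tau> = insert v \<sigma>"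
    proof cases
      case 1
      then show ?thesis using \<sigma>(2) \<tau>(2) by blast
    next
      case 2
      then have "\<sigma> \<subseteq> \<tau>'" using \<tau> Suc.prems(2) \<sigma>(1) by blast
      then show ?thesis using 2 \<sigma>(2) by blast
    qed
  qed (use \<sigma>(1) Suc.prems(2) in auto)
qed

text \<open>The bases of the cones avoid \<open>A\<close>, so a face contains at most one apex, and
  each new apex is absent from everything built before it.\<close>

lemma collapsible_Un_cones:
  assumes "finite A" "collapsible D"
    and "\<And>y. y \<in> A \<Longrightarrow> collapsible (L y)"
    and "\<And>y \<sigma>. \<sigma> \<in> D \<Longrightarrow> \<sigma> \<inter> A = {}"
    and "\<And>y \<sigma>. y \<in> A \<Longrightarrow> \<sigma> \<in> L y \<Longrightarrow> \<sigma> \<inter> A = {}"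
  shows "collapsible (D \<union> (\<Union>y\<in>A. insert y ` L y))"
proof -
  have "collapsible (D \<union> (\<Union>y\<in>B. insert y ` L y))" if "finite B" "B \<subseteq> A" for B
    using that
  proof (induction rule: finite_induct)
    case empty
    then show ?case using assms by simp
  next
    case (insert y B)
    have eq: "D \<union> (\<Union>y\<in>insert y B. insert y ` L y) = (D \<union> (\<Union>y\<in>B. insert y ` L y)) \<union> insert y ` L y"
      by blast
    show ?case
      unfolding eq
    proof (rule collapsible_Un_cone)
      show "y \<notin> \<sigma>" if "\<sigma> \<in> L y" for \<sigma>
        using assms(5) insert.prems that by blast
      show "y \<notin> \<sigma>" if \<sigma>: "\<sigma> \<in> D \<union> (\<Union>y\<in>B. insert y ` L y)" for \<sigma>
      proof
        assume "y \<in> \<sigma>"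
        moreover have "y \<in> A" using insert.prems by blast
        ultimately have "\<sigma> \<notin> D" using assms(4) by blast
        then obtain z \<tau> where "z \<in> B" "\<tau> \<in> L z" "\<sigma> = Set.insert z \<tau>"
          using \<sigma> by blast
        then show False
          using \<open>y \<in> \<sigma>\<close> \<open>y \<in> A\<close> insert assms(5)[of z \<tau>] by blast
      qed
    qed (use insert assms(3) in auto)
  qed
  then show ?thesis using assms(1) by blast
qed

lemma collapsible_image:
  assumes "collapsible K" "inj_on g (\<Union>K)"
  shows "collapsible ((`) g ` K)"
  using assms
proof (induction rule: collapsible.induct)
  case void
  then show ?case by (simp add: collapsible.void)
next
  case (collapse K \<sigma> w)
  have inj: "inj_on ((`) g) K"
    using collapse.prems by (rule inj_on_image)
  have w: "insert (g w) (g ` \<sigma>) = g ` insert w \<sigma>" by simp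
  have "(`) g ` K - {g ` \<sigma>, insert (g w) (g ` \<sigma>)} = (`) g ` (K - {\<sigma>, insert w \<sigma>})"
    using collapse.hyps(2,3) by (subst inj_on_image_set_diff[OF inj]) auto
  moreover have "collapsible ((`) g ` (K - {\<sigma>, insert w \<sigma>}))"
    by (rule collapse.IH, rule inj_on_subset[OF collapse.prems]) blast
  ultimately have c: "collapsible ((`) g ` K - {g ` \<sigma>, insert (g w) (g ` \<sigma>)})" by simp
  show ?case
  proof (rule collapsible.collapse[OF c])
    show "g ` \<sigma> \<in> (`) g ` K" "insert (g w) (g ` \<sigma>) \<in> (`) g ` K"
      using collapse.hyps by (auto simp flip: image_insert)
    show "g w \<notin> g ` \<sigma>"
      using collapse.hyps collapse.prems by (subst inj_on_image_mem_iff[where B="\<Union>K"]) auto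
    fix \<tau> assume "\<tau> \<in> (`) g ` K" "g ` \<sigma> \<subseteq> \<tau>"
    then obtain \<tau>' where \<tau>': "\<tau>' \<in> K" "\<tau> = g ` \<tau>'" by blast
    with \<open>g ` \<sigma> \<subseteq> \<tau>\<close> have "\<sigma> \<subseteq> \<tau>'"
      using inj_on_image_subset_iff[OF collapse.prems, of \<sigma> \<tau>'] collapse.hyps(2) by blast
    then show "\<tau> = g ` \<sigma> \<or> \<tau> = insert (g w) (g ` \<sigma>)"
      using collapse.hyps(5)[of \<tau>'] \<tau>' by auto
  qed
qed

text \<open>The number \<open>e\<close> counts vertices, so the deleted facets have dimension
  \<open>e - 1\<close>, and \<open>e = 0\<close> means deleting the empty simplex. A common size is
  required because all spheres of the wedge have the same dimension.\<close>

definition removable_facets :: "'v set set \<Rightarrow> nat \<Rightarrow> 'v set set \<Rightarrow> bool" where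
  "removable_facets K e F \<longleftrightarrow> F \<subseteq> K \<and> finite F \<and> (\<forall>\<sigma>\<in>F. card \<sigma> = e) \<and>
     (\<forall>\<sigma>\<in>F. \<forall>\<tau>\<in>K. \<sigma> \<subseteq> \<tau> \<longrightarrow> \<tau> = \<sigma>) \<and> collapsible (K - F)"

text \<open>The number is an argument of a relation and not the value of a function, since different
  sets \<open>F\<close> might have different sizes as far as the combinatorics shows.\<close>

definition decomposable :: "'v set set \<Rightarrow> nat \<Rightarrow> nat \<Rightarrow> bool" where
  "decomposable K e N \<longleftrightarrow> (\<exists>F. removable_facets K e F \<and> card F = N)"

lemma decomposable_image:
  assumes "decomposable K e N" "inj_on g (\<Union>K)"
  shows "decomposable ((`) g ` K) e N"
proof -
  obtain F where F: "F \<subseteq> K" "finite F" "card F = N" "collapsible (K - F)"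
    "\<And>\<sigma>. \<sigma> \<in> F \<Longrightarrow> card \<sigma> = e" "\<And>\<sigma> \<tau>. \<lbrakk>\<sigma> \<in> F; \<tau> \<in> K; \<sigma> \<subseteq> \<tau>\<rbrakk> \<Longrightarrow> \<tau> = \<sigma>"
    using assms(1) unfolding decomposable_def removable_facets_def by (elim exE conjE) simp
  have inj: "inj_on ((`) g) K"
    using assms(2) by (rule inj_on_image)
  have "(`) g ` K - (`) g ` F = (`) g ` (K - F)"
    using inj_on_image_set_diff[OF inj, of K F] F(1) by blast
  moreover have "collapsible ((`) g ` (K - F))"
    by (rule collapsible_image[OF F(4)], rule inj_on_subset[OF assms(2)]) blast
  moreover have "card ((`) g ` F) = N"
    using F(1,3) inj by (metis card_image inj_on_subset)
  moreover have "card (g ` \<sigma>) = e" if "\<sigma> \<in> F" for \<sigma>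
  proof -
    have "inj_on g \<sigma>"
      by (rule inj_on_subset[OF assms(2)]) (use that F(1) in blast)
    then show ?thesis
      using F(5)[OF that] by (simp add: card_image)
  qed
  moreover have "\<tau> = g ` \<sigma>" if "\<sigma> \<in> F" "\<tau> \<in> (`) g ` K" "g ` \<sigma> \<subseteq> \<tau>" for \<sigma> \<tau>
  proof -
    obtain \<tau>' where \<tau>': "\<tau>' \<in> K" "\<tau> = g ` \<tau>'" using \<open>\<tau> \<in> _\<close> by blast
    have "\<sigma> \<subseteq> \<tau>'"
      using inj_on_image_subset_iff[OF assms(2), of \<sigma> \<tau>'] that(1,3) \<tau>' F(1) by blast
    then show ?thesis using F(6) that(1) \<tau>' by blast
  qed
  ultimately have "removable_facets ((`) g ` K) e ((`) g ` F)" and "card ((`) g ` F) = N"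
    using F(1,2) unfolding removable_facets_def by (simp_all add: image_mono)
  then show ?thesis unfolding decomposable_def by blast
qed

text \<open>The type-class order suffices because congruences are compared by inclusion of
  relations; only the final complex of partitions carries an explicit refinement relation.\<close>

definition finite_chains :: "'b::order set \<Rightarrow> 'b set set" where
  "finite_chains Q = {\<sigma>. finite \<sigma> \<and> \<sigma> \<subseteq> Q \<and> (\<forall>x\<in>\<sigma>. \<forall>y\<in>\<sigma>. x \<le> y \<or> y \<le> x)}"

lemma finite_finite_chains: "finite Q \<Longrightarrow> finite (finite_chains Q)"
  by (rule finite_subset[of _ "Pow Q"]) (auto simp: finite_chains_def)

lemma finite_chains_empty [simp]: "finite_chains {} = {{}}"
  by (auto simp: finite_chains_def)

text \<open>The function \<open>f\<close> is an interior operator bounded by \<open>s\<close>. If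
  \<open>x\<close> is a minimal point moved by \<open>f\<close>, everything strictly below
  \<open>x\<close> is fixed and hence lies below \<open>f x\<close>. The link of \<open>x\<close> is
  therefore a cone with apex \<open>f x\<close>, and \<open>x\<close> can be collapsed away. When no
  moved point is left, \<open>s\<close> is the greatest element and the complex is a cone.\<close>

lemma collapsible_finite_chains:
  fixes Q :: "'b::order set"
  assumes "finite Q" "s \<in> Q" "f s = s"
    and "\<And>x. x \<in> Q \<Longrightarrow> f x \<in> Q" "\<And>x. x \<in> Q \<Longrightarrow> f x \<le> x" "\<And>x. x \<in> Q \<Longrightarrow> f x \<le> s"
    and "\<And>x. x \<in> Q \<Longrightarrow> f (f x) = f x"
    and "\<And>x y. \<lbrakk>x \<in> Q; y \<in> Q; x \<le> y\<rbrakk> \<Longrightarrow> f x \<le> f y"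
  shows "collapsible (finite_chains Q)"
  using assms
proof (induction "card {x\<in>Q. f x \<noteq> x}" arbitrary: Q)
  case 0
  then have fix': "f x = x" if "x \<in> Q" for x
    using that by auto
  let ?L = "{\<sigma> \<in> finite_chains Q. s \<notin> \<sigma>}"
  have "finite_chains Q \<subseteq> ?L \<union> insert s ` ?L"
  proof
    fix \<sigma> assume \<sigma>: "\<sigma> \<in> finite_chains Q"
    then have "\<sigma> - {s} \<in> ?L" by (auto simp: finite_chains_def)
    moreover have "s \<in> \<sigma> \<Longrightarrow> \<sigma> = insert s (\<sigma> - {s})" by blast
    ultimately show "\<sigma> \<in> ?L \<union> insert s ` ?L"
      using \<sigma> by blast
  qed
  moreover have "insert s ` ?L \<subseteq> finite_chains Q"
    using "0.prems"(2,6) fix' by (fastforce simp: finite_chains_def)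
  ultimately have "finite_chains Q = ?L \<union> insert s ` ?L" by blast
  moreover have "collapsible (?L \<union> insert s ` ?L)"
    using finite_finite_chains[OF "0.prems"(1)] by (intro collapsible_cone) auto
  ultimately show ?case by argo
next
  case (Suc n)
  let ?N = "{x\<in>Q. f x \<noteq> x}"
  have "?N \<noteq> {}" using Suc.hyps(2) by (metis card.empty nat.distinct(1))
  moreover have "finite ?N" using Suc.prems(1) by simp
  ultimately  obtain x where x: "x \<in> Q" "f x \<noteq> x" and min: "\<And>z. z \<in> Q \<Longrightarrow> f z \<noteq> z \<Longrightarrow> z \<le> x \<Longrightarrow> z = x"
    using finite_has_minimal[of ?N] by blast
  \<comment> \<open>Minimality of \<open>x\<close> gives \<open>f z = z\<close>, and monotonicity
    gives \<open>f z \<le> f x\<close>.\<close>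
  have below: "z \<le> f x" if "z \<in> Q" "z \<le> x" "z \<noteq> x" for z
    using that min Suc.prems(8) x(1) by metis
  have above: "f x \<le> z" if "z \<in> Q" "x \<le> z" for z
    using that Suc.prems(5) x(1) order_trans by blast
  let ?D = "finite_chains (Q - {x})"
  \<comment> \<open>This is the link of \<open>x\<close>; it is split below into the faces with and
    without \<open>f x\<close>.\<close>
  let ?L = "{\<sigma> \<in> ?D. insert x \<sigma> \<in> finite_chains Q}"
  have D: "collapsible ?D"
  proof (rule Suc.hyps(1))
    have "{z \<in> Q - {x}. f z \<noteq> z} = ?N - {x}" by blast
    then show "n = card {z \<in> Q - {x}. f z \<noteq> z}"
      using Suc.hyps(2) x by simp
    show "s \<in> Q - {x}" using Suc.prems(2,3) x by auto
    show "f z \<in> Q - {x}" if "z \<in> Q - {x}" for z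
      using that Suc.prems(4,7) x by auto
  qed (use Suc.prems in auto)
  have fx: "f x \<in> Q - {x}" using Suc.prems(4) x by blast
  let ?L' = "{\<sigma> \<in> ?L. f x \<notin> \<sigma>}"
  have "?L \<subseteq> ?L' \<union> insert (f x) ` ?L'"
  proof
    fix \<sigma> assume \<sigma>: "\<sigma> \<in> ?L"
    then have "\<sigma> - {f x} \<in> ?L'" by (auto simp: finite_chains_def)
    moreover have "f x \<in> \<sigma> \<Longrightarrow> \<sigma> = insert (f x) (\<sigma> - {f x})" by blast
    ultimately show "\<sigma> \<in> ?L' \<union> insert (f x) ` ?L'"
      using \<sigma> by blast
  qed
  moreover have "insert (f x) \<sigma> \<in> ?L" if "\<sigma> \<in> ?L'" for \<sigma>
  proof -
    have *: "z \<le> f x \<or> f x \<le> z" if "z \<in> \<sigma>" for z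
    proof -
      have "z \<in> Q" "z \<noteq> x" "z \<le> x \<or> x \<le> z"
        using that \<open>\<sigma> \<in> ?L'\<close> unfolding finite_chains_def by auto
      then show ?thesis using below above by blast
    qed
    have "f x \<le> x" using Suc.prems(5) x by blast
    then show ?thesis
      using * that fx x(1) unfolding finite_chains_def by auto
  qed
  ultimately have "?L = ?L' \<union> insert (f x) ` ?L'" by blast
  moreover have "finite ?D"
    using Suc.prems(1) by (intro finite_finite_chains) auto
  then have "collapsible (?L' \<union> insert (f x) ` ?L')"
    by (intro collapsible_cone) auto
  ultimately have L: "collapsible ?L" by argo
  have "collapsible (?D \<union> insert x ` ?L)"
    using L D by (rule collapsible_Un_cone) (auto simp: finite_chains_def)
  moreover have "finite_chains Q = ?D \<union> insert x ` ?L"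
  proof -
    have "\<sigma> \<in> ?D \<union> insert x ` ?L" if \<sigma>: "\<sigma> \<in> finite_chains Q" for \<sigma>
    proof (cases "x \<in> \<sigma>")
      case True
      then have "\<sigma> = insert x (\<sigma> - {x})" by blast
      moreover have "\<sigma> - {x} \<in> ?L" using \<sigma> True by (auto simp: finite_chains_def insert_absorb)
      ultimately show ?thesis by blast
    qed (use \<sigma> in \<open>auto simp: finite_chains_def\<close>)
    moreover have "?D \<subseteq> finite_chains Q" by (auto simp: finite_chains_def)
    ultimately show ?thesis by blast
  qed
  ultimately show ?case by simp
qed

text \<open>The elements of \<open>A\<close> are minimal in \<open>Q\<close>, so a chain meets
  \<open>A\<close> in at most one element, which is its bottom. The chains over
  \<open>y \<in> A\<close> thus form a cone over the chains strictly above \<open>y\<close>, and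
  cones for different \<open>y\<close> share no face containing an apex. Adding the apex to a
  deleted facet raises its size by one.\<close>

lemma decomposable_finite_chains:
  fixes Q :: "'b::order set"
  assumes "finite Q" "A \<subseteq> Q"
    and min: "\<And>x y. \<lbrakk>y \<in> A; x \<in> Q; x \<le> y\<rbrakk> \<Longrightarrow> x = y"
    and D: "collapsible (finite_chains (Q - A))"
    and dec: "\<And>y. y \<in> A \<Longrightarrow> decomposable (finite_chains {x\<in>Q. y < x}) e (N y)"
  shows "decomposable (finite_chains Q) (Suc e) (\<Sum>y\<in>A. N y)"
proof -
  have finA: "finite A" using assms(2,1) by (rule finite_subset)
  let ?K = "\<lambda>y. finite_chains {x\<in>Q. y < x}"
  obtain F where F': "\<And>y. y \<in> A \<Longrightarrow> removable_facets (?K y) e (F y)"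
    and cardF: "\<And>y. y \<in> A \<Longrightarrow> card (F y) = N y"
    using dec unfolding decomposable_def by metis
  have F: "F y \<subseteq> ?K y" "finite (F y)" "card (F y) = N y" "\<And>\<sigma>. \<sigma> \<in> F y \<Longrightarrow> card \<sigma> = e"
    "\<And>\<sigma> \<tau>. \<sigma> \<in> F y \<Longrightarrow> \<tau> \<in> ?K y \<Longrightarrow> \<sigma> \<subseteq> \<tau> \<Longrightarrow> \<tau> = \<sigma>"
    "collapsible (?K y - F y)" if "y \<in> A" for y
    using F'[OF that] cardF[OF that] unfolding removable_facets_def by blast+
  have KA: "\<sigma> \<inter> A = {}" if "\<sigma> \<in> ?K y" "y \<in> A" for \<sigma> y
    using that min assms(2) unfolding finite_chains_def by (auto simp: less_le)
  have ins: "insert y \<tau> \<in> finite_chains Q \<longleftrightarrow> \<tau> \<in> ?K y" if "y \<in> A" "y \<notin> \<tau>" for y \<tau>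
  proof
    assume "insert y \<tau> \<in> finite_chains Q"
    then have \<tau>: "finite \<tau>" "\<tau> \<subseteq> Q" "\<forall>x\<in>\<tau>. \<forall>z\<in>\<tau>. x \<le> z \<or> z \<le> x" "\<forall>x\<in>\<tau>. x \<le> y \<or> y \<le> x"
      by (simp_all add: finite_chains_def)
    have "y < x" if "x \<in> \<tau>" for x
      using \<tau>(2,4) that min[OF \<open>y \<in> A\<close>, of x] \<open>y \<notin> \<tau>\<close> by (metis in_mono order_le_less)
    with \<tau> show "\<tau> \<in> ?K y" unfolding finite_chains_def by blast
  next
    assume "\<tau> \<in> ?K y"
    then have \<tau>: "finite \<tau>" "\<tau> \<subseteq> Q" "\<forall>x\<in>\<tau>. \<forall>z\<in>\<tau>. x \<le> z \<or> z \<le> x" "\<And>x. x \<in> \<tau> \<Longrightarrow> y \<le> x"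
      unfolding finite_chains_def by (blast intro: less_imp_le)+
    moreover have "y \<in> Q" using \<open>y \<in> A\<close> assms(2) by blast
    ultimately show "insert y \<tau> \<in> finite_chains Q"
      unfolding finite_chains_def by simp
  qed
  define FF where "FF = (\<Union>y\<in>A. insert y ` F y)"
  have decQ: "finite_chains Q = finite_chains (Q - A) \<union> (\<Union>y\<in>A. insert y ` ?K y)" (is "_ = ?R")
  proof (intro equalityI subsetI)
    fix \<sigma> assume \<sigma>: "\<sigma> \<in> finite_chains Q"
    show "\<sigma> \<in> ?R"
    proof (cases "\<sigma> \<inter> A = {}")
      case True
      then show ?thesis using \<sigma> by (auto simp: finite_chains_def)
    next
      case False
      then obtain y where y: "y \<in> \<sigma>" "y \<in> A" by blast
      then have eq: "insert y (\<sigma> - {y}) = \<sigma>" by blast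
      with \<sigma> have "\<sigma> - {y} \<in> ?K y"
        using ins[OF y(2), of "\<sigma> - {y}"] by simp
      then show ?thesis using eq y(2) by (metis (no_types, lifting) UN_I UnI2 imageI)
    qed
  next
    fix \<sigma> assume "\<sigma> \<in> ?R"
    then show "\<sigma> \<in> finite_chains Q"
    proof
      assume "\<sigma> \<in> finite_chains (Q - A)"
      then show ?thesis by (auto simp: finite_chains_def)
    next
      assume "\<sigma> \<in> (\<Union>y\<in>A. insert y ` ?K y)"
      then obtain y \<tau> where "y \<in> A" "\<tau> \<in> ?K y" "\<sigma> = insert y \<tau>" by blast
      then show ?thesis using ins[of y \<tau>] KA[of \<tau> y] by blast
    qed
  qed
  \<comment> \<open>The apex can be read off a face as its only vertex in \<open>A\<close>; this
    makes the families of deleted facets disjoint, so that their sizes add.\<close>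
  have uniq: "y = z \<and> \<tau> = \<tau>'"
    if "y \<in> A" "z \<in> A" "\<tau> \<in> ?K y" "\<tau>' \<in> ?K z" "insert y \<tau> = insert z \<tau>'" for y z \<tau> \<tau>'
  proof -
    have d: "\<tau> \<inter> A = {}" "\<tau>' \<inter> A = {}" using KA that by blast+
    then have "y = z" using that by blast
    moreover have "y \<notin> \<tau>" "z \<notin> \<tau>'" using d that by blast+
    ultimately show ?thesis using that(5) insert_ident[of y \<tau> \<tau>'] by simp
  qed
  have "finite_chains Q - FF = finite_chains (Q - A) \<union> (\<Union>y\<in>A. insert y ` (?K y - F y))" (is "?l = ?r")
  proof (intro equalityI subsetI)
    fix \<sigma> assume "\<sigma> \<in> ?l"
    then have nFF: "\<sigma> \<notin> FF" and "\<sigma> \<in> ?R" using decQ by blast+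
    then consider "\<sigma> \<in> finite_chains (Q - A)" | y \<tau> where "y \<in> A" "\<tau> \<in> ?K y" "\<sigma> = insert y \<tau>"
      by blast
    then show "\<sigma> \<in> ?r"
    proof cases
      case 2
      then have "\<tau> \<notin> F y" using nFF unfolding FF_def by blast
      with 2 show ?thesis by blast
    qed blast
  next
    fix \<sigma> assume "\<sigma> \<in> ?r"
    then show "\<sigma> \<in> ?l"
    proof
      assume \<sigma>: "\<sigma> \<in> finite_chains (Q - A)"
      then have "\<sigma> \<inter> A = {}" unfolding finite_chains_def by blast
      then have "\<sigma> \<notin> FF" unfolding FF_def by blast
      then show ?thesis using decQ \<sigma> by blast
    next
      assume "\<sigma> \<in> (\<Union>y\<in>A. insert y ` (?K y - F y))"
      then obtain y \<tau> where \<sigma>: "y \<in> A" "\<tau> \<in> ?K y" "\<tau> \<notin> F y" "\<sigma> = insert y \<tau>" by blast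
      have "\<sigma> \<notin> FF"
      proof
        assume "\<sigma> \<in> FF"
        then obtain z \<tau>' where z: "z \<in> A" "\<tau>' \<in> F z" "\<sigma> = insert z \<tau>'" unfolding FF_def by blast
        then have "\<tau>' \<in> ?K z" using F(1) by blast
        then have "y = z \<and> \<tau> = \<tau>'" using uniq[of y z \<tau> \<tau>'] \<sigma> z by simp
        then show False using z \<sigma> by blast
      qed
      moreover have "\<sigma> \<in> finite_chains Q" using decQ \<sigma> by blast
      ultimately show ?thesis by blast
    qed
  qed
  moreover have "collapsible ?r"
  proof (rule collapsible_Un_cones[OF finA D])
    show "\<sigma> \<inter> A = {}" if "\<sigma> \<in> finite_chains (Q - A)" for \<sigma>
      using that unfolding finite_chains_def by blast
    show "\<sigma> \<inter> A = {}" if "y \<in> A" "\<sigma> \<in> ?K y - F y" for y \<sigma>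
      using KA that by blast
  qed (rule F(6))
  ultimately have "collapsible (finite_chains Q - FF)" by simp
  moreover have "FF \<subseteq> finite_chains Q"
    using F(1) ins KA unfolding FF_def by blast
  moreover have "card FF = (\<Sum>y\<in>A. N y)"
  proof -
    have "card FF = (\<Sum>y\<in>A. card (insert y ` F y))"
      unfolding FF_def
    proof (rule card_UN_disjoint[OF finA])
      show "\<forall>i\<in>A. \<forall>j\<in>A. i \<noteq> j \<longrightarrow> insert i ` F i \<inter> insert j ` F j = {}"
      proof (intro ballI impI equals0I)
        fix i j \<sigma> assume ij: "i \<in> A" "j \<in> A" "i \<noteq> j" "\<sigma> \<in> insert i ` F i \<inter> insert j ` F j"
        then obtain \<tau> \<tau>' where "\<tau> \<in> F i" "\<tau>' \<in> F j" "insert i \<tau> = insert j \<tau>'" by blast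
        then show False using uniq[of i j \<tau> \<tau>'] F(1) ij by blast
      qed
    qed (use F(2) in auto)
    also have "\<dots> = (\<Sum>y\<in>A. N y)"
    proof (rule sum.cong[OF refl])
      fix y assume y: "y \<in> A"
      have "inj_on (insert y) (F y)"
        using uniq[OF y y] F(1)[OF y] unfolding inj_on_def by (meson in_mono)
      then show "card (insert y ` F y) = N y"
        using F(3)[OF y] by (simp add: card_image)
    qed
    finally show ?thesis .
  qed
  moreover have "finite FF" unfolding FF_def using F(2) finA by blast
  moreover have "card \<sigma> = Suc e \<and> (\<forall>\<tau>\<in>finite_chains Q. \<sigma> \<subseteq> \<tau> \<longrightarrow> \<tau> = \<sigma>)" if \<sigma>: "\<sigma> \<in> FF" for \<sigma>
  proof -
    obtain y \<rho> where y: "y \<in> A" "\<rho> \<in> F y" "\<sigma> = insert y \<rho>" using \<sigma> unfolding FF_def by blast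
    have "\<rho> \<in> ?K y" using F(1) y by blast
    then have "finite \<rho>" "y \<notin> \<rho>" using KA[of \<rho> y] y by (auto simp: finite_chains_def)
    then have "card \<sigma> = Suc e" using F(4) y by simp
    moreover have "\<tau> = \<sigma>" if \<tau>: "\<tau> \<in> finite_chains Q" "\<sigma> \<subseteq> \<tau>" for \<tau>
    proof -
      have eq: "insert y (\<tau> - {y}) = \<tau>" using \<tau> y by blast
      then have "\<tau> - {y} \<in> ?K y" using ins[OF y(1), of "\<tau> - {y}"] \<tau>(1) by simp
      moreover have "\<rho> \<subseteq> \<tau> - {y}" using \<tau>(2) y \<open>y \<notin> \<rho>\<close> by blast
      ultimately have "\<tau> - {y} = \<rho>" using F(5) y by blast
      then show ?thesis using eq y by blast
    qed
    ultimately show ?thesis by blast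
  qed
  ultimately show ?thesis
    unfolding decomposable_def removable_facets_def by (intro exI[of _ FF] conjI) simp_all
qed

section \<open>Order congruences\<close>

text \<open>Order congruences in terms of reachability: two points on a common circle are two points
  reachable from each other. Using \<open>r\<close> in place of \<open>r - Id\<close> changes
  nothing, since its diagonal pairs already lie in the reflexive relation \<rho>.\<close>

definition congruences :: "'a set \<Rightarrow> 'a rel \<Rightarrow> 'a rel set" where
  "congruences P r = {\<rho>. equiv P \<rho> \<and> (\<forall>x y. (x, y) \<in> (\<rho> \<union> r)\<^sup>+ \<longrightarrow> (y, x) \<in> (\<rho> \<union> r)\<^sup>+ \<longrightarrow> (x, y) \<in> \<rho>)}"

definition proper_congruences :: "'a set \<Rightarrow> 'a rel \<Rightarrow> 'a rel set" where
  "proper_congruences P r = congruences P r - {Id_on P, P \<times> P}"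

lemma congruences_subset: "\<rho> \<in> congruences P r \<Longrightarrow> \<rho> \<subseteq> P \<times> P"
  by (auto simp: congruences_def equiv_def)

lemma trancl_subset:
  assumes "r \<subseteq> P \<times> P" "\<rho> \<subseteq> P \<times> P"
  shows "(\<rho> \<union> r)\<^sup>+ \<subseteq> P \<times> P"
  using assms by (intro trancl_subset_Sigma) auto

lemma rho_sequence_imp_trancl:
  assumes "rho_sequence P r \<rho> xs" "equiv P \<rho>" "i \<le> j" "j < length xs"
  shows "(xs ! i, xs ! j) \<in> (\<rho> \<union> r)\<^sup>+"
  using assms(3,4)
proof (induction j rule: dec_induct)
  case base
  have "xs ! i \<in> P" using assms(1) base unfolding rho_sequence_def by auto
  then show ?case using assms(2) by (auto simp: equiv_def refl_on_def)
next
  case (step j)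
  have "(xs ! j, xs ! Suc j) \<in> \<rho> \<union> r"
    using assms(1) step.prems unfolding rho_sequence_def successively_conv_nth by auto
  moreover have "(xs ! i, xs ! j) \<in> (\<rho> \<union> r)\<^sup>+" using step by simp
  ultimately show ?case by (meson trancl.simps)
qed

lemma trancl_imp_rho_sequence:
  assumes "(x, y) \<in> (\<rho> \<union> r)\<^sup>+" "equiv P \<rho>" "r \<subseteq> P \<times> P"
  shows "\<exists>xs. rho_sequence P r \<rho> xs \<and> hd xs = x \<and> last xs = y"
  using assms(1)
proof (induction rule: converse_trancl_induct)
  case (base x)
  have "x \<in> P" "y \<in> P" using base assms by (auto simp: equiv_def)
  moreover have "(x, x) \<in> \<rho>" using assms(2) \<open>x \<in> P\<close> by (auto simp: equiv_def refl_on_def)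
  ultimately show ?case using base
    by (intro exI[of _ "[x, y]"]) (auto simp: rho_sequence_def)
next
  case (step x z)
  then obtain xs where xs: "rho_sequence P r \<rho> xs" "hd xs = z" "last xs = y" by blast
  have "x \<in> P" using step assms by (auto simp: equiv_def)
  moreover have "(x, x) \<in> \<rho>" using assms(2) \<open>x \<in> P\<close> by (auto simp: equiv_def refl_on_def)
  ultimately show ?case using step(1) xs
    by (intro exI[of _ "x # xs"]) (auto simp: rho_sequence_def successively_Cons)
qed

lemma ex_rho_sequence_iff:
  assumes "equiv P \<rho>" "r \<subseteq> P \<times> P"
  shows "(\<exists>xs. rho_sequence P r \<rho> xs \<and> hd xs = x \<and> last xs = y) \<longleftrightarrow> (x, y) \<in> (\<rho> \<union> r)\<^sup>+"
proof
  assume "\<exists>xs. rho_sequence P r \<rho> xs \<and> hd xs = x \<and> last xs = y"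
  then obtain xs where xs: "rho_sequence P r \<rho> xs" "hd xs = x" "last xs = y" by blast
  then have "xs \<noteq> []" by (auto simp: rho_sequence_def)
  then show "(x, y) \<in> (\<rho> \<union> r)\<^sup>+"
    using rho_sequence_imp_trancl[OF xs(1) assms(1), of 0 "length xs - 1"] xs
    by (simp add: hd_conv_nth last_conv_nth)
qed (rule trancl_imp_rho_sequence[OF _ assms])

text \<open>Mutual reachability gives two sequences whose concatenation is a circle, the repeated
  point at the joint being allowed by reflexivity. Conversely, every point of a circle reaches, and
  is reached from, its first point.\<close>

lemma order_congruence_iff:
  assumes "r \<subseteq> P \<times> P"
  shows "order_congruence P r \<rho> \<longleftrightarrow> \<rho> \<in> congruences P r"
proof (cases "equiv P \<rho>")
  case False
  then show ?thesis by (simp add: order_congruence_def congruences_def)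
next
  case eq: True
  show ?thesis
  proof
    assume oc: "order_congruence P r \<rho>"
    have "(x, y) \<in> \<rho>" if xy: "(x, y) \<in> (\<rho> \<union> r)\<^sup>+" "(y, x) \<in> (\<rho> \<union> r)\<^sup>+" for x y
    proof -
      obtain xs where xs: "rho_sequence P r \<rho> xs" "hd xs = x" "last xs = y"
        using trancl_imp_rho_sequence[OF xy(1) eq assms] by blast
      obtain ys where ys: "rho_sequence P r \<rho> ys" "hd ys = y" "last ys = x"
        using trancl_imp_rho_sequence[OF xy(2) eq assms] by blast
      have ne: "xs \<noteq> []" "ys \<noteq> []" using xs ys by (auto simp: rho_sequence_def)
      have "y \<in> set xs" "x \<in> set xs" using xs ne by auto
      then have "x \<in> P" "y \<in> P" using xs by (auto simp: rho_sequence_def)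
      then have "(y, y) \<in> \<rho>" using eq by (auto simp: equiv_def refl_on_def)
      then have "rho_circle P r \<rho> (xs @ ys)"
        using xs ys ne by (auto simp: rho_circle_def rho_sequence_def successively_append_iff)
      then have "\<rho> `` {x} = \<rho> `` {y}"
        using oc \<open>x \<in> set xs\<close> \<open>y \<in> set xs\<close> by (simp add: order_congruence_def)
      then show ?thesis using eq \<open>x \<in> P\<close> \<open>y \<in> P\<close> by (simp add: eq_equiv_class_iff)
    qed
    then show "\<rho> \<in> congruences P r" using eq by (simp add: congruences_def)
  next
    assume c: "\<rho> \<in> congruences P r"
    have "\<rho> `` {x} = \<rho> `` {y}" if xs: "rho_circle P r \<rho> xs" "x \<in> set xs" "y \<in> set xs" for xs x y
    proof -
      have seq: "rho_sequence P r \<rho> xs" and ne: "xs \<noteq> []" and hl: "hd xs = last xs"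
        using xs by (auto simp: rho_circle_def rho_sequence_def)
      have *: "(z, hd xs) \<in> (\<rho> \<union> r)\<^sup>+ \<and> (hd xs, z) \<in> (\<rho> \<union> r)\<^sup>+" if z: "z \<in> set xs" for z
      proof -
        obtain i where i: "i < length xs" "z = xs ! i" using z by (auto simp: in_set_conv_nth)
        have "(xs ! i, last xs) \<in> (\<rho> \<union> r)\<^sup>+" "(hd xs, xs ! i) \<in> (\<rho> \<union> r)\<^sup>+"
          using rho_sequence_imp_trancl[OF seq eq, of i "length xs - 1"]
            rho_sequence_imp_trancl[OF seq eq, of 0 i] ne i
          by (simp_all add: last_conv_nth hd_conv_nth)
        then show ?thesis using i hl by metis
      qed
      have "(x, hd xs) \<in> \<rho>" "(y, hd xs) \<in> \<rho>"
        using * xs c by (auto simp: congruences_def)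
      then show ?thesis using eq by (metis equiv_class_eq)
    qed
    then show "order_congruence P r \<rho>" using eq unfolding order_congruence_def by blast
  qed
qed

lemma quotient_order_eq:
  assumes "equiv P \<rho>" "r \<subseteq> P \<times> P"
  shows "quotient_order P r \<rho> = {(\<rho> `` {x}, \<rho> `` {y}) | x y. (x, y) \<in> (\<rho> \<union> r)\<^sup>+}"
  unfolding quotient_order_def ex_rho_sequence_iff[OF assms] ..

text \<open>Reachability along the intersection implies reachability along each of the two
  relations. The lemma supplies the map that sends \<rho> to
  \<open>\<rho> \<inter> s\<close>.\<close>

lemma congruences_Int:
  assumes "\<rho> \<in> congruences P r" "\<sigma> \<in> congruences P r"
  shows "\<rho> \<inter> \<sigma> \<in> congruences P r"
proof -
  have "equiv P (\<rho> \<inter> \<sigma>)"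
    using assms by (auto simp: congruences_def equiv_def refl_on_def intro: sym_Int trans_Int)
  moreover have "((\<rho> \<inter> \<sigma>) \<union> r)\<^sup>+ \<subseteq> (\<rho> \<union> r)\<^sup>+" "((\<rho> \<inter> \<sigma>) \<union> r)\<^sup>+ \<subseteq> (\<sigma> \<union> r)\<^sup>+"
    by (auto intro: trancl_mono)
  ultimately show ?thesis
    using assms unfolding congruences_def by blast
qed

text \<open>\<open>P'\<close> is a model of the quotient of \<open>P\<close> by \<kappa>, in a type
  of its own. One instance has carrier \<open>P - {a}\<close>, with \<open>b\<close> standing for
  the merged class; the other has the classes themselves as elements.\<close>

locale quotient_map_poset =
  fixes P :: "'a set" and r :: "'a rel" and P' :: "'b set" and r' :: "'b rel" and g :: "'a \<Rightarrow> 'b"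
    and \<kappa> :: "'a rel"
  assumes r: "partial_order_on P r"
    and \<kappa>: "\<kappa> \<in> congruences P r"
    and surj: "g ` P = P'"
    and r': "r' \<subseteq> P' \<times> P'"
    and ker: "\<And>x y. \<lbrakk>x \<in> P; y \<in> P\<rbrakk> \<Longrightarrow> g x = g y \<longleftrightarrow> (x, y) \<in> \<kappa>"
    and ord: "\<And>x y. \<lbrakk>x \<in> P; y \<in> P\<rbrakk> \<Longrightarrow> (g x, g y) \<in> r' \<longleftrightarrow> (x, y) \<in> (\<kappa> \<union> r)\<^sup>+"
begin

definition pull :: "'b rel \<Rightarrow> 'a rel" where
  "pull \<sigma> = {(x, y) \<in> P \<times> P. (g x, g y) \<in> \<sigma>}"

lemma rP: "r \<subseteq> P \<times> P"
  using r by (simp add: order_on_defs)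

lemma \<kappa>P: "\<kappa> \<subseteq> P \<times> P"
  using \<kappa> by (rule congruences_subset)

lemma pull_mono_iff:
  assumes "\<sigma> \<subseteq> P' \<times> P'"
  shows "pull \<sigma> \<subseteq> pull \<tau> \<longleftrightarrow> \<sigma> \<subseteq> \<tau>"
proof
  assume *: "pull \<sigma> \<subseteq> pull \<tau>"
  show "\<sigma> \<subseteq> \<tau>"
  proof (rule subrelI)
    fix u v assume uv: "(u, v) \<in> \<sigma>"
    then obtain x y where "x \<in> P" "y \<in> P" "u = g x" "v = g y" using assms surj by blast
    then show "(u, v) \<in> \<tau>" using * uv unfolding pull_def by blast
  qed
qed (auto simp: pull_def)

text \<open>Antisymmetry is exactly the congruence condition on \<kappa>; reflexivity and
  transitivity are inherited from reachability.\<close>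

lemma partial_order_quotient: "partial_order_on P' r'"
proof -
  have refl: "refl_on P r" using r by (simp add: order_on_defs)
  have "(x, x) \<in> (\<kappa> \<union> r)\<^sup>+" if "x \<in> P" for x
    using refl that by (auto simp: refl_on_def)
  then have "refl_on P' r'"
    unfolding refl_on_def surj[symmetric] using ord by auto
  moreover have "trans r'"
  proof (rule transI)
    fix u v w assume *: "(u, v) \<in> r'" "(v, w) \<in> r'"
    then obtain x y z where "x \<in> P" "y \<in> P" "z \<in> P" "u = g x" "v = g y" "w = g z"
      using r' surj by blast
    then show "(u, w) \<in> r'" using * ord by (metis trancl_trans)
  qed
  moreover have "antisym r'"
  proof (rule antisymI)
    fix u v assume *: "(u, v) \<in> r'" "(v, u) \<in> r'"
    then obtain x y where "x \<in> P" "y \<in> P" "u = g x" "v = g y"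
      using r' surj by blast
    then show "u = v" using * ord ker \<kappa> unfolding congruences_def by blast
  qed
  ultimately show ?thesis using r' by (simp add: order_on_defs)
qed

text \<open>A step of \<open>r'\<close> lifts to a path in \<open>\<kappa> \<union> r\<close>, and
  \<kappa> lies in \<open>pull \<sigma>\<close> because \<sigma> is reflexive. So paths below lift,
  whichever representatives of the intermediate points are chosen.\<close>

lemma pull_trancl:
  assumes "\<sigma> \<subseteq> P' \<times> P'" "refl_on P' \<sigma>" "x \<in> P" "y \<in> P"
  shows "(x, y) \<in> (pull \<sigma> \<union> r)\<^sup>+ \<longleftrightarrow> (g x, g y) \<in> (\<sigma> \<union> r')\<^sup>+"
proof
  assume "(x, y) \<in> (pull \<sigma> \<union> r)\<^sup>+"
  then show "(g x, g y) \<in> (\<sigma> \<union> r')\<^sup>+"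
  proof (induction rule: trancl_induct)
    case (base z)
    then show ?case using rP ord[of x z] by (auto simp: pull_def)
  next
    case (step z w)
    then have "(g z, g w) \<in> \<sigma> \<union> r'" using rP ord[of z w] by (auto simp: pull_def)
    then show ?case using step(3) by (meson trancl.simps)
  qed
next
  have k: "\<kappa> \<subseteq> pull \<sigma>"
    using \<kappa>P ker assms(2) surj unfolding pull_def refl_on_def by fastforce
  have one: "(x, y) \<in> (pull \<sigma> \<union> r)\<^sup>+" if "(g x, g y) \<in> \<sigma> \<union> r'" "x \<in> P" "y \<in> P" for x y
  proof (cases "(g x, g y) \<in> \<sigma>")
    case True
    then show ?thesis using that by (auto simp: pull_def)
  next
    case False
    then have "(x, y) \<in> (\<kappa> \<union> r)\<^sup>+" using that ord by blast
    then show ?thesis using k by (meson Un_mono order_refl trancl_mono)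
  qed
  assume "(g x, g y) \<in> (\<sigma> \<union> r')\<^sup>+"
  then have "\<forall>y\<in>P. v = g y \<longrightarrow> (x, y) \<in> (pull \<sigma> \<union> r)\<^sup>+" if "v = g y" for v
    unfolding that
  proof (induction rule: trancl_induct)
    case (base v)
    then show ?case using one assms(3) by blast
  next
    case (step v w)
    then obtain z where "z \<in> P" "v = g z" using assms(1) r' surj by blast
    then have "(x, z) \<in> (pull \<sigma> \<union> r)\<^sup>+" using step.IH by blast
    moreover have "(z, y) \<in> (pull \<sigma> \<union> r)\<^sup>+" if "y \<in> P" "w = g y" for y
      using one[of z y] \<open>z \<in> P\<close> \<open>v = g z\<close> step.hyps(2) that by blast
    ultimately show ?case by (blast intro: trancl_trans)
  qed
  then show "(x, y) \<in> (pull \<sigma> \<union> r)\<^sup>+" using assms(4) by blast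
qed

text \<open>This is the correspondence theorem. The inverse takes \<rho> to its image under
  \<open>g\<close> in both coordinates; pulling back recovers \<rho> because points with equal
  images are related by \<kappa> and hence by \<rho>.\<close>

lemma pull_congruences: "pull ` congruences P' r' = {\<rho> \<in> congruences P r. \<kappa> \<subseteq> \<rho>}"
proof (intro equalityI subsetI)
  fix \<rho> assume "\<rho> \<in> pull ` congruences P' r'"
  then obtain \<sigma> where \<sigma>: "\<sigma> \<in> congruences P' r'" "\<rho> = pull \<sigma>" by blast
  have eq: "equiv P' \<sigma>" using \<sigma> by (simp add: congruences_def)
  then have sub: "\<sigma> \<subseteq> P' \<times> P'" and refl: "refl_on P' \<sigma>" by (auto simp: equiv_def)
  have "\<kappa> \<subseteq> pull \<sigma>"
    using \<kappa>P ker refl surj unfolding pull_def refl_on_def by fastforce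
  moreover have "equiv P (pull \<sigma>)"
  proof (rule equivI)
    show "pull \<sigma> \<subseteq> P \<times> P" by (auto simp: pull_def)
    show "refl_on P (pull \<sigma>)" using refl surj by (auto simp: pull_def refl_on_def)
    show "sym (pull \<sigma>)" using eq unfolding equiv_def sym_def pull_def by blast
    show "trans (pull \<sigma>)" using eq unfolding equiv_def trans_def pull_def by blast
  qed
  moreover have "(x, y) \<in> pull \<sigma>" if xy: "(x, y) \<in> (pull \<sigma> \<union> r)\<^sup>+" "(y, x) \<in> (pull \<sigma> \<union> r)\<^sup>+" for x y
  proof -
    have "x \<in> P" "y \<in> P"
      using trancl_subset[OF rP, of "pull \<sigma>"] xy by (auto simp: pull_def)
    then show ?thesis
      using xy \<sigma>(1) pull_trancl[OF sub refl] unfolding congruences_def pull_def by blast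
  qed
  ultimately show "\<rho> \<in> {\<rho> \<in> congruences P r. \<kappa> \<subseteq> \<rho>}"
    using \<sigma> by (simp add: congruences_def)
next
  fix \<rho> assume "\<rho> \<in> {\<rho> \<in> congruences P r. \<kappa> \<subseteq> \<rho>}"
  then have \<rho>: "\<rho> \<in> congruences P r" "\<kappa> \<subseteq> \<rho>" by auto
  then have eq: "equiv P \<rho>" by (simp add: congruences_def)
  then have \<rho>P: "\<rho> \<subseteq> P \<times> P" by (auto simp: equiv_def)
  define \<sigma> where "\<sigma> = {(g x, g y) | x y. (x, y) \<in> \<rho>}"
  have \<sigma>_iff: "(g x, g y) \<in> \<sigma> \<longleftrightarrow> (x, y) \<in> \<rho>" if "x \<in> P" "y \<in> P" for x y
  proof
    assume "(g x, g y) \<in> \<sigma>"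
    then obtain x' y' where "(x', y') \<in> \<rho>" "g x = g x'" "g y = g y'" unfolding \<sigma>_def by blast
    then have "(x, x') \<in> \<rho>" "(y, y') \<in> \<rho>" using ker that \<rho>P \<rho>(2) by blast+
    then show "(x, y) \<in> \<rho>" using eq \<open>(x', y') \<in> \<rho>\<close>
      unfolding equiv_def by (meson symD transD)
  qed (auto simp: \<sigma>_def)
  then have pull: "pull \<sigma> = \<rho>" using \<rho>P by (auto simp: pull_def)
  have sub: "\<sigma> \<subseteq> P' \<times> P'" using \<rho>P surj by (auto simp: \<sigma>_def)
  have "equiv P' \<sigma>"
  proof (rule equivI[OF sub])
    show refl: "refl_on P' \<sigma>"
      using eq \<sigma>_iff unfolding surj[symmetric] equiv_def refl_on_def by auto
    show "sym \<sigma>" using eq unfolding \<sigma>_def equiv_def sym_def by blast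
    show "trans \<sigma>"
    proof (rule transI)
      fix u v w assume *: "(u, v) \<in> \<sigma>" "(v, w) \<in> \<sigma>"
      then obtain x y z where "x \<in> P" "y \<in> P" "z \<in> P" "u = g x" "v = g y" "w = g z"
        using sub surj by blast
      then show "(u, w) \<in> \<sigma>" using * \<sigma>_iff eq by (metis equivE transD)
    qed
  qed
  moreover have "(u, v) \<in> \<sigma>" if uv: "(u, v) \<in> (\<sigma> \<union> r')\<^sup>+" "(v, u) \<in> (\<sigma> \<union> r')\<^sup>+" for u v
  proof -
    have "u \<in> P'" "v \<in> P'" using trancl_subset[OF r' sub] uv by auto
    then obtain x y where xy: "x \<in> P" "y \<in> P" "u = g x" "v = g y" using surj by blast
    have "refl_on P' \<sigma>" using \<open>equiv P' \<sigma>\<close> by (simp add: equiv_def)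
    then have "(x, y) \<in> (\<rho> \<union> r)\<^sup>+" "(y, x) \<in> (\<rho> \<union> r)\<^sup>+"
      using pull_trancl[OF sub] uv xy pull by auto
    then show ?thesis using \<rho>(1) \<sigma>_iff xy by (auto simp: congruences_def)
  qed
  ultimately have "\<sigma> \<in> congruences P' r'" by (simp add: congruences_def)
  then show "\<rho> \<in> pull ` congruences P' r'" using pull by blast
qed

lemma pull_Id_on: "pull (Id_on P') = \<kappa>"
proof -
  have "(g x, g y) \<in> Id_on P' \<longleftrightarrow> (x, y) \<in> \<kappa>" if "x \<in> P" "y \<in> P" for x y
    using ker[OF that] that surj by auto
  moreover have "x \<in> P \<and> y \<in> P" if "(x, y) \<in> \<kappa>" for x y
    using \<kappa>P that by blast
  ultimately have "(x, y) \<in> pull (Id_on P') \<longleftrightarrow> (x, y) \<in> \<kappa>" for x y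
    unfolding pull_def mem_Collect_eq case_prod_conv mem_Sigma_iff by meson
  then show ?thesis by (simp add: set_eq_iff split_paired_all)
qed

lemma pull_Times: "pull (P' \<times> P') = P \<times> P"
  using surj by (auto simp: pull_def)

lemma inj_on_pull: "inj_on pull {\<sigma>. \<sigma> \<subseteq> P' \<times> P'}"
  by (rule inj_onI) (metis pull_mono_iff mem_Collect_eq order_refl subset_antisym)

text \<open>Bottom and top of the quotient correspond to \<kappa> and \<open>P \<times> P\<close>;
  leaving them out turns the upper interval of \<kappa> into the strict upper interval inside the
  proper part.\<close>

lemma pull_proper_congruences:
  assumes "\<kappa> \<noteq> Id_on P"
  shows "pull ` proper_congruences P' r' = {\<rho> \<in> proper_congruences P r. \<kappa> \<subset> \<rho>}"
proof -
  have "pull ` (congruences P' r' - {Id_on P', P' \<times> P'}) =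
      pull ` congruences P' r' - pull ` {Id_on P', P' \<times> P'}"
    by (rule inj_on_image_set_diff[OF inj_on_pull]) (auto dest: congruences_subset)
  also have "\<dots> = {\<rho> \<in> congruences P r. \<kappa> \<subseteq> \<rho>} - {\<kappa>, P \<times> P}"
    by (simp add: pull_congruences pull_Id_on pull_Times)
  also have "\<dots> = {\<rho> \<in> proper_congruences P r. \<kappa> \<subset> \<rho>}"
  proof -
    have "Id_on P \<subseteq> \<kappa>" using \<kappa> by (auto simp: congruences_def equiv_def refl_on_def)
    then show ?thesis using assms by (auto simp: proper_congruences_def)
  qed
  finally show ?thesis by (simp add: proper_congruences_def)
qed

lemma pull_finite_chains:
  assumes "\<kappa> \<noteq> Id_on P"
  shows "finite_chains {\<rho> \<in> proper_congruences P r. \<kappa> \<subset> \<rho>} =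
    (`) pull ` finite_chains (proper_congruences P' r')" (is "?l = ?r")
proof -
  have sub: "proper_congruences P' r' \<subseteq> {\<sigma>. \<sigma> \<subseteq> P' \<times> P'}"
    by (auto simp: proper_congruences_def dest: congruences_subset)
  have 1: "pull ` C \<in> ?l" if C: "C \<in> finite_chains (proper_congruences P' r')" for C
  proof -
    have "pull ` C \<subseteq> pull ` proper_congruences P' r'"
      using C by (intro image_mono) (auto simp: finite_chains_def)
    moreover have "pull \<sigma> \<subseteq> pull \<tau> \<or> pull \<tau> \<subseteq> pull \<sigma>" if "\<sigma> \<in> C" "\<tau> \<in> C" for \<sigma> \<tau>
      using C that by (auto simp: finite_chains_def pull_def)
    ultimately show ?thesis
      using C unfolding pull_proper_congruences[OF assms] finite_chains_def by simp
  qed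
  have 2: "D \<in> ?r" if D: "D \<in> ?l" for D
  proof -
    have "D \<subseteq> pull ` proper_congruences P' r'" "finite D"
      using D by (auto simp: finite_chains_def pull_proper_congruences[OF assms])
    then obtain C where C: "C \<subseteq> proper_congruences P' r'" "finite C" "D = pull ` C"
      by (meson finite_subset_image)
    have "\<sigma> \<subseteq> \<tau> \<or> \<tau> \<subseteq> \<sigma>" if "\<sigma> \<in> C" "\<tau> \<in> C" for \<sigma> \<tau>
    proof -
      have "pull \<sigma> \<subseteq> pull \<tau> \<or> pull \<tau> \<subseteq> pull \<sigma>"
        using D that unfolding finite_chains_def C(3) by blast
      moreover have "\<sigma> \<subseteq> P' \<times> P'" "\<tau> \<subseteq> P' \<times> P'" using sub C that by blast+
      ultimately show ?thesis by (simp add: pull_mono_iff)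
    qed
    then show ?thesis using C by (auto simp: finite_chains_def)
  qed
  show ?thesis by (intro equalityI subsetI image_subsetI 1 2)
qed

lemma decomposable_upper:
  assumes "\<kappa> \<noteq> Id_on P" "decomposable (finite_chains (proper_congruences P' r')) e N"
  shows "decomposable (finite_chains {\<rho> \<in> proper_congruences P r. \<kappa> \<subset> \<rho>}) e N"
  unfolding pull_finite_chains[OF assms(1)]
proof (rule decomposable_image[OF assms(2)], rule inj_on_subset[OF inj_on_pull])
  show "\<Union> (finite_chains (proper_congruences P' r')) \<subseteq> {\<sigma>. \<sigma> \<subseteq> P' \<times> P'}"
    unfolding finite_chains_def proper_congruences_def by (blast dest: congruences_subset)
qed

end

section \<open>Passing between equivalence relations and partitions\<close>

lemma partition_rel_quotient:
  assumes "equiv P \<rho>"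
  shows "partition_rel (P // \<rho>) = \<rho>"
proof -
  have "(x, y) \<in> partition_rel (P // \<rho>) \<longleftrightarrow> (x, y) \<in> \<rho>" for x y
  proof
    assume "(x, y) \<in> partition_rel (P // \<rho>)"
    then obtain B where "B \<in> P // \<rho>" "x \<in> B" "y \<in> B" by (auto simp: partition_rel_def)
    then show "(x, y) \<in> \<rho>" using assms by (rule_tac quotient_eq_iff[THEN iffD1, OF assms, of B B]) auto
  next
    assume xy: "(x, y) \<in> \<rho>"
    then have "x \<in> P" using assms by (auto simp: equiv_def)
    then have "\<rho> `` {x} \<in> P // \<rho>" "x \<in> \<rho> `` {x}" "y \<in> \<rho> `` {x}"
      using xy assms by (auto simp: quotientI equiv_def refl_on_def)
    then show "(x, y) \<in> partition_rel (P // \<rho>)" by (auto simp: partition_rel_def)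
  qed
  then show ?thesis by (simp add: set_eq_iff split_paired_all)
qed

lemma refines_quotient_iff:
  assumes "equiv P \<rho>" "equiv P \<sigma>"
  shows "refines P (P // \<rho>) (P // \<sigma>) \<longleftrightarrow> \<rho> \<subseteq> \<sigma>"
proof
  assume ref: "refines P (P // \<rho>) (P // \<sigma>)"
  show "\<rho> \<subseteq> \<sigma>"
  proof (rule subrelI)
    fix x y assume "(x, y) \<in> \<rho>"
    then have "(x, y) \<in> partition_rel (P // \<rho>)" using assms by (simp add: partition_rel_quotient)
    then have "(x, y) \<in> partition_rel (P // \<sigma>)"
      using ref unfolding refines_def partition_rel_def by blast
    then show "(x, y) \<in> \<sigma>" using assms by (simp add: partition_rel_quotient)
  qed
next
  assume *: "\<rho> \<subseteq> \<sigma>"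
  have "\<exists>Y\<in>P // \<sigma>. X \<subseteq> Y" if X: "X \<in> P // \<rho>" for X
  proof -
    obtain x where "x \<in> P" "X = \<rho> `` {x}" using X by (auto elim: quotientE)
    then show ?thesis using * by (intro bexI[of _ "\<sigma> `` {x}"]) (auto simp: quotientI)
  qed
  then show "refines P (P // \<rho>) (P // \<sigma>)"
    using assms by (simp add: refines_def partition_on_quotient)
qed

lemma inj_on_quotient: "inj_on (\<lambda>\<rho>. P // \<rho>) {\<rho>. equiv P \<rho>}"
  by (rule inj_onI) (metis mem_Collect_eq partition_rel_quotient)

lemma quotient_Id_on: "P // Id_on P = (\<lambda>x. {x}) ` P"
  unfolding quotient_def by auto

lemma quotient_Times: "P \<noteq> {} \<Longrightarrow> P // (P \<times> P) = {P}"
  unfolding quotient_def by auto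

lemma order_preserving_partitions_eq:
  assumes "r \<subseteq> P \<times> P"
  shows "order_preserving_partitions P r = (\<lambda>\<rho>. P // \<rho>) ` congruences P r"
  unfolding order_preserving_partitions_def order_congruence_iff[OF assms] by auto

lemma equiv_Id_on: "equiv P (Id_on P)"
  by (auto simp: equiv_def refl_on_def sym_def trans_def)

lemma equiv_Times: "equiv P (P \<times> P)"
  by (auto simp: equiv_def refl_on_def sym_def trans_def)

lemma proper_order_preserving_partitions_eq:
  assumes "r \<subseteq> P \<times> P" "P \<noteq> {}"
  shows "proper_order_preserving_partitions P r = (\<lambda>\<rho>. P // \<rho>) ` proper_congruences P r"
proof -
  have "(\<lambda>\<rho>. P // \<rho>) ` (congruences P r - {Id_on P, P \<times> P}) =
     (\<lambda>\<rho>. P // \<rho>) ` congruences P r - (\<lambda>\<rho>. P // \<rho>) ` {Id_on P, P \<times> P}"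
    by (rule inj_on_image_set_diff[OF inj_on_quotient])
      (auto simp: congruences_def equiv_Id_on equiv_Times)
  then show ?thesis
    unfolding proper_order_preserving_partitions_def proper_congruences_def
    using assms by (simp add: order_preserving_partitions_eq quotient_Id_on quotient_Times)
qed

text \<open>Taking classes is injective and turns inclusion into refinement, so the two complexes
  differ only in the names of their vertices.\<close>

lemma order_complex_partitions:
  assumes "r \<subseteq> P \<times> P" "P \<noteq> {}"
  shows "order_complex (proper_order_preserving_partitions P r) {(\<pi>, \<tau>). refines P \<pi> \<tau>} =
    (`) (\<lambda>\<rho>. P // \<rho>) ` finite_chains (proper_congruences P r)" (is "?l = (`) ?q ` ?K")
proof -
  have eq: "equiv P \<rho>" if "\<rho> \<in> proper_congruences P r" for \<rho>
    using that by (simp add: proper_congruences_def congruences_def)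
  have iff: "?q ` C \<in> Chains {(\<pi>, \<tau>). refines P \<pi> \<tau>} \<longleftrightarrow> (\<forall>\<rho>\<in>C. \<forall>\<sigma>\<in>C. \<rho> \<subseteq> \<sigma> \<or> \<sigma> \<subseteq> \<rho>)"
    if "C \<subseteq> proper_congruences P r" for C
    using that eq by (auto simp: Chains_def refines_quotient_iff subset_iff[of C])
  have 1: "?q ` C \<in> ?l" if C: "C \<in> ?K" for C
  proof -
    have "C \<subseteq> proper_congruences P r" using C by (simp add: finite_chains_def)
    then show ?thesis
      using C iff[of C] unfolding order_complex_def proper_order_preserving_partitions_eq[OF assms]
      by (simp add: finite_chains_def image_mono)
  qed
  have 2: "D \<in> (`) ?q ` ?K" if D: "D \<in> ?l" for D
  proof -
    have "finite D" "D \<subseteq> ?q ` proper_congruences P r"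
      using D unfolding order_complex_def proper_order_preserving_partitions_eq[OF assms] by auto
    then obtain C where C: "C \<subseteq> proper_congruences P r" "finite C" "D = ?q ` C"
      by (meson finite_subset_image)
    then have "C \<in> ?K"
      using D iff[OF C(1)] by (simp add: order_complex_def finite_chains_def)
    then show ?thesis using C(3) by blast
  qed
  show ?thesis by (intro equalityI subsetI image_subsetI 1 2)
qed

lemma decomposable_order_complex:
  assumes "r \<subseteq> P \<times> P" "P \<noteq> {}" "decomposable (finite_chains (proper_congruences P r)) e N"
  shows "decomposable (order_complex (proper_order_preserving_partitions P r) {(\<pi>, \<tau>). refines P \<pi> \<tau>}) e N"
  unfolding order_complex_partitions[OF assms(1,2)]
proof (rule decomposable_image[OF assms(3)], rule inj_on_subset[OF inj_on_quotient])
  show "\<Union> (finite_chains (proper_congruences P r)) \<subseteq> {\<rho>. equiv P \<rho>}"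
    unfolding finite_chains_def proper_congruences_def congruences_def by blast
qed

section \<open>Atoms at a minimal element and the recursion for the number of facets\<close>

definition pair_rel :: "'a set \<Rightarrow> 'a \<Rightarrow> 'a \<Rightarrow> 'a rel" where
  "pair_rel P a b = Id_on P \<union> {(a, b), (b, a)}"

lemma pair_rel_iff: "(x, y) \<in> pair_rel P a b \<longleftrightarrow> x = y \<and> x \<in> P \<or> x = a \<and> y = b \<or> x = b \<and> y = a"
  by (auto simp: pair_rel_def)

lemma equiv_pair_rel:
  assumes "a \<in> P" "b \<in> P"
  shows "equiv P (pair_rel P a b)"
  by (rule equivI) (use assms in \<open>auto simp: pair_rel_def refl_on_def sym_def trans_def\<close>)

lemma quotient_pair_rel:
  assumes "a \<in> P" "b \<in> P"
  shows "P // pair_rel P a b = pair_partition P a b"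
proof -
  have cls: "pair_rel P a b `` {x} = (if x = a \<or> x = b then {a, b} else {x})" if "x \<in> P" for x
    using assms that by (auto simp: pair_rel_def)
  have "P // pair_rel P a b = (\<lambda>x. if x = a \<or> x = b then {a, b} else {x}) ` P"
    unfolding quotient_def using cls by (simp add: UNION_singleton_eq_range cong: image_cong_simp)
  also have "\<dots> = pair_partition P a b"
    unfolding pair_partition_def using assms by (auto simp: image_iff)
  finally show ?thesis .
qed

lemma pair_partition_preserving_iff:
  assumes "r \<subseteq> P \<times> P" "a \<in> P" "b \<in> P"
  shows "pair_partition P a b \<in> order_preserving_partitions P r \<longleftrightarrow> pair_rel P a b \<in> congruences P r"
proof
  assume "pair_partition P a b \<in> order_preserving_partitions P r"
  then obtain \<rho> where \<rho>: "\<rho> \<in> congruences P r" "P // pair_rel P a b = P // \<rho>"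
    using assms by (auto simp: order_preserving_partitions_eq quotient_pair_rel)
  then have "equiv P \<rho>" by (simp add: congruences_def)
  then have "pair_rel P a b = \<rho>"
    using \<rho>(2) equiv_pair_rel[OF assms(2,3)] by (metis partition_rel_quotient)
  then show "pair_rel P a b \<in> congruences P r" using \<rho>(1) by simp
next
  assume "pair_rel P a b \<in> congruences P r"
  then show "pair_partition P a b \<in> order_preserving_partitions P r"
    using assms by (auto simp: order_preserving_partitions_eq simp flip: quotient_pair_rel)
qed

lemma partition_rel_pair_partition:
  assumes "a \<in> P" "b \<in> P"
  shows "partition_rel (pair_partition P a b) = pair_rel P a b"
  using partition_rel_quotient[OF equiv_pair_rel[OF assms]] quotient_pair_rel[OF assms] by simp

lemma card_pair_partition:
  assumes "finite P" "a \<in> P" "b \<in> P" "a \<noteq> b"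
  shows "card (pair_partition P a b) = card P - 1"
proof -
  have "{a, b} \<notin> (\<lambda>x. {x}) ` (P - {a, b})" by auto
  moreover have "card ((\<lambda>x. {x}) ` (P - {a, b})) = card (P - {a, b})"
    by (rule card_image) (auto simp: inj_on_def)
  moreover have "card (P - {a, b}) = card P - 2"
    using assms by (subst card_Diff_subset) auto
  moreover have "card P \<ge> 2"
    using assms card_mono[of P "{a, b}"] by simp
  ultimately show ?thesis
    unfolding pair_partition_def using assms(1) by simp
qed

lemma proper_congruences_card_2:
  assumes "card P = 2"
  shows "proper_congruences P r = {}"
proof -
  obtain x y where xy: "P = {x, y}" using assms by (auto simp: card_2_iff)
  have "\<rho> = Id_on P \<or> \<rho> = P \<times> P" if "equiv P \<rho>" for \<rho>
  proof (cases "(x, y) \<in> \<rho>")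
    case True
    then have "\<rho> = P \<times> P"
      using that xy unfolding equiv_def refl_on_def sym_def by blast
    then show ?thesis ..
  next
    case False
    then have "(y, x) \<notin> \<rho>" using that unfolding equiv_def sym_def by blast
    then have "\<rho> = Id_on P"
      using that False xy unfolding equiv_def refl_on_def by blast
    then show ?thesis ..
  qed
  then show ?thesis by (auto simp: proper_congruences_def congruences_def)
qed

text \<open>The proper part is empty, so the complex is \<open>{{}}\<close>, a sphere of dimension
  -1. Its empty face is the one facet to delete.\<close>

lemma decomposable_card_2:
  assumes "card P = 2"
  shows "decomposable (finite_chains (proper_congruences P r)) 0 1"
  unfolding decomposable_def removable_facets_def
  by (rule exI[of _ "{{}}"]) (simp add: proper_congruences_card_2[OF assms] collapsible.void)

lemma finite_proper_congruences: "finite P \<Longrightarrow> finite (proper_congruences P r)"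
  by (rule finite_subset[of _ "Pow (P \<times> P)"])
    (auto simp: proper_congruences_def dest: congruences_subset)

text \<open>The numbers \<open>N b\<close> are left arbitrary because the lemma is used twice: with
  numbers provided by the induction hypothesis, and with the values of \<open>num_spheres\<close> on
  the quotients.\<close>

lemma decomposable_step:
  assumes fin: "finite P" and po: "partial_order_on P r" and card: "card P \<ge> 3"
    and a: "a \<in> P" and min: "\<And>x. x \<in> P \<Longrightarrow> (x, a) \<in> r \<Longrightarrow> x = a"
    and dec: "\<And>b. \<lbrakk>b \<in> P; b \<noteq> a; pair_rel P a b \<in> congruences P r\<rbrakk> \<Longrightarrow>
      decomposable (finite_chains {\<rho> \<in> proper_congruences P r. pair_rel P a b \<subset> \<rho>}) (card P - 3) (N b)"
  shows "decomposable (finite_chains (proper_congruences P r)) (card P - 2)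
    (\<Sum>b | b \<in> P \<and> b \<noteq> a \<and> pair_rel P a b \<in> congruences P r. N b)"
proof -
  let ?Q = "proper_congruences P r" and ?B = "{b. b \<in> P \<and> b \<noteq> a \<and> pair_rel P a b \<in> congruences P r}"
  have rP: "r \<subseteq> P \<times> P" using po by (simp add: order_on_defs)
  define s where "s = {(x, y) \<in> P \<times> P. x = a \<longleftrightarrow> y = a}"
  have "card (P - {a}) \<ge> 2" using card a fin by simp
  \<comment> \<open>Two points other than \<open>a\<close> show that \<open>s\<close> is not the
    identity and that no atom at \<open>a\<close> is the full relation.\<close>
  then obtain T where T: "T \<subseteq> P - {a}" "card T = 2" by (rule obtain_subset_with_card_n)
  from T(2) obtain u v where "T = {u, v}" "u \<noteq> v" by (auto simp: card_2_iff)
  with T(1) have uv: "u \<in> P" "v \<in> P" "u \<noteq> a" "v \<noteq> a" "u \<noteq> v" by blast+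
  have s: "s \<in> ?Q"
  proof -
    \<comment> \<open>Neither a step of \<open>s\<close> nor a step of \<open>r\<close> enters
      \<open>a\<close> from another point, the latter by minimality.\<close>
    have into_a: "x = a" if xa: "(x, a) \<in> (s \<union> r)\<^sup>+" for x
      using xa by (induction rule: converse_trancl_induct) (use rP min in \<open>auto simp: s_def\<close>)
    have "equiv P s"
      by (rule equivI) (auto simp: s_def refl_on_def sym_def trans_def)
    moreover have "(x, y) \<in> s" if xy: "(x, y) \<in> (s \<union> r)\<^sup>+" "(y, x) \<in> (s \<union> r)\<^sup>+" for x y
    proof -
      have "x \<in> P" "y \<in> P" using trancl_subset[OF rP, of s] xy by (auto simp: s_def)
      then show ?thesis using xy into_a unfolding s_def by blast
    qed
    ultimately have "s \<in> congruences P r" by (simp add: congruences_def)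
    moreover have "s \<noteq> Id_on P" using uv by (auto simp: s_def)
    moreover have "s \<noteq> P \<times> P" using uv a by (auto simp: s_def)
    ultimately show ?thesis by (simp add: proper_congruences_def)
  qed
  have Id_sub: "Id_on P \<subseteq> \<rho>" if "\<rho> \<in> ?Q" for \<rho>
    using that by (auto simp: proper_congruences_def congruences_def equiv_def refl_on_def)
  define A where "A = pair_rel P a ` ?B"
  have A_iff: "\<rho> \<in> A \<longleftrightarrow> \<rho> \<inter> s = Id_on P" if \<rho>: "\<rho> \<in> ?Q" for \<rho>
  proof
    assume "\<rho> \<in> A"
    then show "\<rho> \<inter> s = Id_on P"
      using a unfolding A_def s_def pair_rel_def by auto
  next
    assume eq: "\<rho> \<inter> s = Id_on P"
    have \<rho>': "equiv P \<rho>" "\<rho> \<in> congruences P r" "\<rho> \<noteq> Id_on P" "\<rho> \<subseteq> P \<times> P"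
      using \<rho> by (auto simp: proper_congruences_def congruences_def equiv_def)
    then obtain x y where xy: "(x, y) \<in> \<rho>" "x \<noteq> y" using Id_sub[OF \<rho>] by auto
    then have "(x, y) \<notin> s" using eq by (metis IntI Id_onE Pair_inject)
    then have "x = a \<or> y = a" using xy \<rho>'(4) unfolding s_def by auto
    moreover have "(y, x) \<in> \<rho>" using \<rho>'(1) xy unfolding equiv_def sym_def by blast
    ultimately obtain b where b: "(a, b) \<in> \<rho>" "b \<noteq> a" using xy by blast
    have "b \<in> P" using b \<rho>'(4) by blast
    have ba: "(b, a) \<in> \<rho>" using \<rho>'(1) b unfolding equiv_def sym_def by blast
    \<comment> \<open>Two partners of \<open>a\<close> would be related to each other by \<rho> and
      also by \<open>s\<close>, which the trivial intersection forbids.\<close>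
    have uniq: "c = b" if c: "(a, c) \<in> \<rho>" "c \<noteq> a" for c
    proof -
      have "(b, c) \<in> \<rho>" using \<rho>'(1) ba c unfolding equiv_def trans_def by blast
      then have "(b, c) \<in> \<rho> \<inter> s" using b c \<rho>'(4) unfolding s_def by blast
      then show ?thesis unfolding eq by auto
    qed
    have "\<rho> = pair_rel P a b"
    proof (intro equalityI subrelI)
      fix x y assume xy: "(x, y) \<in> \<rho>"
      have yx: "(y, x) \<in> \<rho>" using \<rho>'(1) xy unfolding equiv_def sym_def by blast
      have P: "x \<in> P" "y \<in> P" using \<rho>'(4) xy by blast+
      consider "x = a \<longleftrightarrow> y = a" | "x = a" "y \<noteq> a" | "y = a" "x \<noteq> a" by blast
      then show "(x, y) \<in> pair_rel P a b"
      proof cases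
        case 1
        then have "(x, y) \<in> \<rho> \<inter> s" using xy P unfolding s_def by blast
        then show ?thesis unfolding eq pair_rel_def by blast
      qed (use uniq xy yx in \<open>auto simp: pair_rel_iff\<close>)
    next
      fix x y assume "(x, y) \<in> pair_rel P a b"
      then show "(x, y) \<in> \<rho>" using b ba Id_sub[OF \<rho>] unfolding pair_rel_def by auto
    qed
    then show "\<rho> \<in> A" using b \<open>b \<in> P\<close> \<rho>'(2) unfolding A_def by auto
  qed
  have AQ: "A \<subseteq> ?Q"
  proof
    fix \<rho> assume "\<rho> \<in> A"
    then obtain b where b: "\<rho> = pair_rel P a b" "b \<in> P" "b \<noteq> a" "\<rho> \<in> congruences P r"
      unfolding A_def by blast
    have "\<rho> \<noteq> Id_on P" unfolding b(1) using b(3) by (auto simp: pair_rel_def)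
    moreover have "(u, v) \<notin> \<rho>" unfolding b(1) using uv by (auto simp: pair_rel_def)
    then have "\<rho> \<noteq> P \<times> P" using uv by blast
    ultimately show "\<rho> \<in> ?Q" using b by (simp add: proper_congruences_def)
  qed
  have sP: "\<rho> \<inter> s \<in> ?Q" if \<rho>: "\<rho> \<in> ?Q" "\<rho> \<notin> A" for \<rho>
  proof -
    have "\<rho> \<inter> s \<in> congruences P r"
      using congruences_Int \<rho> s by (auto simp: proper_congruences_def)
    moreover have "\<rho> \<inter> s \<noteq> Id_on P" using A_iff \<rho> by blast
    moreover have "\<rho> \<inter> s \<noteq> P \<times> P" using uv a by (auto simp: s_def)
    ultimately show ?thesis by (simp add: proper_congruences_def)
  qed
  \<comment> \<open>The sum first runs over atoms; the description recovers the partner of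
    \<open>a\<close> from the atom, so that the sum can be reindexed by \<open>b\<close>.\<close>
  have "decomposable (finite_chains ?Q) (Suc (card P - 3)) (\<Sum>y\<in>A. N (THE b. b \<noteq> a \<and> y = pair_rel P a b))"
  proof (rule decomposable_finite_chains[OF finite_proper_congruences[OF fin] AQ])
    fix x y assume *: "y \<in> A" "x \<in> ?Q" "x \<subseteq> y"
    then have "y \<inter> s = Id_on P" using A_iff AQ by blast
    then have "x \<inter> s \<subseteq> Id_on P" using Int_mono[OF *(3) order_refl, of s] by simp
    moreover have "Id_on P \<subseteq> x \<inter> s" using Id_sub[OF *(2)] Id_sub[OF s] by (rule Int_greatest)
    ultimately have "x \<inter> s = Id_on P" by (rule subset_antisym)
    then have "x \<in> A" using A_iff *(2) by blast
    then obtain b c where bc: "x = pair_rel P a b" "y = pair_rel P a c" "b \<noteq> a"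
      using *(1) unfolding A_def by blast
    then have "(a, b) \<in> pair_rel P a c" using *(3) by (auto simp: pair_rel_def)
    then have "b = c" using bc(3) by (auto simp: pair_rel_def)
    then show "x = y" using bc by simp
  next
    show "collapsible (finite_chains (?Q - A))"
    proof (rule collapsible_finite_chains[where s = s and f = "\<lambda>\<rho>. \<rho> \<inter> s"])
      show "s \<in> ?Q - A" using s A_iff[OF s] by (auto simp: proper_congruences_def)
      show "\<rho> \<inter> s \<in> ?Q - A" if "\<rho> \<in> ?Q - A" for \<rho>
        \<comment> \<open>Intersecting with \<open>s\<close> a second time changes nothing, so
          \<open>\<rho> \<inter> s\<close> meets \<open>s\<close> trivially only if \<rho>
          does.\<close>
        using sP[of \<rho>] A_iff[of "\<rho> \<inter> s"] A_iff[of \<rho>] that by (auto simp: Int_assoc)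
    qed (use finite_proper_congruences[OF fin] in auto)
  next
    fix y assume "y \<in> A"
    then obtain b where b: "b \<in> P" "b \<noteq> a" "y = pair_rel P a b" "y \<in> congruences P r"
      unfolding A_def by blast
    have "(THE b. b \<noteq> a \<and> y = pair_rel P a b) = b"
    proof (rule the_equality)
      fix c assume c: "c \<noteq> a \<and> y = pair_rel P a c"
      then have "(a, c) \<in> pair_rel P a b" using b(3) by (auto simp: pair_rel_def)
      then show "c = b" using c by (auto simp: pair_rel_def)
    qed (use b in simp)
    then show "decomposable (finite_chains {x \<in> ?Q. y \<subset> x}) (card P - 3)
        (N (THE b. b \<noteq> a \<and> y = pair_rel P a b))"
      using dec[of b] b by simp
  qed
  moreover have "(\<Sum>y\<in>A. N (THE b. b \<noteq> a \<and> y = pair_rel P a b)) = (\<Sum>b\<in>?B. N b)"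
    unfolding A_def
  proof (rule sum.reindex_cong[OF _ refl])
    have inj: "c = b" if "c \<noteq> a" "pair_rel P a b = pair_rel P a c" for b c
    proof -
      have "(a, c) \<in> pair_rel P a b" unfolding that(2) by (simp add: pair_rel_def)
      then show ?thesis using that(1) by (auto simp: pair_rel_def)
    qed
    then show "inj_on (pair_rel P a) ?B" by (auto simp: inj_on_def)
    fix b assume "b \<in> ?B"
    then have "(THE c. c \<noteq> a \<and> pair_rel P a b = pair_rel P a c) = b"
      using inj by (intro the_equality) auto
    then show "N (THE c. c \<noteq> a \<and> pair_rel P a b = pair_rel P a c) = N b" by simp
  qed
  moreover have "Suc (card P - 3) = card P - 2" using card by simp
  ultimately show ?thesis by simp
qed

lemma finite_partial_order_has_minimal:
  assumes "finite P" "P \<noteq> {}" "partial_order_on P r"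
  shows "\<exists>a\<in>P. \<forall>x\<in>P. (x, a) \<in> r \<longrightarrow> x = a"
proof -
  have "r \<subseteq> P \<times> P" "trans r" "antisym r" using assms by (auto simp: order_on_defs)
  then have "finite (r - Id)" "acyclic (r - Id)"
    using assms(1) by (auto intro: finite_subset acyclicI_order simp: trans_diff_Id acyclic_def)
  then have "wf (r - Id)" by (rule finite_acyclic_wf)
  then obtain a where "a \<in> P" "\<And>x. (x, a) \<in> r - Id \<Longrightarrow> x \<notin> P"
    using assms(2) by (auto intro: wfE_min'[of "r - Id" P])
  then show ?thesis by blast
qed

text \<open>The quotient by an atom is modelled on \<open>P - {a}\<close> by sending
  \<open>a\<close> to \<open>b\<close>. Its order is reachability in the old poset, restricted to
  the remaining points, and the induction hypothesis applies in the same type.\<close>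

theorem decomposable_proper_congruences:
  assumes "finite P" "partial_order_on P r" "card P \<ge> 2"
  shows "\<exists>N. decomposable (finite_chains (proper_congruences P r)) (card P - 2) N"
  using assms
proof (induction "card P" arbitrary: P r rule: less_induct)
  case less
  show ?case
  proof (cases "card P = 2")
    case True
    then show ?thesis using decomposable_card_2[OF True, of r] by auto
  next
    case False
    then have card: "card P \<ge> 3" using less.prems by simp
    have "P \<noteq> {}" using card by auto
    then obtain a where a: "a \<in> P" and min: "\<And>x. x \<in> P \<Longrightarrow> (x, a) \<in> r \<Longrightarrow> x = a"
      using finite_partial_order_has_minimal less.prems by metis
    let ?U = "\<lambda>b. finite_chains {\<rho> \<in> proper_congruences P r. pair_rel P a b \<subset> \<rho>}"
    have ex: "\<exists>N. decomposable (?U b) (card P - 3) N"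
      if b: "b \<in> P" "b \<noteq> a" "pair_rel P a b \<in> congruences P r" for b
    proof -
      let ?g = "\<lambda>x. if x = a then b else x"
      define r' where "r' = (pair_rel P a b \<union> r)\<^sup>+ \<inter> (P - {a}) \<times> (P - {a})"
      have eq: "equiv P (pair_rel P a b)" using a b by (simp add: equiv_pair_rel)
      interpret quotient_map_poset P r "P - {a}" r' ?g "pair_rel P a b"
      proof
        show "?g ` P = P - {a}" using a b by (auto simp: image_iff)
        show "?g x = ?g y \<longleftrightarrow> (x, y) \<in> pair_rel P a b" if "x \<in> P" "y \<in> P" for x y
          using that b by (auto simp: pair_rel_iff)
        have g: "(x, ?g x) \<in> (pair_rel P a b \<union> r)\<^sup>+" "(?g x, x) \<in> (pair_rel P a b \<union> r)\<^sup>+" if "x \<in> P" for x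
          using that b by (auto simp: pair_rel_iff intro!: r_into_trancl)
        show "(?g x, ?g y) \<in> r' \<longleftrightarrow> (x, y) \<in> (pair_rel P a b \<union> r)\<^sup>+" if xy: "x \<in> P" "y \<in> P" for x y
        proof -
          have "(?g x, ?g y) \<in> r' \<longleftrightarrow> (?g x, ?g y) \<in> (pair_rel P a b \<union> r)\<^sup>+"
            using xy b unfolding r'_def by auto
          then show ?thesis using g[OF xy(1)] g[OF xy(2)] by (meson trancl_trans)
        qed
      qed (use less.prems b in \<open>auto simp: r'_def\<close>)
      have "card (P - {a}) < card P" "card (P - {a}) \<ge> 2" "card (P - {a}) - 2 = card P - 3"
        using less.prems(1) a card by simp_all
      then obtain N where "decomposable (finite_chains (proper_congruences (P - {a}) r')) (card P - 3) N"
        using less.hyps[of "P - {a}" r'] less.prems(1) partial_order_quotient by auto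
      moreover have "pair_rel P a b \<noteq> Id_on P" using b by (auto simp: pair_rel_def)
      ultimately show ?thesis using decomposable_upper by blast
    qed
    then obtain N where "\<And>b. \<lbrakk>b \<in> P; b \<noteq> a; pair_rel P a b \<in> congruences P r\<rbrakk> \<Longrightarrow>
        decomposable (?U b) (card P - 3) (N b)" by metis
    from decomposable_step[OF less.prems(1,2) card a min this] show ?thesis by blast
  qed
qed

section \<open>Geometric realizations\<close>

definition finite_complex :: "'v set set \<Rightarrow> bool" where
  "finite_complex K \<longleftrightarrow> finite K \<and> (\<forall>\<sigma>\<in>K. finite \<sigma> \<and> (\<forall>\<tau>\<subseteq>\<sigma>. \<tau> \<in> K))"

definition realization_set :: "'v set set \<Rightarrow> ('v \<Rightarrow> real) set" where
  "realization_set K = {f. (\<forall>v. 0 \<le> f v) \<and> {v. f v \<noteq> 0} \<in> K \<and> (\<Sum>v | f v \<noteq> 0. f v) = 1}"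

lemma geometric_realization_eq: "geometric_realization K = top_of_set (realization_set K)"
  by (simp add: geometric_realization_def realization_set_def euclidean_product_topology)

text \<open>The face \<tau> may be larger than the support, which spares computing the exact support
  of points given by formulas.\<close>

lemma realization_setI:
  assumes "finite_complex K" "\<tau> \<in> K" "\<And>v. 0 \<le> f v" "\<And>v. v \<notin> \<tau> \<Longrightarrow> f v = 0" "sum f \<tau> = 1"
  shows "f \<in> realization_set K"
proof -
  have "{v. f v \<noteq> 0} \<subseteq> \<tau>" using assms(4) by blast
  moreover from this have "sum f {v. f v \<noteq> 0} = sum f \<tau>"
    using assms by (intro sum.mono_neutral_left) (auto simp: finite_complex_def)
  ultimately show ?thesis using assms by (auto simp: realization_set_def finite_complex_def)
qed

lemma realization_setD:
  assumes "f \<in> realization_set K"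
  shows "0 \<le> f v" "{v. f v \<noteq> 0} \<in> K" "sum f {v. f v \<noteq> 0} = 1"
  using assms by (auto simp: realization_set_def)

lemma sum_realization_set:
  assumes "f \<in> realization_set K" "finite \<tau>" "{v. f v \<noteq> 0} \<subseteq> \<tau>"
  shows "sum f \<tau> = 1"
  using sum.mono_neutral_left[OF assms(2,3), of f] realization_setD(3)[OF assms(1)] by auto

lemma realization_set_mono: "L \<subseteq> K \<Longrightarrow> realization_set L \<subseteq> realization_set K"
  by (auto simp: realization_set_def)

lemma finite_complex_Diff:
  assumes "finite_complex K" "\<And>\<sigma> \<tau>. \<lbrakk>\<sigma> \<in> F; \<tau> \<in> K; \<sigma> \<subseteq> \<tau>\<rbrakk> \<Longrightarrow> \<tau> \<in> F"
  shows "finite_complex (K - F)"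
  using assms unfolding finite_complex_def by blast

lemma continuous_on_coordinate:
  fixes g :: "'c::topological_space \<Rightarrow> 'v \<Rightarrow> real"
  assumes "continuous_on S g"
  shows "continuous_on S (\<lambda>x. g x v)"
  using assms by (rule continuous_on_product_then_coordinatewise)

lemma continuous_on_Min_image:
  fixes g :: "'c::topological_space \<Rightarrow> 'v \<Rightarrow> real"
  assumes "finite \<sigma>" "\<sigma> \<noteq> {}" "continuous_on S g"
  shows "continuous_on S (\<lambda>x. Min (g x ` \<sigma>))"
  using assms(1,2)
proof (induction rule: finite_ne_induct)
  case (singleton v)
  then show ?case using assms(3) by (simp add: continuous_on_coordinate)
next
  case (insert v \<sigma>)
  then have "continuous_on S (\<lambda>x. min (g x v) (Min (g x ` \<sigma>)))"
    by (intro continuous_on_min continuous_on_coordinate[OF assms(3)])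
  then show ?case using insert by simp
qed

lemma Min_image_pos_iff:
  fixes f :: "'v \<Rightarrow> real"
  assumes "finite \<sigma>" "\<sigma> \<noteq> {}" "\<And>v. 0 \<le> f v"
  shows "0 < Min (f ` \<sigma>) \<longleftrightarrow> \<sigma> \<subseteq> {v. f v \<noteq> 0}"
proof -
  have "0 < Min (f ` \<sigma>) \<longleftrightarrow> (\<forall>v\<in>\<sigma>. 0 < f v)" using assms by simp
  also have "\<dots> \<longleftrightarrow> \<sigma> \<subseteq> {v. f v \<noteq> 0}" using assms(3) by (auto simp: less_le)
  finally show ?thesis .
qed

text \<open>A point whose support contains \<sigma> moves along the fixed direction
  \<open>c\<close>, losing equal amounts at the vertices of \<sigma> and gaining their total at
  \<open>w\<close>. The speed is the minimum over \<sigma>, so at time 1 a vertex of \<sigma> has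
  coordinate 0. The speed vanishes on all points supported elsewhere, which therefore stay
  fixed.\<close>

lemma realization_set_elementary_collapse:
  assumes K: "finite_complex K" and \<sigma>: "\<sigma> \<in> K" "insert w \<sigma> \<in> K" "w \<notin> \<sigma>" "\<sigma> \<noteq> {}"
    and free: "\<And>\<tau>. \<lbrakk>\<tau> \<in> K; \<sigma> \<subseteq> \<tau>\<rbrakk> \<Longrightarrow> \<tau> = \<sigma> \<or> \<tau> = insert w \<sigma>"
  shows "top_of_set (realization_set K) homotopy_equivalent_space top_of_set (realization_set (K - {\<sigma>, insert w \<sigma>}))"
proof -
  let ?L = "K - {\<sigma>, insert w \<sigma>}" and ?\<tau> = "insert w \<sigma>"
  have fin: "finite \<sigma>" using K \<sigma> by (auto simp: finite_complex_def)
  have L: "finite_complex ?L"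
    by (rule finite_complex_Diff[OF K]) (use free in blast)
  define \<mu> where "\<mu> f = Min (f ` \<sigma>)" for f :: "'a \<Rightarrow> real"
  define c :: "'a \<Rightarrow> real" where "c v = (if v = w then real (card \<sigma>) else if v \<in> \<sigma> then - 1 else 0)" for v
  define h where "h = (\<lambda>(t::real, f) v. f v + t * \<mu> f * c v)"
  have "sum c \<sigma> = (\<Sum>v\<in>\<sigma>. - 1)"
    using \<sigma>(3) by (intro sum.cong) (auto simp: c_def)
  then have sum_c: "sum c ?\<tau> = 0"
    using fin \<sigma>(3) by (simp add: c_def)
  have h: "h (t, f) \<in> realization_set K \<and> (t = 1 \<longrightarrow> h (t, f) \<in> realization_set ?L) \<and>
      (f \<in> realization_set ?L \<longrightarrow> h (t, f) = f)"
    if f: "f \<in> realization_set K" and t: "0 \<le> t" "t \<le> 1" for t f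
  proof (cases "\<sigma> \<subseteq> {v. f v \<noteq> 0}")
    case False
    have "0 \<le> \<mu> f" unfolding \<mu>_def using fin \<sigma>(4) realization_setD(1)[OF f] by simp
    moreover have "\<not> 0 < \<mu> f"
      unfolding \<mu>_def using False Min_image_pos_iff[OF fin \<sigma>(4)] realization_setD(1)[OF f] by blast
    ultimately have "h (t, f) = f" by (auto simp: h_def)
    moreover have "f \<in> realization_set ?L" using f False by (auto simp: realization_set_def)
    ultimately show ?thesis using f by metis
  next
    case True
    then have supp: "{v. f v \<noteq> 0} = \<sigma> \<or> {v. f v \<noteq> 0} = ?\<tau>"
      using free realization_setD(2)[OF f] by blast
    then have "f \<notin> realization_set ?L" by (auto simp: realization_set_def)
    have \<mu>0: "0 \<le> \<mu> f" unfolding \<mu>_def using fin \<sigma>(4) realization_setD(1)[OF f] by simp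
    have \<mu>_le: "\<mu> f \<le> f v" if "v \<in> \<sigma>" for v unfolding \<mu>_def using fin that by simp
    \<comment> \<open>A vertex where the minimum is attained is the one that drops out at time
      1.\<close>
    obtain v0 where v0: "v0 \<in> \<sigma>" "f v0 = \<mu> f"
      using Min_in[of "f ` \<sigma>"] fin \<sigma>(4) unfolding \<mu>_def by fastforce
    have pos: "0 \<le> h (t, f) v" for v
    proof (cases "v \<in> \<sigma>")
      case True
      have "t * \<mu> f \<le> 1 * f v" using t \<mu>0 \<mu>_le[OF True] by (intro mult_mono) auto
      then show ?thesis using True \<sigma>(3) by (auto simp: h_def c_def)
    qed (use t \<mu>0 realization_setD(1)[OF f] in \<open>auto simp: h_def c_def\<close>)
    have zero: "h (t, f) v = 0" if "v \<notin> ?\<tau>" for v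
      using supp that by (auto simp: h_def c_def)
    have "sum f ?\<tau> = 1" using sum_realization_set[OF f, of ?\<tau>] supp fin by auto
    then have sum1: "sum (h (t, f)) ?\<tau> = 1"
      using sum_c by (simp add: h_def sum.distrib flip: sum_distrib_left del: sum.insert)
    have "h (t, f) \<in> realization_set K"
      using realization_setI[OF K \<sigma>(2) pos zero sum1] by blast
    moreover have "h (t, f) \<in> realization_set ?L" if "t = 1"
    proof -
      have z: "h (t, f) v0 = 0" using that v0 \<sigma>(3) by (auto simp: h_def c_def)
      have "?\<tau> - {v0} \<in> K" using K \<sigma>(2) unfolding finite_complex_def by blast
      then have "?\<tau> - {v0} \<in> ?L" using v0 \<sigma>(3) by blast
      moreover have "sum (h (t, f)) (?\<tau> - {v0}) = 1"
        using sum1 z fin v0 sum.remove[of ?\<tau> v0 "h (t, f)"] by simp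
      ultimately show ?thesis
        using pos zero z by (intro realization_setI[OF L]) auto
    qed
    ultimately show ?thesis using \<open>f \<notin> realization_set ?L\<close> by blast
  qed
  have cont: "continuous_on ({0..1} \<times> realization_set K) h"
    unfolding h_def case_prod_beta \<mu>_def
    by (intro continuous_on_coordinatewise_then_product continuous_on_add continuous_on_mult
        continuous_on_const continuous_on_fst continuous_on_id continuous_on_Min_image fin \<sigma>(4)
        continuous_on_snd continuous_on_coordinate[OF continuous_on_snd[OF continuous_on_id]])
  define r where "r f = h (1, f)" for f
  have "continuous_on (realization_set K) r"
    unfolding r_def by (rule continuous_on_compose2[OF cont]) (auto intro!: continuous_intros)
  moreover have "r \<in> realization_set K \<rightarrow> realization_set ?L" using h[of _ 1] by (simp add: r_def)
  ultimately have cr: "continuous_map (top_of_set (realization_set K)) (top_of_set (realization_set ?L)) r"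
    by (simp add: continuous_map_subtopology_eu image_subset_iff_funcset)
  have LK: "realization_set ?L \<subseteq> realization_set K" by (rule realization_set_mono) blast
  have cid: "continuous_map (top_of_set (realization_set ?L)) (top_of_set (realization_set K)) id"
    using LK by (auto simp: continuous_map_subtopology_eu)
  have hom: "homotopic_with (\<lambda>x. True) (top_of_set (realization_set K)) (top_of_set (realization_set K)) id r"
    unfolding homotopic_with_def
  proof (intro exI[of _ h] conjI allI ballI)
    show "continuous_map (prod_topology (top_of_set {0..1}) (top_of_set (realization_set K))) (top_of_set (realization_set K)) h"
      using cont h by (auto simp: prod_topology_subtopology_eu continuous_map_subtopology_eu)
  qed (auto simp: h_def r_def)
  show ?thesis
    unfolding homotopy_equivalent_space_def
  proof (intro exI conjI)
    show "homotopic_with (\<lambda>x. True) (top_of_set (realization_set K)) (top_of_set (realization_set K)) (id \<circ> r) id"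
      using hom by (simp add: homotopic_with_sym)
    show "homotopic_with (\<lambda>x. True) (top_of_set (realization_set ?L)) (top_of_set (realization_set ?L)) (r \<circ> id) id"
      by (rule homotopic_with_equal) (use h LK continuous_map_compose[OF cid cr] in \<open>auto simp: r_def\<close>)
  qed (rule cr cid)+
qed

lemma contractible_realization_set:
  assumes "collapsible K" "finite_complex K" "K \<noteq> {}"
  shows "contractible_space (top_of_set (realization_set K))"
  using assms
proof (induction rule: collapsible.induct)
  case void
  then show ?case by simp
next
  case (collapse K \<sigma> w)
  show ?case
  proof (cases "\<sigma> = {}")
    case True
    \<comment> \<open>Every face contains the empty one, so freeness leaves only these two: the
      realization is a point.\<close>
    then have K: "K = {{}, {w}}" using collapse.hyps by blast
    define \<delta> where "\<delta> v = (if v = w then 1 else 0 :: real)" for v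
    have "realization_set K = {\<delta>}"
    proof (intro equalityI subsetI)
      fix f assume f: "f \<in> realization_set K"
      then have "{v. f v \<noteq> 0} = {w}" using realization_setD(2,3)[OF f] K by auto
      then have "\<And>v. v \<noteq> w \<Longrightarrow> f v = 0" "f w = 1" using realization_setD(3)[OF f] by auto
      then show "f \<in> {\<delta>}" by (auto simp: \<delta>_def)
    next
      fix f assume "f \<in> {\<delta>}"
      then show "f \<in> realization_set K"
        by (intro realization_setI[OF collapse.prems(1), of "{w}"]) (auto simp: K \<delta>_def)
    qed
    then show ?thesis using contractible_space_subtopology_singleton[of euclidean \<delta>] by simp
  next
    case False
    have "finite_complex (K - {\<sigma>, insert w \<sigma>})"
      by (rule finite_complex_Diff[OF collapse.prems(1)]) (use collapse.hyps in blast)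
    moreover have "{} \<in> K" using collapse.prems collapse.hyps(2) by (auto simp: finite_complex_def)
    \<comment> \<open>The empty face survives a collapse at a nonempty \<sigma>, which keeps the
      induction hypothesis applicable.\<close>
    then have "K - {\<sigma>, insert w \<sigma>} \<noteq> {}" using False by blast
    ultimately have "contractible_space (top_of_set (realization_set (K - {\<sigma>, insert w \<sigma>})))"
      by (rule collapse.IH)
    then show ?thesis
      using realization_set_elementary_collapse[OF collapse.prems(1) collapse.hyps(2-4) False collapse.hyps(5)]
        homotopy_equivalent_space_contractibility by blast
  qed
qed

lemma realization_set_nonempty:
  assumes "collapsible K" "finite_complex K" "K \<noteq> {}"
  shows "realization_set K \<noteq> {}"
proof -
  obtain w \<sigma> where \<sigma>: "insert w \<sigma> \<in> K" using assms(1,3) by (metis collapsible.cases)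
  then have w: "{w} \<in> K" using assms(2) by (auto simp: finite_complex_def)
  have "(\<lambda>v. if v = w then 1 else 0) \<in> realization_set K"
    by (rule realization_setI[OF assms(2) w]) auto
  then show ?thesis by blast
qed

text \<open>Identifying \<open>A\<close> to a point is harmless when a contraction of
  \<open>A\<close> within itself extends to a homotopy of the whole space. The end map is constant
  on \<open>A\<close>, so it factors through \<open>q\<close> and gives the inverse; the homotopy
  itself descends because it keeps \<open>A\<close> inside \<open>A\<close>.\<close>

lemma homotopy_equivalent_space_quotient:
  assumes q: "quotient_map X Y q"
    and fib: "\<And>x x'. \<lbrakk>x \<in> topspace X; x' \<in> topspace X; q x = q x'\<rbrakk> \<Longrightarrow> x = x' \<or> x \<in> A \<and> x' \<in> A"
    and const: "\<And>x x'. \<lbrakk>x \<in> A; x' \<in> A\<rbrakk> \<Longrightarrow> q x = q x'"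
    and h: "continuous_map (prod_topology (top_of_set {0..1::real}) X) X h"
    and h0: "\<And>x. x \<in> topspace X \<Longrightarrow> h (0, x) = x"
    and hA: "\<And>t x. \<lbrakk>x \<in> A; t \<in> {0..1}\<rbrakk> \<Longrightarrow> h (t, x) \<in> A"
    and h1: "\<And>x. x \<in> A \<Longrightarrow> h (1, x) = p"
  shows "X homotopy_equivalent_space Y"
proof -
  let ?I = "top_of_set {0..1::real}"
  have "continuous_map X X (h \<circ> (\<lambda>x. (1, x)))"
    by (rule continuous_map_compose[OF _ h]) (auto intro!: continuous_map_pairedI)
  then have "continuous_map X X (\<lambda>x. h (1, x))" by (simp add: o_def)
  moreover have "h (1, x) = h (1, x')" if "x \<in> topspace X" "x' \<in> topspace X" "q x = q x'" for x x'
    using fib[OF that] h1 by auto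
  ultimately obtain g where g: "continuous_map Y X g" "\<And>x. x \<in> topspace X \<Longrightarrow> g (q x) = h (1, x)"
    by (metis (no_types, lifting) quotient_map_lift_exists[OF q])
  \<comment> \<open>Local compactness of the interval makes the product of the identity with
    \<open>q\<close> again a quotient map, so that the homotopy can be pushed down.\<close>
  have "locally_compact_space ?I"
    by (intro compact_imp_locally_compact_space) (simp_all add: compact_space_subtopology Hausdorff_space_subtopology)
  then have Q: "quotient_map (prod_topology ?I X) (prod_topology ?I Y) (\<lambda>(t, x). (t, q x))"
    by (intro quotient_map_prod_right q) (simp_all add: Hausdorff_space_subtopology)
  have cq: "continuous_map X Y q" using q by (rule quotient_imp_continuous_map)
  have qim: "q ` topspace X = topspace Y" using q by (simp add: quotient_map_def)
  have "continuous_map (prod_topology ?I X) Y (q \<circ> h)"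
    using h cq by (rule continuous_map_compose)
  moreover have "(q \<circ> h) z = (q \<circ> h) z'"
    if z: "z \<in> topspace (prod_topology ?I X)" "z' \<in> topspace (prod_topology ?I X)"
      "(\<lambda>(t, x). (t, q x)) z = (\<lambda>(t, x). (t, q x)) z'" for z z'
  proof -
    obtain t x x' where eq: "z = (t, x)" "z' = (t, x')" "q x = q x'" using z(3) by (auto split: prod.splits)
    then have "x = x' \<or> x \<in> A \<and> x' \<in> A" "t \<in> {0..1}" using z fib by auto
    then show ?thesis using const hA unfolding eq by auto
  qed
  ultimately obtain k where k: "continuous_map (prod_topology ?I Y) Y k"
    "\<And>z. z \<in> topspace (prod_topology ?I X) \<Longrightarrow> k ((\<lambda>(t, x). (t, q x)) z) = (q \<circ> h) z"
    by (metis (no_types, lifting) quotient_map_lift_exists[OF Q])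
  have "homotopic_with (\<lambda>x. True) X X id (g \<circ> q)"
    by (subst homotopic_with, simp, intro exI[of _ h]) (use h h0 g in auto)
  moreover have "homotopic_with (\<lambda>x. True) Y Y id (q \<circ> g)"
  proof (subst homotopic_with, simp, intro exI[of _ k] conjI ballI)
    fix y assume "y \<in> topspace Y"
    then obtain x where x: "x \<in> topspace X" "y = q x" using qim by blast
    then show "k (0, y) = id y" "k (1, y) = (q \<circ> g) y"
      using k(2)[of "(0, x)"] k(2)[of "(1, x)"] h0 g(2) by auto
  qed (use k in auto)
  ultimately show ?thesis
    unfolding homotopy_equivalent_space_def
    using cq g(1) by (metis homotopic_with_symD)
qed

section \<open>A simplex modulo its boundary\<close>

definition corner :: "nat \<Rightarrow> real" where
  "corner j = (if j = 0 then 1 else 0)"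

definition scaled_min :: "nat \<Rightarrow> (nat \<Rightarrow> real) \<Rightarrow> real" where
  "scaled_min d x = real (Suc d) * Min (x ` {..d})"

definition diff_norm :: "nat \<Rightarrow> (nat \<Rightarrow> real) \<Rightarrow> real" where
  "diff_norm d x = sqrt (\<Sum>j=1..d. (x j - x 0)\<^sup>2)"

text \<open>The first coordinate \<open>1 - 2 * scaled_min d x\<close> is \<open>1\<close> on the boundary of the simplex and \<open>-1\<close>
  at the barycentre; the direction of \<open>x - barycentre\<close> is measured by the differences \<open>x j - x 0\<close>.
  The quotient has the junk value \<open>0\<close> when \<open>diff_norm d x = 0\<close>, where the square root vanishes too.\<close>

definition to_sphere :: "nat \<Rightarrow> (nat \<Rightarrow> real) \<Rightarrow> nat \<Rightarrow> real" where
  "to_sphere d x j =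
     (if j = 0 then 1 - 2 * scaled_min d x
      else if j \<le> d then 2 * sqrt (scaled_min d x * (1 - scaled_min d x)) * ((x j - x 0) / diff_norm d x)
      else 0)"

text \<open>These conditions hold for the coordinates of any point of a complex at the vertices of a
  facet: they sum to less than 1 only for points outside the open facet, where one of them vanishes.
  Thus \<open>to_sphere\<close> can be applied to the whole realization and sends everything outside
  the open facet to \<open>corner\<close>.\<close>

definition sphere_dom :: "nat \<Rightarrow> (nat \<Rightarrow> real) set" where
  "sphere_dom d = {x. (\<forall>j\<le>d. 0 \<le> x j) \<and> (\<Sum>j\<le>d. x j) \<le> 1 \<and>
     (0 < Min (x ` {..d}) \<longrightarrow> (\<Sum>j\<le>d. x j) = 1)}"

definition sphere_set :: "nat \<Rightarrow> (nat \<Rightarrow> real) set" where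
  "sphere_set d = {x. (\<Sum>j\<le>d. (x j)\<^sup>2) = 1 \<and> (\<forall>j>d. x j = 0)}"

lemma nsphere_eq: "nsphere d = top_of_set (sphere_set d)"
  by (simp add: nsphere sphere_set_def euclidean_product_topology)

lemma atMost_eq_insert_0: "{..d::nat} = insert 0 {1..d}"
  by auto

lemma sum_sphere_dom: "x \<in> sphere_dom d \<Longrightarrow> 0 < Min (x ` {..d}) \<Longrightarrow> (\<Sum>j\<le>d. x j) = 1"
  unfolding sphere_dom_def by blast

lemma scaled_min_bounds:
  assumes "x \<in> sphere_dom d"
  shows "0 \<le> scaled_min d x" "scaled_min d x \<le> 1"
proof -
  have "\<forall>a\<in>x ` {..d}. 0 \<le> a" using assms by (auto simp: sphere_dom_def)
  then have "0 \<le> Min (x ` {..d})" by simp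
  then show "0 \<le> scaled_min d x" by (simp add: scaled_min_def)
  have "(\<Sum>j\<le>d. Min (x ` {..d})) \<le> (\<Sum>j\<le>d. x j)" by (intro sum_mono) simp
  then show "scaled_min d x \<le> 1" using assms by (simp add: scaled_min_def sphere_dom_def)
qed

lemma diff_norm_eq_0_iff: "diff_norm d x = 0 \<longleftrightarrow> (\<forall>j\<le>d. x j = x 0)"
proof -
  have "diff_norm d x = 0 \<longleftrightarrow> (\<forall>j\<in>{1..d}. (x j - x 0)\<^sup>2 = 0)"
    unfolding diff_norm_def real_sqrt_eq_zero_cancel_iff by (intro sum_nonneg_eq_0_iff) auto
  also have "\<dots> \<longleftrightarrow> (\<forall>j\<le>d. x j = x 0)"
  proof (intro iffI allI ballI impI)
    fix j assume "\<forall>j\<in>{1..d}. (x j - x 0)\<^sup>2 = 0" "j \<le> d"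
    then show "x j = x 0" by (cases "j = 0") auto
  next
    fix j assume *: "\<forall>j\<le>d. x j = x 0" "j \<in> {1..d}"
    have "x j = x 0" by (rule *(1)[rule_format]) (use *(2) in simp)
    then show "(x j - x 0)\<^sup>2 = 0" by simp
  qed
  finally show ?thesis .
qed

text \<open>Equal coordinates are either all 0 or, by the condition on the sum, those of the
  barycentre; the scaled minimum is then 0 or 1.\<close>

lemma diff_norm_zero:
  assumes "x \<in> sphere_dom d" "diff_norm d x = 0"
  shows "scaled_min d x * (1 - scaled_min d x) = 0"
proof -
  have eq: "x j = x 0" if "j \<in> {..d}" for j
    using assms(2) that unfolding diff_norm_eq_0_iff by blast
  have "x ` {..d} = (\<lambda>_. x 0) ` {..d}" by (rule image_cong[OF refl eq])
  then have M: "Min (x ` {..d}) = x 0" by simp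
  have "(\<Sum>j\<le>d. x j) = (\<Sum>j\<le>d. x 0)" by (rule sum.cong[OF refl eq])
  then have S: "(\<Sum>j\<le>d. x j) = scaled_min d x" by (simp add: scaled_min_def M)
  show ?thesis
  proof (cases "0 < x 0")
    case True
    then show ?thesis using sum_sphere_dom[OF assms(1)] unfolding M S by simp
  next
    case False
    then have "x 0 = 0" using assms(1) by (auto simp: sphere_dom_def)
    then show ?thesis using M by (simp add: scaled_min_def)
  qed
qed

lemma to_sphere_in_sphere:
  assumes "x \<in> sphere_dom d"
  shows "to_sphere d x \<in> sphere_set d"
proof -
  let ?m = "scaled_min d x" and ?n = "diff_norm d x"
  have m: "0 \<le> ?m" "?m \<le> 1" using scaled_min_bounds[OF assms] .
  have n2: "(\<Sum>j=1..d. (x j - x 0)\<^sup>2) = ?n\<^sup>2"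
    unfolding diff_norm_def by (simp add: sum_nonneg)
  have "(\<Sum>j=1..d. (to_sphere d x j)\<^sup>2) = (\<Sum>j=1..d. (4 * (?m * (1 - ?m)) / ?n\<^sup>2) * (x j - x 0)\<^sup>2)"
    using m by (intro sum.cong) (auto simp: to_sphere_def power_mult_distrib power_divide)
  also have "\<dots> = (4 * (?m * (1 - ?m)) / ?n\<^sup>2) * ?n\<^sup>2"
    unfolding n2[symmetric] by (rule sum_distrib_left[symmetric])
  \<comment> \<open>If the denominator is 0, both sides are 0 by
    \<open>diff_norm_zero\<close>.\<close>
  also have "\<dots> = 4 * (?m * (1 - ?m))"
    using diff_norm_zero[OF assms] by (cases "?n = 0") simp_all
  finally have "(\<Sum>j\<le>d. (to_sphere d x j)\<^sup>2) = (1 - 2 * ?m)\<^sup>2 + 4 * (?m * (1 - ?m))"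
    by (simp add: atMost_eq_insert_0 to_sphere_def)
  also have "\<dots> = 1" by (simp add: power2_eq_square algebra_simps)
  finally show ?thesis by (simp add: sphere_set_def to_sphere_def)
qed

lemma to_sphere_eq_corner_iff:
  "to_sphere d x = corner \<longleftrightarrow> scaled_min d x = 0"
proof
  assume "to_sphere d x = corner"
  then have "to_sphere d x 0 = corner 0" by simp
  then show "scaled_min d x = 0" by (simp add: to_sphere_def corner_def)
qed (auto simp: to_sphere_def corner_def)

lemma corner_in_sphere: "corner \<in> sphere_set d"
  by (simp add: sphere_set_def corner_def atMost_eq_insert_0)

text \<open>The quotient stays bounded by 1 in absolute value while the factor \<open>s\<close>
  tends to 0 wherever the denominator vanishes.\<close>

lemma continuous_on_mult_bounded_quotient:
  fixes s y n :: "'c::topological_space \<Rightarrow> real"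
  assumes "continuous_on Z s" "continuous_on Z y" "continuous_on Z n"
    and bd: "\<And>z. z \<in> Z \<Longrightarrow> \<bar>y z\<bar> \<le> n z" and zero: "\<And>z. z \<in> Z \<Longrightarrow> n z = 0 \<Longrightarrow> s z = 0"
  shows "continuous_on Z (\<lambda>z. s z * (y z / n z))"
  unfolding continuous_on_def
proof
  fix z assume z: "z \<in> Z"
  have lim: "(s \<longlongrightarrow> s z) (at z within Z)" "(y \<longlongrightarrow> y z) (at z within Z)" "(n \<longlongrightarrow> n z) (at z within Z)"
    using assms(1-3) z by (auto simp: continuous_on_def)
  show "((\<lambda>z. s z * (y z / n z)) \<longlongrightarrow> s z * (y z / n z)) (at z within Z)"
  proof (cases "n z = 0")
    case False
    then show ?thesis using lim by (intro tendsto_intros)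
  next
    case True
    then have "s z = 0" using zero z by blast
    then have s0: "(s \<longlongrightarrow> 0) (at z within Z)" using lim(1) by simp
    have "((\<lambda>z. s z * (y z / n z)) \<longlongrightarrow> 0) (at z within Z)"
    proof (rule Lim_null_comparison)
      show "\<forall>\<^sub>F w in at z within Z. norm (s w * (y w / n w)) \<le> \<bar>s w\<bar>"
        unfolding eventually_at_filter
      proof (intro always_eventually allI impI)
        fix w assume "w \<in> Z"
        then have "\<bar>y w\<bar> / n w \<le> 1" "0 \<le> n w"
          using bd[of w] by (auto simp: divide_le_eq_1)
        then have "\<bar>s w\<bar> * (\<bar>y w\<bar> / n w) \<le> \<bar>s w\<bar> * 1"
          by (intro mult_left_mono) auto
        then show "norm (s w * (y w / n w)) \<le> \<bar>s w\<bar>"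
          using \<open>0 \<le> n w\<close> by (simp add: abs_mult)
      qed
      show "((\<lambda>w. \<bar>s w\<bar>) \<longlongrightarrow> 0) (at z within Z)" using s0 by (rule tendsto_rabs_zero)
    qed
    then show ?thesis using True \<open>s z = 0\<close> by simp
  qed
qed

lemma continuous_on_to_sphere: "continuous_on (sphere_dom d) (to_sphere d)"
proof (rule continuous_on_coordinatewise_then_product)
  fix j
  have m: "continuous_on (sphere_dom d) (scaled_min d)"
    unfolding scaled_min_def
    by (intro continuous_on_mult continuous_on_const continuous_on_Min_image continuous_on_id) auto
  have c: "continuous_on (sphere_dom d) (\<lambda>x. x k)" for k
    by (rule continuous_on_coordinate[OF continuous_on_id])
  have n: "continuous_on (sphere_dom d) (diff_norm d)"
    unfolding diff_norm_def
    by (intro continuous_on_real_sqrt continuous_on_sum continuous_on_power continuous_on_diff c)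
  consider "j = 0" | "1 \<le> j" "j \<le> d" | "j > d" by linarith
  then show "continuous_on (sphere_dom d) (\<lambda>x. to_sphere d x j)"
  proof cases
    case 1
    have "continuous_on (sphere_dom d) (\<lambda>x. 1 - 2 * scaled_min d x)"
      by (intro continuous_on_diff continuous_on_mult continuous_on_const m)
    then show ?thesis using 1 by (simp add: to_sphere_def)
  next
    case 2
    have "continuous_on (sphere_dom d)
       (\<lambda>x. 2 * sqrt (scaled_min d x * (1 - scaled_min d x)) * ((x j - x 0) / diff_norm d x))"
    proof (rule continuous_on_mult_bounded_quotient[OF _ _ n])
      show "continuous_on (sphere_dom d) (\<lambda>x. 2 * sqrt (scaled_min d x * (1 - scaled_min d x)))"
        by (intro continuous_on_mult continuous_on_const continuous_on_real_sqrt continuous_on_diff m)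
      show "continuous_on (sphere_dom d) (\<lambda>x. x j - x 0)"
        by (intro continuous_on_diff c)
      show "\<bar>x j - x 0\<bar> \<le> diff_norm d x" for x
      proof -
        have "(x j - x 0)\<^sup>2 \<le> (\<Sum>j=1..d. (x j - x 0)\<^sup>2)"
          using 2 by (intro member_le_sum) auto
        then show ?thesis unfolding diff_norm_def by (metis real_sqrt_abs real_sqrt_le_mono)
      qed
    qed (use diff_norm_zero in auto)
    then show ?thesis using 2 by (simp add: to_sphere_def)
  next
    case 3
    then show ?thesis by (simp add: to_sphere_def)
  qed
qed

text \<open>The first coordinate determines the minimum. Away from the barycentre the others
  determine the differences up to a positive factor \<open>c\<close>, so \<open>x'\<close> is an
  increasing affine function of \<open>x\<close> and both attain the minimum at a common index. The
  excesses over the minimum then differ by the factor \<open>c\<close>, but have the same total, so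
  \<open>c = 1\<close>.\<close>

lemma to_sphere_inj:
  assumes x: "x \<in> sphere_dom d" "x' \<in> sphere_dom d" and pos: "0 < scaled_min d x"
    and eq: "to_sphere d x = to_sphere d x'" and "j \<le> d"
  shows "x j = x' j"
proof -
  let ?m = "scaled_min d x" and ?M = "Min (x ` {..d})" and ?M' = "Min (x' ` {..d})"
  have m: "scaled_min d x' = ?m"
    using fun_cong[OF eq, of 0] by (simp add: to_sphere_def)
  then have MM: "?M' = ?M" by (simp add: scaled_min_def)
  have "0 < ?M" using pos unfolding scaled_min_def by (simp only: zero_less_mult_iff) linarith
  then have sums: "(\<Sum>j\<le>d. x j) = 1" "(\<Sum>j\<le>d. x' j) = 1"
    using sum_sphere_dom[OF x(1)] sum_sphere_dom[OF x(2)] unfolding MM by blast+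
  have le: "?M \<le> x k" "?M \<le> x' k" if "k \<le> d" for k
    using that MM Min_le[of "x ` {..d}" "x k"] Min_le[of "x' ` {..d}" "x' k"] by auto
  have sw: "(\<Sum>j\<le>d. x j - ?M) = 1 - ?m" "(\<Sum>j\<le>d. x' j - ?M) = 1 - ?m"
    using sums by (simp_all add: sum_subtractf scaled_min_def)
  have "\<forall>k\<le>d. x k = x' k"
  proof (cases "?m = 1")
    case True
    have "(\<Sum>j\<le>d. x j - ?M) = 0" "(\<Sum>j\<le>d. x' j - ?M) = 0" using sw True by simp_all
    moreover have "0 \<le> x k - ?M" "0 \<le> x' k - ?M" if "k \<in> {..d}" for k using le[of k] that by simp_all
    ultimately have "\<forall>k\<in>{..d}. x k - ?M = 0" "\<forall>k\<in>{..d}. x' k - ?M = 0"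
      by (simp_all only: sum_nonneg_eq_0_iff finite_atMost)
    then show ?thesis by (metis atMost_iff right_minus_eq)
  next
    case False
    then have m1: "?m < 1" using scaled_min_bounds(2)[OF x(1)] by simp
    let ?n = "diff_norm d x" and ?n' = "diff_norm d x'"
    have "?n \<noteq> 0" "?n' \<noteq> 0"
      using diff_norm_zero[OF x(1)] diff_norm_zero[OF x(2)] m pos m1 by auto
    moreover have "0 \<le> ?n" "0 \<le> ?n'" by (simp_all add: diff_norm_def sum_nonneg)
    ultimately have n: "0 < ?n" "0 < ?n'" by simp_all
    define c where "c = ?n' / ?n"
    have c: "0 < c" using n by (simp add: c_def)
    have "x' k - x' 0 = c * (x k - x 0)" if "k \<le> d" for k
    proof (cases "k = 0")
      case False
      have "2 * sqrt (?m * (1 - ?m)) * ((x k - x 0) / ?n) = 2 * sqrt (?m * (1 - ?m)) * ((x' k - x' 0) / ?n')"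
        using fun_cong[OF eq, of k] False that m by (simp add: to_sphere_def)
      moreover have "2 * sqrt (?m * (1 - ?m)) \<noteq> 0" using pos m1 by simp
      ultimately have "(x k - x 0) / ?n = (x' k - x' 0) / ?n'"
        by (metis mult_left_cancel)
      then show ?thesis using n by (simp add: c_def field_simps)
    qed simp
    then have aff: "x' k = c * x k + (x' 0 - c * x 0)" if "k \<le> d" for k
      using that by (simp add: algebra_simps)
    obtain j0 where j0: "j0 \<le> d" "x j0 = ?M" using Min_in[of "x ` {..d}"] by fastforce
    obtain j1 where j1: "j1 \<le> d" "x' j1 = ?M" using Min_in[of "x' ` {..d}"] MM by fastforce
    have "c * x j0 \<le> c * x j1" using c le(1)[OF j1(1)] j0 by simp
    then have "x' j0 \<le> x' j1" using aff[OF j0(1)] aff[OF j1(1)] by linarith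
    then have "x' j0 = ?M" using le(2)[OF j0(1)] j1 by linarith
    then have a: "?M = c * ?M + (x' 0 - c * x 0)" using aff[OF j0(1)] j0 by simp
    have w: "x' k - ?M = c * (x k - ?M)" if "k \<le> d" for k
      using aff[OF that] a by (simp add: algebra_simps)
    have "(\<Sum>j\<le>d. x' j - ?M) = c * (\<Sum>j\<le>d. x j - ?M)"
      unfolding sum_distrib_left by (rule sum.cong) (use w in auto)
    then have "c = 1" using sw m1 by simp
    then show ?thesis using w by simp
  qed
  then show ?thesis using \<open>j \<le> d\<close> by blast
qed

lemma to_sphere_surj:
  assumes s: "s \<in> sphere_set d" "s \<noteq> corner"
  shows "\<exists>x. (\<forall>j. 0 \<le> x j) \<and> (\<forall>j>d. x j = 0) \<and> (\<Sum>j\<le>d. x j) = 1 \<and> to_sphere d x = s"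
proof -
  have s2: "(s 0)\<^sup>2 + (\<Sum>j=1..d. (s j)\<^sup>2) = 1" and sd: "\<And>j. j > d \<Longrightarrow> s j = 0"
    using s(1) by (auto simp: sphere_set_def atMost_eq_insert_0)
  have "0 \<le> (\<Sum>j=1..d. (s j)\<^sup>2)" by (simp add: sum_nonneg)
  then have "(s 0)\<^sup>2 \<le> 1" using s2 by linarith
  then have s0: "-1 \<le> s 0" "s 0 \<le> 1" by (auto simp: abs_square_le_1)
  have rest: "s j = 0" if "(s 0)\<^sup>2 = 1" "j \<noteq> 0" for j
  proof (cases "j \<le> d")
    case True
    have "(\<Sum>j=1..d. (s j)\<^sup>2) = 0" using s2 that by simp
    then have "\<forall>j\<in>{1..d}. (s j)\<^sup>2 = 0" by (subst (asm) sum_nonneg_eq_0_iff) auto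
    then show ?thesis using True that by simp
  qed (use sd in simp)
  have "s 0 \<noteq> 1"
  proof
    assume "s 0 = 1"
    then have "s = corner" using rest by (auto simp: corner_def)
    then show False using s(2) by blast
  qed
  define m where "m = (1 - s 0) / 2"
  have m: "0 < m" "m \<le> 1" "s 0 = 1 - 2 * m"
    using s0 \<open>s 0 \<noteq> 1\<close> by (auto simp: m_def field_simps)
  show ?thesis
  proof (cases "m = 1")
    case True
    define x where "x j = (if j \<le> d then 1 / real (Suc d) else 0)" for j
    have "x ` {..d} = {1 / real (Suc d)}" by (auto simp: x_def image_iff)
    then have "scaled_min d x = 1" by (simp add: scaled_min_def)
    moreover have "s j = 0" if "j \<noteq> 0" for j using rest[OF _ that] m(3) True by simp
    ultimately have "to_sphere d x = s"
      using True m(3) by (auto simp: to_sphere_def)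
    moreover have "(\<Sum>j\<le>d. x j) = 1" by (simp add: x_def)
    ultimately show ?thesis by (intro exI[of _ x]) (auto simp: x_def)
  next
    case False
    then have m1: "m < 1" using m by simp
    \<comment> \<open>Only differences to the coordinate 0 enter \<open>to_sphere\<close>, so
      \<open>u\<close> prescribes a direction. Subtracting its minimum \<open>M\<close> makes it
      nonnegative, and dividing by the total \<open>S\<close> lets the weight \<open>1 - m\<close>
      be distributed along it.\<close>
    define u where "u j = (if j = 0 then 0 else s j)" for j
    define M where "M = Min (u ` {..d})"
    define S where "S = (\<Sum>j\<le>d. u j - M)"
    have le: "M \<le> u j" if "j \<le> d" for j using that by (simp add: M_def)
    have "S \<noteq> 0"
    proof
      assume "S = 0"
      then have "\<forall>j\<in>{..d}. u j - M = 0"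
        unfolding S_def using le by (subst (asm) sum_nonneg_eq_0_iff) auto
      then have eqM: "u j = M" if "j \<le> d" for j using that by simp
      from eqM[of 0] have "M = 0" by (simp add: u_def)
      then have "s j = 0" if "j \<in> {1..d}" for j using eqM[of j] that by (auto simp: u_def)
      then have "(s 0)\<^sup>2 = 1" using s2 by simp
      then have "s 0 = 1 \<or> s 0 = -1" by (simp add: power2_eq_1_iff)
      then show False using \<open>s 0 \<noteq> 1\<close> m(3) m1 by auto
    qed
    moreover have "0 \<le> S" unfolding S_def using le by (intro sum_nonneg) auto
    ultimately have S: "0 < S" by simp
    define x where "x j = (if j \<le> d then m / real (Suc d) + (1 - m) / S * (u j - M) else 0)" for j
    have nn: "0 \<le> (1 - m) / S * (u j - M)" if "j \<le> d" for j
      using le[OF that] S m1 by simp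
    have Min_x: "Min (x ` {..d}) = m / real (Suc d)"
    proof (rule Min_eqI)
      obtain j0 where "j0 \<le> d" "u j0 = M" using Min_in[of "u ` {..d}"] unfolding M_def by fastforce
      then show "m / real (Suc d) \<in> x ` {..d}" by (intro image_eqI[of _ _ j0]) (auto simp: x_def)
    qed (use nn in \<open>auto simp: x_def\<close>)
    then have sm: "scaled_min d x = m" by (simp add: scaled_min_def)
    have "(\<Sum>j\<le>d. x j) = (\<Sum>j\<le>d. m / real (Suc d)) + (\<Sum>j\<le>d. (1 - m) / S * (u j - M))"
      unfolding sum.distrib[symmetric] by (rule sum.cong) (auto simp: x_def)
    also have "\<dots> = m + (1 - m) / S * S"
      unfolding S_def sum_distrib_left[symmetric] by simp
    also have "\<dots> = 1" using S by simp
    finally have sum1: "(\<Sum>j\<le>d. x j) = 1" .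
    have diff: "x j - x 0 = (1 - m) / S * u j" if "j \<le> d" for j
      using that by (simp add: x_def u_def right_diff_distrib)
    have "(\<Sum>j=1..d. (x j - x 0)\<^sup>2) = ((1 - m) / S)\<^sup>2 * (\<Sum>j=1..d. (s j)\<^sup>2)"
      unfolding sum_distrib_left using diff by (intro sum.cong) (auto simp: power_mult_distrib power_divide u_def)
    moreover have "(\<Sum>j=1..d. (s j)\<^sup>2) = 4 * (m * (1 - m))"
      using s2 m(3) by (simp add: power2_eq_square algebra_simps)
    ultimately have "diff_norm d x = sqrt (((1 - m) / S)\<^sup>2 * (4 * (m * (1 - m))))"
      by (simp add: diff_norm_def)
    also have "\<dots> = (1 - m) / S * (2 * sqrt (m * (1 - m)))"
      using m1 S by (simp add: real_sqrt_mult)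
    finally have dn: "diff_norm d x = (1 - m) / S * (2 * sqrt (m * (1 - m)))" .
    have "to_sphere d x = s"
    proof
      fix j
      consider "j = 0" | "j \<noteq> 0" "j \<le> d" | "j > d" by linarith
      then show "to_sphere d x j = s j"
      proof cases
        case 2
        have "to_sphere d x j = 2 * sqrt (m * (1 - m)) * ((1 - m) / S * u j / ((1 - m) / S * (2 * sqrt (m * (1 - m)))))"
          using 2 by (simp add: to_sphere_def sm dn diff)
        also have "\<dots> = u j"
          using m m1 S by simp
        finally show ?thesis using 2 by (simp add: u_def)
      qed (auto simp: to_sphere_def sm m(3) sd)
    qed
    moreover have "0 \<le> x j" for j using nn m(1) by (simp add: x_def)
    ultimately show ?thesis using sum1 by (intro exI[of _ x]) (auto simp: x_def)
  qed
qed

section \<open>Wedges of spheres from maximal faces\<close>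

locale facet_complex =
  fixes K :: "'v set set" and F :: "'v set set" and d :: nat
  assumes K: "finite_complex K" and FK: "F \<subseteq> K"
    and card_facet: "\<And>\<sigma>. \<sigma> \<in> F \<Longrightarrow> card \<sigma> = Suc d"
    and maximal: "\<And>\<sigma> \<tau>. \<lbrakk>\<sigma> \<in> F; \<tau> \<in> K; \<sigma> \<subseteq> \<tau>\<rbrakk> \<Longrightarrow> \<tau> = \<sigma>"
    and coll: "collapsible (K - F)" and ne: "K \<noteq> {}"
begin

abbreviation "X \<equiv> realization_set K"
abbreviation "A \<equiv> realization_set (K - F)"

definition low :: "'v set \<Rightarrow> ('v \<Rightarrow> real) \<Rightarrow> real" where
  "low \<sigma> f = Min (f ` \<sigma>)"

text \<open>At a point of the realization at most one summand is nonzero. Summing over all facets,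
  here and in the two functions below, gives continuity without a case distinction on the
  facet.\<close>

definition mass :: "('v \<Rightarrow> real) \<Rightarrow> real" where
  "mass f = (\<Sum>\<sigma>\<in>F. real (Suc d) * low \<sigma> f)"

definition resid :: "('v \<Rightarrow> real) \<Rightarrow> 'v \<Rightarrow> real" where
  "resid f v = f v - (\<Sum>\<sigma>\<in>F. if v \<in> \<sigma> then low \<sigma> f else 0)"

text \<open>A point of a facet is \<open>mass f\<close> times the barycentre plus \<open>resid f\<close>, and \<open>resid f\<close> is a multiple of a
  boundary point. The homotopy of \<open>ex_homotopy\<close> extends a contraction of \<open>A\<close>: at time \<open>t\<close> the points
  with \<open>mass f \<ge> t / 2\<close> are stretched over the whole facet by \<open>inflate\<close>, and the contraction is
  spread over the remaining collar.\<close>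

definition inflate :: "real \<Rightarrow> ('v \<Rightarrow> real) \<Rightarrow> 'v \<Rightarrow> real" where
  "inflate t f v =
     (resid f v + (\<Sum>\<sigma>\<in>F. if v \<in> \<sigma> then max 0 (low \<sigma> f - t / (2 * real (Suc d))) else 0)) / (1 - t / 2)"

lemma finF: "finite F"
  using K FK finite_subset by (auto simp: finite_complex_def)

lemma facet: "finite \<sigma>" "\<sigma> \<noteq> {}" if "\<sigma> \<in> F"
  using card_facet[OF that] by (auto intro: card_ge_0_finite)

lemma KF: "finite_complex (K - F)"
  by (rule finite_complex_Diff[OF K]) (use maximal in blast)

lemma AX: "A \<subseteq> X"
  by (rule realization_set_mono) blast

lemma KF_ne: "K - F \<noteq> {}"
proof -
  have "{} \<in> K" using K ne by (auto simp: finite_complex_def)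
  moreover have "{} \<notin> F" using facet(2) by blast
  ultimately show ?thesis by blast
qed

lemma A_ne: "A \<noteq> {}"
  by (rule realization_set_nonempty[OF coll KF KF_ne])

lemma low_nonneg: "f \<in> X \<Longrightarrow> \<sigma> \<in> F \<Longrightarrow> 0 \<le> low \<sigma> f"
  using facet[of \<sigma>] realization_setD(1)[of f K] by (simp add: low_def)

text \<open>Positivity means that the support contains \<sigma>, and by maximality it then equals
  \<sigma>.\<close>

lemma low_pos_iff:
  assumes "f \<in> X" "\<sigma> \<in> F"
  shows "0 < low \<sigma> f \<longleftrightarrow> {v. f v \<noteq> 0} = \<sigma>"
proof -
  have "0 < low \<sigma> f \<longleftrightarrow> \<sigma> \<subseteq> {v. f v \<noteq> 0}"
    unfolding low_def using facet[OF assms(2)] realization_setD(1)[OF assms(1)] by (rule Min_image_pos_iff)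
  then show ?thesis
    using maximal[OF assms(2) realization_setD(2)[OF assms(1)]] by blast
qed

lemma low_eq_0_iff:
  assumes "f \<in> X" "\<sigma> \<in> F"
  shows "low \<sigma> f = 0 \<longleftrightarrow> {v. f v \<noteq> 0} \<noteq> \<sigma>"
  using low_pos_iff[OF assms] low_nonneg[OF assms] by (auto simp: less_le)

lemma in_A_iff: "f \<in> X \<Longrightarrow> f \<in> A \<longleftrightarrow> {v. f v \<noteq> 0} \<notin> F"
  by (auto simp: realization_set_def)

lemma low_A: "f \<in> A \<Longrightarrow> \<sigma> \<in> F \<Longrightarrow> low \<sigma> f = 0"
  using low_eq_0_iff in_A_iff AX by blast

lemma mass_A: "f \<in> A \<Longrightarrow> mass f = 0"
  unfolding mass_def by (simp add: low_A)

lemma resid_A: "f \<in> A \<Longrightarrow> resid f = f"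
  unfolding resid_def by (simp add: low_A cong: if_cong)

context
  fixes f \<sigma>
  assumes f: "f \<in> X" and \<sigma>: "\<sigma> \<in> F" and supp: "{v. f v \<noteq> 0} = \<sigma>"
begin

lemma low_other: "\<tau> \<in> F \<Longrightarrow> \<tau> \<noteq> \<sigma> \<Longrightarrow> low \<tau> f = 0"
  using low_eq_0_iff[OF f] supp by blast

lemma mass_facet: "mass f = real (Suc d) * low \<sigma> f"
proof -
  have "mass f = (\<Sum>\<tau>\<in>F. if \<tau> = \<sigma> then real (Suc d) * low \<sigma> f else 0)"
    unfolding mass_def by (rule sum.cong) (auto simp: low_other)
  then show ?thesis using finF \<sigma> by simp
qed

lemma resid_facet: "resid f v = (if v \<in> \<sigma> then f v - low \<sigma> f else 0)"
proof -
  have "(\<Sum>\<tau>\<in>F. if v \<in> \<tau> then low \<tau> f else 0) = (\<Sum>\<tau>\<in>F. if \<tau> = \<sigma> then if v \<in> \<sigma> then low \<sigma> f else 0 else 0)"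
    by (rule sum.cong) (auto simp: low_other)
  also have "\<dots> = (if v \<in> \<sigma> then low \<sigma> f else 0)" using finF \<sigma> by simp
  finally show ?thesis using supp by (auto simp: resid_def)
qed

lemma inflate_facet:
  assumes "0 \<le> t"
  shows "inflate t f v =
    (resid f v + (if v \<in> \<sigma> then max 0 (low \<sigma> f - t / (2 * real (Suc d))) else 0)) / (1 - t / 2)"
proof -
  have "(\<Sum>\<tau>\<in>F. if v \<in> \<tau> then max 0 (low \<tau> f - t / (2 * real (Suc d))) else 0) =
     (\<Sum>\<tau>\<in>F. if \<tau> = \<sigma> then if v \<in> \<sigma> then max 0 (low \<sigma> f - t / (2 * real (Suc d))) else 0 else 0)"
  proof (intro sum.cong refl)
    have "0 \<le> t / (2 * real (Suc d))" using assms by simp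
    then show "(if v \<in> \<tau> then max 0 (low \<tau> f - t / (2 * real (Suc d))) else 0) =
        (if \<tau> = \<sigma> then if v \<in> \<sigma> then max 0 (low \<sigma> f - t / (2 * real (Suc d))) else 0 else 0)"
      if "\<tau> \<in> F" for \<tau>
      by (cases "\<tau> = \<sigma>") (simp_all add: low_other[OF that])
  qed
  also have "\<dots> = (if v \<in> \<sigma> then max 0 (low \<sigma> f - t / (2 * real (Suc d))) else 0)"
    using finF \<sigma> by simp
  finally show ?thesis by (simp add: inflate_def)
qed

lemma sum_resid_facet: "sum (resid f) \<sigma> = 1 - mass f"
proof -
  have "sum (resid f) \<sigma> = sum f \<sigma> - real (card \<sigma>) * low \<sigma> f"
    by (simp add: resid_facet sum_subtractf)
  also have "sum f \<sigma> = 1" using realization_setD(3)[OF f] supp by simp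
  finally show ?thesis by (simp add: mass_facet card_facet[OF \<sigma>])
qed

lemma resid_facet_nonneg: "0 \<le> resid f v"
  using facet(1)[OF \<sigma>] by (simp add: resid_facet low_def)

text \<open>This is the radial projection from the barycentre. A vertex attaining the minimum loses
  its coordinate, and the face without it is not deleted, since it is not maximal.\<close>

lemma resid_scaled_in_A:
  assumes "mass f < 1"
  shows "(\<lambda>v. resid f v / (1 - mass f)) \<in> A"
proof -
  obtain v0 where v0: "v0 \<in> \<sigma>" "f v0 = low \<sigma> f"
    using Min_in[of "f ` \<sigma>"] facet[OF \<sigma>] unfolding low_def by fastforce
  have sub: "\<sigma> - {v0} \<in> K" using K FK \<sigma> unfolding finite_complex_def by blast
  moreover have "\<sigma> - {v0} \<notin> F" using maximal[of "\<sigma> - {v0}" \<sigma>] FK \<sigma> v0 by blast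
  ultimately have KF': "\<sigma> - {v0} \<in> K - F" by blast
  have "sum (resid f) (\<sigma> - {v0}) = 1 - mass f"
    using sum_resid_facet sum.remove[of \<sigma> v0 "resid f"] v0 facet(1)[OF \<sigma>] by (simp add: resid_facet)
  then have "(\<Sum>v\<in>\<sigma> - {v0}. resid f v / (1 - mass f)) = 1"
    using assms by (simp flip: sum_divide_distrib)
  then show ?thesis
    using v0 assms resid_facet_nonneg by (intro realization_setI[OF KF KF']) (auto simp: resid_facet)
qed

lemma inflate_in_X:
  assumes "0 \<le> t" "t \<le> 1" "t / 2 \<le> mass f"
  shows "inflate t f \<in> X"
proof -
  let ?e = "low \<sigma> f - t / (2 * real (Suc d))"
  have e: "0 \<le> ?e" using assms by (simp add: mass_facet field_simps)
  have "sum (inflate t f) \<sigma> = (\<Sum>v\<in>\<sigma>. resid f v / (1 - t / 2) + ?e / (1 - t / 2))"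
    using e assms(1) by (intro sum.cong) (auto simp: inflate_facet add_divide_distrib)
  also have "\<dots> = sum (resid f) \<sigma> / (1 - t / 2) + real (Suc d) * (?e / (1 - t / 2))"
    by (simp add: sum.distrib card_facet[OF \<sigma>] flip: sum_divide_distrib)
  also have "\<dots> = (1 - mass f + real (Suc d) * ?e) / (1 - t / 2)"
    by (simp add: sum_resid_facet add_divide_distrib)
  also have "real (Suc d) * ?e = mass f - t / 2"
    unfolding mass_facet by (simp add: right_diff_distrib field_simps)
  finally have "sum (inflate t f) \<sigma> = 1" using assms by simp
  then show ?thesis
    using FK \<sigma> assms e resid_facet_nonneg
    by (intro realization_setI[OF K, of \<sigma>]) (auto simp: inflate_facet resid_facet)
qed

end

lemma resid_scaled_in_A':
  assumes "f \<in> X" "mass f < 1"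
  shows "(\<lambda>v. resid f v / (1 - mass f)) \<in> A"
proof (cases "f \<in> A")
  case True
  then show ?thesis by (simp add: resid_A mass_A)
next
  case False
  then show ?thesis using in_A_iff[OF assms(1)] resid_scaled_in_A[OF assms(1) _ refl] assms(2) by blast
qed

lemma mass_nonneg: "f \<in> X \<Longrightarrow> 0 \<le> mass f"
  unfolding mass_def using low_nonneg by (intro sum_nonneg) simp

lemma inflate_in_X':
  assumes "f \<in> X" "0 \<le> t" "t \<le> 1" "t / 2 \<le> mass f"
  shows "inflate t f \<in> X"
proof (cases "f \<in> A")
  case True
  then have "t = 0" using assms by (simp add: mass_A)
  then have "inflate t f = f" using True by (auto simp: inflate_def resid_A low_A fun_eq_iff cong: if_cong)
  then show ?thesis using assms by simp
next
  case False
  then show ?thesis using in_A_iff[OF assms(1)] inflate_in_X[OF assms(1) _ refl] assms by blast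
qed

text \<open>Every positive part in \<open>inflate\<close> vanishes here, so stretching agrees with
  radial projection; this joins the two branches of the homotopy.\<close>

lemma inflate_boundary:
  assumes "f \<in> X" "0 \<le> t" "t / 2 = mass f"
  shows "inflate t f = (\<lambda>v. resid f v / (1 - mass f))"
proof -
  have "low \<sigma> f \<le> t / (2 * real (Suc d))" if "\<sigma> \<in> F" for \<sigma>
  proof -
    have "real (Suc d) * low \<sigma> f \<le> mass f"
      unfolding mass_def using that finF low_nonneg[OF assms(1)]
      by (intro member_le_sum) auto
    then show ?thesis using assms(3) by (simp add: field_simps)
  qed
  then have "(\<Sum>\<sigma>\<in>F. if v \<in> \<sigma> then max 0 (low \<sigma> f - t / (2 * real (Suc d))) else 0) = 0" for v
    by (intro sum.neutral) auto
  then show ?thesis by (simp add: inflate_def assms(3) fun_eq_iff)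
qed

lemma inflate_0: "inflate 0 f = f" if "f \<in> X"
proof
  fix v
  have "(\<Sum>\<sigma>\<in>F. if v \<in> \<sigma> then max 0 (low \<sigma> f - 0 / (2 * real (Suc d))) else 0) = (\<Sum>\<sigma>\<in>F. if v \<in> \<sigma> then low \<sigma> f else 0)"
    using low_nonneg[OF that] by (intro sum.cong) auto
  then show "inflate 0 f v = f v" by (simp add: inflate_def resid_def)
qed

lemma continuous_on_low: "\<sigma> \<in> F \<Longrightarrow> continuous_on S g \<Longrightarrow> continuous_on S (\<lambda>z. low \<sigma> (g z))"
  unfolding low_def by (intro continuous_on_Min_image facet)

lemma continuous_on_mass: "continuous_on S g \<Longrightarrow> continuous_on S (\<lambda>z. mass (g z))"
  unfolding mass_def by (intro continuous_on_sum continuous_on_mult continuous_on_const continuous_on_low)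

lemma continuous_on_if_const:
  "(P \<Longrightarrow> continuous_on S p) \<Longrightarrow> (\<not> P \<Longrightarrow> continuous_on S q) \<Longrightarrow> continuous_on S (\<lambda>z. if P then p z else q z)"
  by (cases P) simp_all

lemma continuous_on_resid: "continuous_on S g \<Longrightarrow> continuous_on S (\<lambda>z. resid (g z) v)"
  unfolding resid_def
  by (intro continuous_on_diff continuous_on_sum continuous_on_if_const continuous_on_const continuous_on_low)
    (auto intro: continuous_on_coordinate)

lemma ex_homotopy:
  obtains h a where "continuous_on ({0..1::real} \<times> X) h" "h \<in> {0..1} \<times> X \<rightarrow> X" "\<And>f. f \<in> X \<Longrightarrow> h (0, f) = f"
    "\<And>t f. \<lbrakk>t \<in> {0..1}; f \<in> A\<rbrakk> \<Longrightarrow> h (t, f) \<in> A" "\<And>f. f \<in> A \<Longrightarrow> h (1, f) = a"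
proof -
  have "contractible_space (top_of_set A)"
    by (rule contractible_realization_set[OF coll KF KF_ne])
  then obtain a H where H: "continuous_map (prod_topology (top_of_set {0..1::real}) (top_of_set A)) (top_of_set A) H"
    "\<And>f. H (0, f) = f" "\<And>f. H (1, f) = a"
    unfolding contractible_space_def homotopic_with_def by auto
  then have cH: "continuous_on ({0..1} \<times> A) H" and HA: "H \<in> {0..1} \<times> A \<rightarrow> A"
    by auto
  \<comment> \<open>A collar point is projected to \<open>A\<close> and contracted for the time
    \<open>t - 2 * mass f\<close>, which is 0 at the inner edge of the collar and \<open>t\<close>
    on \<open>A\<close>. The factor 1/2 keeps the mass in the collar at most 1/2, away from the
    barycentre, where the projection is undefined.\<close>
  define h where "h = (\<lambda>(t, f). if mass f - t / 2 \<le> 0 then H (t - 2 * mass f, \<lambda>v. resid f v / (1 - mass f))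
    else inflate t f)"
  let ?S = "{0..1::real} \<times> X"
  have cm: "continuous_on S (\<lambda>z::real \<times> ('v \<Rightarrow> real). mass (snd z))" for S
    by (intro continuous_on_mass continuous_on_snd continuous_on_id)
  have ct: "continuous_on S (\<lambda>z::real \<times> ('v \<Rightarrow> real). fst z)" for S
    by (intro continuous_on_fst continuous_on_id)
  have cr: "continuous_on S (\<lambda>z::real \<times> ('v \<Rightarrow> real). resid (snd z) v)" for S v
    by (intro continuous_on_resid continuous_on_snd continuous_on_id)
  have "continuous_on ?S (\<lambda>z. if mass (snd z) - fst z / 2 \<le> 0
      then H (fst z - 2 * mass (snd z), \<lambda>v. resid (snd z) v / (1 - mass (snd z))) else inflate (fst z) (snd z))"
  proof (rule continuous_on_cases_le)
    show "continuous_on {z \<in> ?S. mass (snd z) - fst z / 2 \<le> 0}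
      (\<lambda>z. H (fst z - 2 * mass (snd z), \<lambda>v. resid (snd z) v / (1 - mass (snd z))))"
    proof (rule continuous_on_compose2[OF cH])
      show "continuous_on {z \<in> ?S. mass (snd z) - fst z / 2 \<le> 0}
        (\<lambda>z. (fst z - 2 * mass (snd z), \<lambda>v. resid (snd z) v / (1 - mass (snd z))))"
        by (intro continuous_on_Pair continuous_on_diff continuous_on_mult continuous_on_const cm ct
            continuous_on_coordinatewise_then_product continuous_on_divide cr) auto
      show "(\<lambda>z. (fst z - 2 * mass (snd z), \<lambda>v. resid (snd z) v / (1 - mass (snd z)))) `
          {z \<in> ?S. mass (snd z) - fst z / 2 \<le> 0} \<subseteq> {0..1} \<times> A"
      proof (intro image_subsetI)
        fix z assume z: "z \<in> {z \<in> ?S. mass (snd z) - fst z / 2 \<le> 0}"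
        then have "snd z \<in> X" "mass (snd z) < 1" "0 \<le> mass (snd z)" using mass_nonneg by auto
        then show "(fst z - 2 * mass (snd z), \<lambda>v. resid (snd z) v / (1 - mass (snd z))) \<in> {0..1} \<times> A"
          using z resid_scaled_in_A' by auto
      qed
    qed
    show "continuous_on {z \<in> ?S. 0 \<le> mass (snd z) - fst z / 2} (\<lambda>z. inflate (fst z) (snd z))"
      unfolding inflate_def
      by (intro continuous_on_coordinatewise_then_product continuous_on_divide continuous_on_add cr
          continuous_on_sum continuous_on_if_const continuous_on_max continuous_on_diff
          continuous_on_const ct continuous_on_low continuous_on_snd continuous_on_id) auto
    show "continuous_on ?S (\<lambda>z. mass (snd z) - fst z / 2)"
      by (intro continuous_on_diff continuous_on_divide continuous_on_const cm ct) auto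
    show "H (fst z - 2 * mass (snd z), \<lambda>v. resid (snd z) v / (1 - mass (snd z))) = inflate (fst z) (snd z)"
      if "z \<in> ?S" "mass (snd z) - fst z / 2 = 0" for z
      using that H(2) inflate_boundary[of "snd z" "fst z"] by auto
  qed
  then have ch: "continuous_on ?S h" by (simp add: h_def case_prod_beta)
  show ?thesis
  proof (rule that[OF ch])
    show "h \<in> ?S \<rightarrow> X"
    proof (rule funcsetI)
      fix z assume "z \<in> ?S"
      then obtain t f where z: "z = (t, f)" "0 \<le> t" "t \<le> 1" "f \<in> X" by auto
      show "h z \<in> X"
      proof (cases "mass f - t / 2 \<le> 0")
        case True
        then have "mass f < 1" "0 \<le> t - 2 * mass f" "t - 2 * mass f \<le> 1" using z mass_nonneg[of f] by auto
        then show ?thesis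
          using True z HA resid_scaled_in_A'[of f] AX unfolding h_def by auto
      next
        case False
        then show ?thesis using z inflate_in_X'[of f t] by (simp add: h_def)
      qed
    qed
    show "h (0, f) = f" if "f \<in> X" for f
    proof (cases "mass f = 0")
      case True
      then have "h (0, f) = resid f" by (simp add: h_def H(2))
      also have "resid f = f"
        using inflate_boundary[of f 0] inflate_0[of f] that True by simp
      finally show ?thesis .
    next
      case False
      then show ?thesis using mass_nonneg[OF that] inflate_0[OF that] by (simp add: h_def)
    qed
    show "h (t, f) \<in> A" if "t \<in> {0..1}" "f \<in> A" for t f
      using that HA by (auto simp: h_def mass_A resid_A)
    show "h (1, f) = a" if "f \<in> A" for f
      using that by (simp add: h_def mass_A resid_A H(3))
  qed
qed

end

section \<open>The quotient map from the realization onto the wedge\<close>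

lemma wedge_of_spheres_eq: "wedge_of_spheres N d = wedge_space {..<N} (\<lambda>_. nsphere d) (\<lambda>_. corner)"
  unfolding wedge_of_spheres_def corner_def ..

abbreviation winj :: "nat \<Rightarrow> (nat \<Rightarrow> real) \<Rightarrow> (nat \<times> (nat \<Rightarrow> real)) option" where
  "winj \<equiv> wedge_inj (\<lambda>_. corner)"

lemma wedge_inj_corner: "winj i x = (if x = corner then None else Some (i, x))"
  by (simp add: wedge_inj_def)

lemma topspace_wedge_of_spheres:
  "topspace (wedge_of_spheres N d) = insert None (\<Union>i<N. winj i ` sphere_set d)"
  by (simp add: wedge_of_spheres_eq topspace_wedge_space nsphere_eq)

lemma openin_wedge_of_spheres:
  "openin (wedge_of_spheres N d) U \<longleftrightarrow> U \<subseteq> topspace (wedge_of_spheres N d) \<and>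
     (\<forall>i<N. openin (nsphere d) {x \<in> sphere_set d. winj i x \<in> U})"
  unfolding topspace_wedge_of_spheres by (simp add: wedge_of_spheres_eq openin_wedge_space nsphere_eq Ball_def)

lemma compact_closed_simplex:
  assumes "finite \<sigma>"
  shows "compact {f :: 'v \<Rightarrow> real. (\<forall>v. 0 \<le> f v) \<and> (\<forall>v. v \<notin> \<sigma> \<longrightarrow> f v = 0) \<and> sum f \<sigma> = 1}" (is "compact ?T")
proof -
  let ?B = "PiE UNIV (\<lambda>v. if v \<in> \<sigma> then {0..1} else {0}) :: ('v \<Rightarrow> real) set"
  have "compactin (powertop_real UNIV) ?B"
    unfolding compactin_PiE by auto
  then have "compact ?B" by (simp add: euclidean_product_topology)
  moreover have "continuous_on UNIV (\<lambda>f :: 'v \<Rightarrow> real. sum f \<sigma>)"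
    by (intro continuous_on_sum continuous_on_coordinate[OF continuous_on_id])
  then have "closed {f :: 'v \<Rightarrow> real. sum f \<sigma> = 1}"
    by (intro closed_Collect_eq continuous_on_const)
  ultimately have "compact (?B \<inter> {f. sum f \<sigma> = 1})" by (rule compact_Int_closed)
  moreover have "?B \<inter> {f. sum f \<sigma> = 1} = ?T"
  proof (intro equalityI subsetI)
    fix f assume "f \<in> ?B \<inter> {f. sum f \<sigma> = 1}"
    then have *: "\<And>v. f v \<in> (if v \<in> \<sigma> then {0..1} else {0})" and "sum f \<sigma> = 1" by (auto simp: PiE_iff)
    moreover have "0 \<le> f v" "v \<notin> \<sigma> \<Longrightarrow> f v = 0" for v using *[of v] by (auto split: if_splits)
    ultimately show "f \<in> ?T" by blast
  next
    fix f assume f: "f \<in> ?T"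
    then have "f v \<le> 1" if "v \<in> \<sigma>" for v
      using member_le_sum[of v \<sigma> f] that assms by auto
    then show "f \<in> ?B \<inter> {f. sum f \<sigma> = 1}" using f by (auto simp: PiE_iff)
  qed
  ultimately show ?thesis by simp
qed

context facet_complex
begin

context
  fixes N :: nat and e :: "nat \<Rightarrow> 'v set" and en :: "'v set \<Rightarrow> nat \<Rightarrow> 'v"
  assumes e: "bij_betw e {..<N} F" and en: "\<And>\<sigma>. \<sigma> \<in> F \<Longrightarrow> bij_betw (en \<sigma>) {..d} \<sigma>"
begin

definition theta :: "nat \<Rightarrow> ('v \<Rightarrow> real) \<Rightarrow> nat \<Rightarrow> real" where
  "theta i f = to_sphere d (f \<circ> en (e i))"

definition active :: "('v \<Rightarrow> real) \<Rightarrow> nat \<Rightarrow> bool" where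
  "active f i \<longleftrightarrow> i < N \<and> 0 < low (e i) f"

definition wedge_map :: "('v \<Rightarrow> real) \<Rightarrow> (nat \<times> (nat \<Rightarrow> real)) option" where
  "wedge_map f = (if \<exists>i. active f i then Some (THE i. active f i, theta (THE i. active f i) f) else None)"

lemma eF: "i < N \<Longrightarrow> e i \<in> F"
  using e by (auto simp: bij_betw_def)

lemma scaled_min_low: "\<sigma> \<in> F \<Longrightarrow> scaled_min d (f \<circ> en \<sigma>) = real (Suc d) * low \<sigma> f"
  using en[of \<sigma>] by (simp add: scaled_min_def low_def bij_betw_def flip: image_image image_comp)

lemma sum_en: "\<sigma> \<in> F \<Longrightarrow> (\<Sum>j\<le>d. (f \<circ> en \<sigma>) j) = sum f \<sigma>" for f :: "'v \<Rightarrow> real"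
  using sum.reindex_bij_betw[OF en, of \<sigma> f] by simp

lemma comp_in_sphere_dom:
  assumes "f \<in> X" "\<sigma> \<in> F"
  shows "f \<circ> en \<sigma> \<in> sphere_dom d"
proof -
  let ?S = "{v. f v \<noteq> 0}"
  have "finite ?S" using realization_setD(2)[OF assms(1)] K by (auto simp: finite_complex_def)
  then have "sum f (\<sigma> \<union> ?S) = 1"
    using facet(1)[OF assms(2)] by (intro sum_realization_set[OF assms(1)]) auto
  moreover have "sum f \<sigma> \<le> sum f (\<sigma> \<union> ?S)"
    using \<open>finite ?S\<close> facet(1)[OF assms(2)] realization_setD(1)[OF assms(1)] by (intro sum_mono2) auto
  ultimately have "sum f \<sigma> \<le> 1" by simp
  moreover have "sum f \<sigma> = 1" if "0 < Min ((f \<circ> en \<sigma>) ` {..d})"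
  proof -
    have "0 < scaled_min d (f \<circ> en \<sigma>)" unfolding scaled_min_def using that by (intro mult_pos_pos) auto
    then have "0 < low \<sigma> f" unfolding scaled_min_low[OF assms(2)] by (simp add: zero_less_mult_iff)
    then show ?thesis using low_pos_iff[OF assms] realization_setD(3)[OF assms(1)] by blast
  qed
  ultimately show ?thesis
    unfolding sphere_dom_def mem_Collect_eq sum_en[OF assms(2)] using realization_setD(1)[OF assms(1)] by simp
qed

lemma theta_in_sphere: "f \<in> X \<Longrightarrow> i < N \<Longrightarrow> theta i f \<in> sphere_set d"
  unfolding theta_def by (intro to_sphere_in_sphere comp_in_sphere_dom eF)

lemma theta_eq_corner_iff: "f \<in> X \<Longrightarrow> i < N \<Longrightarrow> theta i f = corner \<longleftrightarrow> \<not> active f i"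
  unfolding theta_def to_sphere_eq_corner_iff active_def
  using low_nonneg[of f "e i"] by (auto simp: scaled_min_low eF less_le)

lemma active_iff: "f \<in> X \<Longrightarrow> active f i \<longleftrightarrow> i < N \<and> {v. f v \<noteq> 0} = e i"
  unfolding active_def using low_pos_iff[OF _ eF] by blast

lemma active_unique: "f \<in> X \<Longrightarrow> active f i \<Longrightarrow> active f j \<Longrightarrow> i = j"
  using e by (auto simp: active_iff bij_betw_def inj_on_def)

lemma wedge_map_active: "f \<in> X \<Longrightarrow> active f i \<Longrightarrow> wedge_map f = Some (i, theta i f)"
proof -
  assume *: "f \<in> X" "active f i"
  then have "(THE i. active f i) = i" using active_unique by blast
  then show ?thesis using * by (auto simp: wedge_map_def)
qed

lemma wedge_map_inactive: "(\<And>i. \<not> active f i) \<Longrightarrow> wedge_map f = None"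
  by (simp add: wedge_map_def)

lemma winj_theta: "f \<in> X \<Longrightarrow> i < N \<Longrightarrow> winj i (theta i f) = (if active f i then Some (i, theta i f) else None)"
  using theta_eq_corner_iff[of f i] by (simp add: wedge_inj_corner)

text \<open>At most one facet is active, and all other sphere maps give the base point. Preimages
  under \<open>wedge_map\<close> thus become finite intersections or unions of preimages under
  continuous maps to single spheres.\<close>

lemma wedge_map_in_iff:
  assumes "f \<in> X"
  shows "wedge_map f \<in> U \<longleftrightarrow>
    (if None \<in> U then \<forall>i<N. winj i (theta i f) \<in> U else \<exists>i<N. winj i (theta i f) \<in> U)"
proof (cases "\<exists>i. active f i")
  case True
  then obtain i where i: "active f i" by blast
  then have "i < N" by (simp add: active_def)
  have "\<not> active f j" if "j \<noteq> i" for j using active_unique[OF assms i] that by blast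
  then have other: "winj j (theta j f) = None" if "j \<noteq> i" "j < N" for j
    using that winj_theta[OF assms] by simp
  have act: "winj i (theta i f) = wedge_map f"
    using winj_theta[OF assms \<open>i < N\<close>] wedge_map_active[OF assms i] i by simp
  show ?thesis using act other \<open>i < N\<close> by metis
next
  case False
  then have "wedge_map f = None" by (simp add: wedge_map_inactive)
  moreover have "winj i (theta i f) = None" if "i < N" for i using False winj_theta[OF assms that] by simp
  ultimately show ?thesis by auto
qed

lemma continuous_on_theta: "i < N \<Longrightarrow> continuous_on X (theta i)"
  unfolding theta_def
proof (rule continuous_on_compose2[OF continuous_on_to_sphere])
  show "continuous_on X (\<lambda>f. f \<circ> en (e i))"
    unfolding o_def by (intro continuous_on_coordinatewise_then_product continuous_on_coordinate[OF continuous_on_id])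
qed (use comp_in_sphere_dom eF in auto)

lemma continuous_map_theta: "i < N \<Longrightarrow> continuous_map (top_of_set X) (nsphere d) (theta i)"
  using continuous_on_theta theta_in_sphere by (auto simp: nsphere_eq)

lemma theta_surj:
  assumes i: "i < N" and s: "s \<in> sphere_set d" "s \<noteq> corner"
  obtains f where "f \<in> X" "\<And>v. v \<notin> e i \<Longrightarrow> f v = 0" "theta i f = s" "active f i"
proof -
  obtain x where x: "\<forall>j. 0 \<le> x j" "(\<Sum>j\<le>d. x j) = 1" "to_sphere d x = s"
    using to_sphere_surj[OF s] by blast
  let ?\<sigma> = "e i"
  note \<sigma> = eF[OF i]
  define f where "f v = (if v \<in> ?\<sigma> then x (inv_into {..d} (en ?\<sigma>) v) else 0)" for v
  have inj: "inj_on (en ?\<sigma>) {..d}" and im: "en ?\<sigma> ` {..d} = ?\<sigma>"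
    using en[OF \<sigma>] by (auto simp: bij_betw_def)
  have fen: "(f \<circ> en ?\<sigma>) j = x j" if "j \<le> d" for j
    using that inj im by (auto simp: f_def)
  have "sum f ?\<sigma> = (\<Sum>j\<le>d. (f \<circ> en ?\<sigma>) j)" by (rule sum_en[OF \<sigma>, symmetric])
  also have "\<dots> = (\<Sum>j\<le>d. x j)" by (rule sum.cong) (use fen in auto)
  finally have "sum f ?\<sigma> = 1" using x(2) by simp
  then have fX: "f \<in> X"
    using \<sigma> FK x(1) by (intro realization_setI[OF K, of ?\<sigma>]) (auto simp: f_def)
  have "(f \<circ> en ?\<sigma>) ` {..d} = x ` {..d}" by (rule image_cong) (use fen in auto)
  then have "scaled_min d (f \<circ> en ?\<sigma>) = scaled_min d x" by (simp add: scaled_min_def)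
  moreover have "diff_norm d (f \<circ> en ?\<sigma>) = diff_norm d x"
    unfolding diff_norm_def by (intro arg_cong[of _ _ sqrt] sum.cong) (use fen in auto)
  ultimately have "to_sphere d (f \<circ> en ?\<sigma>) = to_sphere d x"
    using fen by (intro ext) (simp add: to_sphere_def del: o_apply)
  then have "theta i f = s" using x(3) by (simp add: theta_def)
  moreover from this have "active f i" using theta_eq_corner_iff[OF fX i] s by blast
  ultimately show thesis using fX by (intro that) (auto simp: f_def)
qed

lemma wedge_map_image: "wedge_map ` X = topspace (wedge_of_spheres N d)"
proof (intro equalityI subsetI)
  fix w assume "w \<in> wedge_map ` X"
  then obtain f where f: "f \<in> X" "w = wedge_map f" by blast
  show "w \<in> topspace (wedge_of_spheres N d)"
  proof (cases "\<exists>i. active f i")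
    case True
    then obtain i where i: "active f i" by blast
    then have iN: "i < N" by (simp add: active_def)
    have "w = winj i (theta i f)" using winj_theta[OF f(1) iN] wedge_map_active[OF f(1) i] i f(2) by simp
    then show ?thesis using theta_in_sphere[OF f(1) iN] iN unfolding topspace_wedge_of_spheres by blast
  next
    case False
    then show ?thesis using wedge_map_inactive f(2) by (simp add: topspace_wedge_of_spheres)
  qed
next
  fix w assume w: "w \<in> topspace (wedge_of_spheres N d)"
  show "w \<in> wedge_map ` X"
  proof (cases w)
    case None
    obtain f where f: "f \<in> A" using A_ne by blast
    then have "\<not> active f i" for i using low_A[OF f eF] by (auto simp: active_def)
    then show ?thesis using f AX None wedge_map_inactive by (metis imageI subsetD)
  next
    case (Some p)
    then obtain i x where ix: "i < N" "x \<in> sphere_set d" "w = winj i x"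
      using w unfolding topspace_wedge_of_spheres by blast
    then have "x \<noteq> corner" using Some by (auto simp: wedge_inj_corner)
    then obtain f where "f \<in> X" "theta i f = x" "active f i"
      using theta_surj[OF ix(1,2)] by metis
    then have "wedge_map f = w" using ix wedge_map_active \<open>x \<noteq> corner\<close> by (simp add: wedge_inj_corner)
    then show ?thesis using \<open>f \<in> X\<close> by blast
  qed
qed

lemma wedge_map_open_preimage:
  assumes U: "openin (wedge_of_spheres N d) U"
  shows "openin (top_of_set X) {f \<in> X. wedge_map f \<in> U}"
proof -
  have i: "openin (top_of_set X) {f \<in> X. winj i (theta i f) \<in> U}" if "i < N" for i
  proof -
    have "openin (nsphere d) {x \<in> sphere_set d. winj i x \<in> U}"
      using U that by (simp add: openin_wedge_of_spheres)
    then have "openin (top_of_set X) {f \<in> topspace (top_of_set X). theta i f \<in> {x \<in> sphere_set d. winj i x \<in> U}}"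
      by (rule openin_continuous_map_preimage[OF continuous_map_theta[OF that]])
    moreover have "{f \<in> topspace (top_of_set X). theta i f \<in> {x \<in> sphere_set d. winj i x \<in> U}}
        = {f \<in> X. winj i (theta i f) \<in> U}"
      using theta_in_sphere that by auto
    ultimately show ?thesis by simp
  qed
  show ?thesis
  proof (cases "None \<in> U")
    case True
    have "openin (top_of_set X) ((\<Inter>i\<in>{..<N}. {f \<in> X. winj i (theta i f) \<in> U}) \<inter> topspace (top_of_set X))"
      using i by (intro openin_INT) auto
    moreover have "(\<Inter>i\<in>{..<N}. {f \<in> X. winj i (theta i f) \<in> U}) \<inter> topspace (top_of_set X) = {f \<in> X. wedge_map f \<in> U}"
      using True by (auto simp: wedge_map_in_iff)
    ultimately show ?thesis by simp
  next
    case False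
    have "openin (top_of_set X) (\<Union>i\<in>{..<N}. {f \<in> X. winj i (theta i f) \<in> U})"
      using i by (intro openin_Union) auto
    moreover have "(\<Union>i\<in>{..<N}. {f \<in> X. winj i (theta i f) \<in> U}) = {f \<in> X. wedge_map f \<in> U}"
      using False by (auto simp: wedge_map_in_iff)
    ultimately show ?thesis by simp
  qed
qed

text \<open>Compactness of a closed facet gives the quotient topology: the points of the facet
  outside the preimage of \<open>U\<close> form a compact set, so their image on the sphere is
  closed, and up to \<open>corner\<close> this image is the complement of the trace of
  \<open>U\<close>.\<close>

lemma wedge_map_open:
  assumes U: "U \<subseteq> topspace (wedge_of_spheres N d)"
    and op: "openin (top_of_set X) {f \<in> X. wedge_map f \<in> U}"
  shows "openin (wedge_of_spheres N d) U"
  unfolding openin_wedge_of_spheres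
proof (intro conjI U allI impI)
  fix i assume i: "i < N"
  let ?\<sigma> = "e i"
  let ?T = "{f :: 'v \<Rightarrow> real. (\<forall>v. 0 \<le> f v) \<and> (\<forall>v. v \<notin> ?\<sigma> \<longrightarrow> f v = 0) \<and> sum f ?\<sigma> = 1}"
  let ?D = "?T - {f \<in> X. wedge_map f \<in> U}"
  have TX: "?T \<subseteq> X"
    using eF[OF i] FK by (auto intro: realization_setI[OF K, of ?\<sigma>])
  have T_wedge: "wedge_map f = winj i (theta i f)" if f: "f \<in> ?T" for f
  proof -
    have fX: "f \<in> X" using f TX by blast
    have "j = i" if "active f j" for j
    proof -
      have "e j \<subseteq> ?\<sigma>" "j < N" using that f active_iff[OF fX] by auto
      then have "e i = e j" using maximal[OF eF[of j], of ?\<sigma>] eF[OF i] FK by blast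
      then show ?thesis using e i \<open>j < N\<close> by (auto simp: bij_betw_def inj_on_def)
    qed
    then show ?thesis
      using winj_theta[OF fX i] wedge_map_active[OF fX] wedge_map_inactive[of f] by metis
  qed
  have "openin (top_of_set ?T) (?T \<inter> {f \<in> X. wedge_map f \<in> U})"
    using op TX by (metis (no_types, lifting) inf.absorb_iff2 inf_commute openin_subtopology_Int2 subtopology_subtopology)
  from closedin_diff[OF closedin_topspace this]
  have "closedin (top_of_set ?T) (?T - (?T \<inter> {f \<in> X. wedge_map f \<in> U}))"
    unfolding topspace_euclidean_subtopology .
  then have "closedin (top_of_set ?T) ?D" by (simp add: Diff_Int)
  moreover have "compact ?T" using facet(1)[OF eF[OF i]] by (rule compact_closed_simplex)
  ultimately have "compact ?D" by (rule closedin_compact[rotated])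
  moreover have "continuous_on ?D (theta i)"
    by (rule continuous_on_subset[OF continuous_on_theta[OF i]]) (use TX in blast)
  ultimately have "compact (theta i ` ?D)" by (rule compact_continuous_image[rotated])
  then have closed: "closed (theta i ` ?D)" by (rule compact_imp_closed)
  let ?V = "{x \<in> sphere_set d. winj i x \<in> U}"
  have sub1: "x \<in> theta i ` ?D" if x: "x \<in> sphere_set d" "x \<notin> ?V" "x \<noteq> corner" for x
  proof -
    obtain f where f: "f \<in> X" "\<And>v. v \<notin> ?\<sigma> \<Longrightarrow> f v = 0" "theta i f = x" "active f i"
      using theta_surj[OF i x(1,3)] by metis
    have "sum f ?\<sigma> = 1"
      using f(2) facet(1)[OF eF[OF i]] by (intro sum_realization_set[OF f(1)]) auto
    then have "f \<in> ?T" using f realization_setD(1)[OF f(1)] by blast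
    moreover have "wedge_map f \<notin> U" using T_wedge[OF \<open>f \<in> ?T\<close>] f(3) x by auto
    ultimately show ?thesis using f(3) by blast
  qed
  have sub2: "x \<in> sphere_set d \<and> x \<notin> ?V" if x: "x \<in> theta i ` ?D" for x
  proof -
    obtain f where f: "f \<in> ?T" "wedge_map f \<notin> U" "x = theta i f" using x TX by blast
    then have "f \<in> X" using TX by blast
    then show ?thesis using theta_in_sphere[of f i] i f T_wedge[OF f(1)] by auto
  qed
  have "closed (sphere_set d - ?V) \<or> closedin (top_of_set (sphere_set d)) (sphere_set d - ?V)"
  proof (cases "None \<in> U")
    case True
    then have "winj i corner \<in> U" by (simp add: wedge_inj_corner)
    then have "sphere_set d - ?V = theta i ` ?D" using sub1 sub2 corner_in_sphere by blast
    then show ?thesis using closed by simp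
  next
    case False
    then have "winj i corner \<notin> U" by (simp add: wedge_inj_corner)
    \<comment> \<open>The corner is added by hand because for \<open>d = 0\<close> the closed facet
      is one point and its image misses it.\<close>
    then have "sphere_set d - ?V = insert corner (theta i ` ?D)" using sub1 sub2 corner_in_sphere by blast
    then show ?thesis using closed by simp
  qed
  then have "closedin (top_of_set (sphere_set d)) (sphere_set d - ?V)"
    by (auto intro: closed_subset)
  from openin_diff[OF openin_topspace this]
  have "openin (top_of_set (sphere_set d)) (sphere_set d - (sphere_set d - ?V))"
    unfolding topspace_euclidean_subtopology .
  moreover have "sphere_set d - (sphere_set d - ?V) = ?V" by blast
  ultimately show "openin (nsphere d) ?V" unfolding nsphere_eq by simp
qed

lemma quotient_map_wedge_map: "quotient_map (top_of_set X) (wedge_of_spheres N d) wedge_map"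
  unfolding quotient_map_def
  using wedge_map_image wedge_map_open_preimage wedge_map_open by auto

lemma wedge_map_fibre:
  assumes ff: "f \<in> X" "f' \<in> X" "wedge_map f = wedge_map f'"
  shows "f = f' \<or> f \<in> A \<and> f' \<in> A"
proof (cases "\<exists>i. active f i")
  case True
  then obtain i where i: "active f i" by blast
  then have iN: "i < N" by (simp add: active_def)
  have "wedge_map f' = Some (i, theta i f)" using wedge_map_active[OF ff(1) i] ff(3) by simp
  then have i': "active f' i" "theta i f' = theta i f"
    using wedge_map_active[OF ff(2)] wedge_map_inactive[of f'] by (metis option.distinct(1) option.inject prod.inject)+
  have "0 < low (e i) f" using i by (simp add: active_def)
  then have pos: "0 < scaled_min d (f \<circ> en (e i))" unfolding scaled_min_low[OF eF[OF iN]] by simp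
  have en_eq: "(f \<circ> en (e i)) j = (f' \<circ> en (e i)) j" if "j \<le> d" for j
    using i'(2) that pos unfolding theta_def
    by (intro to_sphere_inj[OF comp_in_sphere_dom comp_in_sphere_dom] ff eF iN) auto
  have "f v = f' v" for v
  proof (cases "v \<in> e i")
    case True
    then obtain j where "j \<le> d" "v = en (e i) j" using en[OF eF[OF iN]] unfolding bij_betw_def by auto
    then show ?thesis using en_eq[of j] by simp
  next
    case False
    have "{v. f v \<noteq> 0} = e i" "{v. f' v \<noteq> 0} = e i"
      using i i'(1) active_iff[OF ff(1)] active_iff[OF ff(2)] by simp_all
    then have "f v = 0" "f' v = 0" using False by blast+
    then show ?thesis by simp
  qed
  then show ?thesis by blast
next
  case False
  then have "wedge_map f' = None" using wedge_map_inactive[of f] ff(3) by simp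
  then have "\<not> active f' i" for i using wedge_map_active[OF ff(2)] by force
  moreover have "{v. g v \<noteq> 0} \<notin> F" if "\<And>i. \<not> active g i" "g \<in> X" for g
  proof
    assume "{v. g v \<noteq> 0} \<in> F"
    then obtain i where "i < N" "{v. g v \<noteq> 0} = e i" using e unfolding bij_betw_def by auto
    then show False using that active_iff by blast
  qed
  ultimately show ?thesis using False ff in_A_iff by blast
qed

lemma wedge_map_A: "f \<in> A \<Longrightarrow> wedge_map f = None"
  using low_A[OF _ eF] by (intro wedge_map_inactive) (auto simp: active_def)

lemma homotopy_equivalent_wedge:
  "top_of_set X homotopy_equivalent_space wedge_of_spheres N d"
proof (rule ex_homotopy)
  fix h a assume h: "continuous_on ({0..1::real} \<times> X) h" "h \<in> {0..1} \<times> X \<rightarrow> X" "\<And>f. f \<in> X \<Longrightarrow> h (0, f) = f"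
    "\<And>t f. \<lbrakk>t \<in> {0..1}; f \<in> A\<rbrakk> \<Longrightarrow> h (t, f) \<in> A" "\<And>f. f \<in> A \<Longrightarrow> h (1, f) = a"
  show ?thesis
  proof (rule homotopy_equivalent_space_quotient[OF quotient_map_wedge_map])
    show "continuous_map (prod_topology (top_of_set {0..1}) (top_of_set X)) (top_of_set X) h"
      using h(1,2) by simp
    show "f = f' \<or> f \<in> A \<and> f' \<in> A"
      if "f \<in> topspace (top_of_set X)" "f' \<in> topspace (top_of_set X)" "wedge_map f = wedge_map f'" for f f'
      using wedge_map_fibre that by simp
    show "h (1, f) = a" if "f \<in> A" for f using h(5) that .
  qed (use h(3,4) wedge_map_A in simp_all)
qed

end

lemma homotopy_equivalent_wedge_of_spheres:
  "top_of_set X homotopy_equivalent_space wedge_of_spheres (card F) d"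
proof -
  obtain e where e: "bij_betw e {..<card F} F"
    using ex_bij_betw_nat_finite[OF finF] by (auto simp: atLeast0LessThan)
  have "\<exists>g. bij_betw g {..d} \<sigma>" if "\<sigma> \<in> F" for \<sigma>
    using ex_bij_betw_nat_finite[OF facet(1)[OF that]] card_facet[OF that]
    by (simp add: atLeast0LessThan lessThan_Suc_atMost)
  then obtain en where "\<And>\<sigma>. \<sigma> \<in> F \<Longrightarrow> bij_betw (en \<sigma>) {..d} \<sigma>" by metis
  from homotopy_equivalent_wedge[OF e this] show ?thesis .
qed

end

theorem geometric_realization_homotopy_equivalent:
  assumes "finite_complex K" "K \<noteq> {}" "decomposable K (Suc d) N"
  shows "geometric_realization K homotopy_equivalent_space wedge_of_spheres N d"
proof -
  obtain F where F: "removable_facets K (Suc d) F" "card F = N"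
    using assms(3) by (auto simp: decomposable_def)
  interpret facet_complex K F d
    by unfold_locales (use assms F in \<open>auto simp: removable_facets_def\<close>)
  show ?thesis
    using homotopy_equivalent_wedge_of_spheres F(2) by (simp add: geometric_realization_eq)
qed

section \<open>The number of spheres is a homotopy invariant\<close>

definition cap :: "nat \<Rightarrow> (nat \<Rightarrow> real) set" where
  "cap d = {x \<in> sphere_set d. 1/2 < x 0}"

definition damping :: "real \<Rightarrow> real \<Rightarrow> real" where
  "damping t a = (1 - t) + t * max 0 (1/2 - a)"

text \<open>At time \<open>1\<close> this collapses the cap to its centre, since the damping factor vanishes there.\<close>

definition push :: "real \<Rightarrow> (nat \<Rightarrow> real) \<Rightarrow> nat \<Rightarrow> real" where
  "push t x j = (if j = 0 then x 0 else damping t (x 0) * x j) /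
     sqrt ((x 0)\<^sup>2 + (damping t (x 0))\<^sup>2 * (1 - (x 0)\<^sup>2))"

lemma sphere_setD:
  assumes "x \<in> sphere_set d"
  shows "(x 0)\<^sup>2 + (\<Sum>j=1..d. (x j)\<^sup>2) = 1" "(x 0)\<^sup>2 \<le> 1" "\<And>j. j > d \<Longrightarrow> x j = 0"
proof -
  show *: "(x 0)\<^sup>2 + (\<Sum>j=1..d. (x j)\<^sup>2) = 1"
    using assms by (simp add: sphere_set_def atMost_eq_insert_0)
  have "0 \<le> (\<Sum>j=1..d. (x j)\<^sup>2)" by (simp add: sum_nonneg)
  then show "(x 0)\<^sup>2 \<le> 1" using * by linarith
  show "\<And>j. j > d \<Longrightarrow> x j = 0" using assms by (simp add: sphere_set_def)
qed

text \<open>Only \<open>x 0 = 0\<close> could be dangerous, and there the damping factor is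
  \<open>1 - t / 2\<close>, which is positive. The factor reaches 0 only at time 1 and for first
  coordinates of at least 1/2.\<close>

lemma push_denominator:
  assumes "x \<in> sphere_set d" "0 \<le> t" "t \<le> 1"
  shows "0 < (x 0)\<^sup>2 + (damping t (x 0))\<^sup>2 * (1 - (x 0)\<^sup>2)"
proof (cases "x 0 = 0")
  case True
  have "damping t (x 0) = 1 - t / 2" using True by (simp add: damping_def)
  then show ?thesis using True assms by simp
next
  case False
  have "0 \<le> (damping t (x 0))\<^sup>2 * (1 - (x 0)\<^sup>2)" using sphere_setD(2)[OF assms(1)] by simp
  moreover have "0 < (x 0)\<^sup>2" using False by simp
  ultimately show ?thesis by linarith
qed

lemma push_in_sphere:
  assumes "x \<in> sphere_set d" "0 \<le> t" "t \<le> 1"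
  shows "push t x \<in> sphere_set d"
proof -
  let ?g = "damping t (x 0)"
  let ?D = "(x 0)\<^sup>2 + ?g\<^sup>2 * (1 - (x 0)\<^sup>2)"
  have D: "0 < ?D" using push_denominator[OF assms] .
  have "(\<Sum>j\<le>d. (push t x j)\<^sup>2) = (\<Sum>j\<le>d. (if j = 0 then x 0 else ?g * x j)\<^sup>2 / ?D)"
    using D by (intro sum.cong) (auto simp: push_def power_divide)
  also have "\<dots> = ((x 0)\<^sup>2 + (\<Sum>j=1..d. ?g\<^sup>2 * (x j)\<^sup>2)) / ?D"
    by (simp add: atMost_eq_insert_0 power_mult_distrib add_divide_distrib flip: sum_divide_distrib)
  also have "(\<Sum>j=1..d. ?g\<^sup>2 * (x j)\<^sup>2) = ?g\<^sup>2 * (1 - (x 0)\<^sup>2)"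
    using sphere_setD(1)[OF assms(1)] by (simp flip: sum_distrib_left)
  finally have "(\<Sum>j\<le>d. (push t x j)\<^sup>2) = 1" using D by simp
  then show ?thesis using sphere_setD(3)[OF assms(1)] by (simp add: sphere_set_def push_def)
qed

lemma push_0: "x \<in> sphere_set d \<Longrightarrow> push 0 x = x"
  by (auto simp: push_def damping_def fun_eq_iff)

lemma push_corner: "push t corner = corner"
  by (auto simp: push_def corner_def fun_eq_iff)

lemma push_1_cap:
  assumes "x \<in> cap d"
  shows "push 1 x = corner"
proof -
  have "damping 1 (x 0) = 0" "0 < x 0" using assms by (auto simp: damping_def cap_def)
  then show ?thesis by (auto simp: push_def corner_def fun_eq_iff)
qed

text \<open>On the cap the damping factor is at most 1, so the normalising root is at most 1 and the
  positive first coordinate cannot decrease.\<close>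

lemma push_cap:
  assumes "x \<in> cap d" "0 \<le> t" "t \<le> 1"
  shows "push t x \<in> cap d"
proof -
  have x: "x \<in> sphere_set d" "1/2 < x 0" using assms by (auto simp: cap_def)
  let ?g = "damping t (x 0)"
  let ?D = "(x 0)\<^sup>2 + ?g\<^sup>2 * (1 - (x 0)\<^sup>2)"
  have D: "0 < ?D" using push_denominator[OF x(1) assms(2,3)] .
  have "?g = 1 - t" using x by (simp add: damping_def)
  then have "?g\<^sup>2 \<le> 1" using assms by (simp add: power_le_one)
  then have "?g\<^sup>2 * (1 - (x 0)\<^sup>2) \<le> 1 * (1 - (x 0)\<^sup>2)"
    using sphere_setD(2)[OF x(1)] by (intro mult_right_mono) auto
  then have "?D \<le> 1" by simp
  then have "sqrt ?D \<le> 1" by simp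
  moreover have "0 < sqrt ?D" using D by simp
  ultimately have "x 0 \<le> x 0 / sqrt ?D" using x(2) by (simp add: le_divide_eq mult_left_le)
  with x(2) have "1/2 < x 0 / sqrt ?D" by linarith
  then have "1/2 < push t x 0" unfolding push_def by (simp only: simp_thms if_True)
  then show ?thesis using push_in_sphere[OF x(1) assms(2,3)] by (simp add: cap_def)
qed

lemma continuous_on_push: "continuous_on ({0..1} \<times> sphere_set d) (\<lambda>z. push (fst z) (snd z))"
proof (rule continuous_on_coordinatewise_then_product)
  fix j
  have c: "continuous_on S (\<lambda>z::real \<times> (nat \<Rightarrow> real). snd z i)" for S i
    by (rule continuous_on_coordinate[OF continuous_on_snd[OF continuous_on_id]])
  have g: "continuous_on S (\<lambda>z::real \<times> (nat \<Rightarrow> real). damping (fst z) (snd z 0))" for S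
    unfolding damping_def
    by (intro continuous_on_add continuous_on_diff continuous_on_mult continuous_on_max
        continuous_on_const continuous_on_fst continuous_on_id c)
  have n: "continuous_on S (\<lambda>z::real \<times> (nat \<Rightarrow> real). if j = 0 then snd z 0 else damping (fst z) (snd z 0) * snd z j)" for S
    by (cases "j = 0") (simp_all add: c g continuous_on_mult)
  show "continuous_on ({0..1} \<times> sphere_set d) (\<lambda>z. push (fst z) (snd z) j)"
    unfolding push_def
  proof (intro continuous_on_divide n ballI)
    show "sqrt ((snd z 0)\<^sup>2 + (damping (fst z) (snd z 0))\<^sup>2 * (1 - (snd z 0)\<^sup>2)) \<noteq> 0"
      if "z \<in> {0..1} \<times> sphere_set d" for z
      using push_denominator[of "snd z" d "fst z"] that by auto
    show "continuous_on ({0..1} \<times> sphere_set d)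
      (\<lambda>z. sqrt ((snd z 0)\<^sup>2 + (damping (fst z) (snd z 0))\<^sup>2 * (1 - (snd z 0)\<^sup>2)))"
      by (intro continuous_on_real_sqrt continuous_on_add continuous_on_mult continuous_on_power
          continuous_on_diff continuous_on_const c g)
  qed
qed

lemma continuous_map_push:
  "continuous_map (prod_topology (top_of_set {0..1}) (nsphere d)) (nsphere d) (\<lambda>z. push (fst z) (snd z))"
  using continuous_on_push push_in_sphere by (auto simp: nsphere_eq)

lemma t1_space_nsphere: "t1_space (nsphere d)"
proof -
  have "Hausdorff_space (powertop_real (UNIV :: nat set))"
    by (simp add: Hausdorff_space_product_topology)
  then show ?thesis
    unfolding nsphere by (intro Hausdorff_imp_t1_space Hausdorff_space_subtopology)
qed

lemma closedin_corner: "closedin (nsphere d) {corner}"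
  using t1_space_nsphere[of d] corner_in_sphere[of d]
  by (simp add: t1_space_closedin_singleton nsphere_eq)

lemma openin_cap: "openin (nsphere d) (cap d)"
proof -
  have "continuous_map (nsphere d) euclideanreal (\<lambda>x. x 0)"
    by (simp add: nsphere_eq continuous_on_coordinate[OF continuous_on_id])
  then have "openin (nsphere d) {x \<in> topspace (nsphere d). x 0 \<in> {1/2<..}}"
    by (rule openin_continuous_map_preimage) auto
  moreover have "{x \<in> topspace (nsphere d). x 0 \<in> {1/2<..}} = cap d"
    by (auto simp: cap_def nsphere_eq)
  ultimately show ?thesis by simp
qed

text \<open>The image of \<open>j\<close> is a sphere attached to the rest of \<open>X\<close> at the single point \<open>j corner\<close>, and \<open>c\<close>
  collapses that rest. Excision compares \<open>X\<close> modulo the rest with the sphere modulo its base point.\<close>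

locale petal =
  fixes X :: "'x topology" and d :: nat and c :: "'x \<Rightarrow> nat \<Rightarrow> real" and j :: "(nat \<Rightarrow> real) \<Rightarrow> 'x"
  assumes c: "continuous_map X (nsphere d) c" and j: "continuous_map (nsphere d) X j"
    and cj: "\<And>x. x \<in> sphere_set d \<Longrightarrow> c (j x) = x"
    and jc: "\<And>w. \<lbrakk>w \<in> topspace X; c w \<noteq> corner\<rbrakk> \<Longrightarrow> j (c w) = w"
    and petal_closed: "closedin X (j ` sphere_set d)"
begin

definition rest :: "'x set" where
  "rest = {w \<in> topspace X. c w = corner}"

definition collar :: "'x set" where
  "collar = {w \<in> topspace X. c w \<in> cap d}"

definition squeeze :: "real \<times> 'x \<Rightarrow> 'x" where
  "squeeze z = (if snd z \<in> rest then snd z else j (push (fst z) (c (snd z))))"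

lemma c_in: "w \<in> topspace X \<Longrightarrow> c w \<in> sphere_set d"
  using continuous_map_funspace[OF c] by (auto simp: nsphere_eq)

lemma j_in: "x \<in> sphere_set d \<Longrightarrow> j x \<in> topspace X"
  using continuous_map_funspace[OF j] by (auto simp: nsphere_eq)

lemma closed_rest: "closedin X rest"
proof -
  have "closedin X {w \<in> topspace X. c w \<in> {corner}}"
    by (rule closedin_continuous_map_preimage[OF c closedin_corner])
  then show ?thesis by (simp add: rest_def)
qed

lemma open_collar: "openin X collar"
  unfolding collar_def by (rule openin_continuous_map_preimage[OF c openin_cap])

lemma rest_collar: "rest \<subseteq> collar"
  using corner_in_sphere by (auto simp: rest_def collar_def cap_def corner_def)

text \<open>The rest and the petal are closed and meet only in \<open>j corner\<close>, which
  \<open>push\<close> leaves fixed; the two formulas agree there.\<close>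

lemma continuous_squeeze: "continuous_map (prod_topology (top_of_set {0..1}) X) X squeeze"
  unfolding squeeze_def
proof (rule continuous_map_cases_alt)
  let ?Z = "prod_topology (top_of_set {0..1::real}) X"
  have "continuous_map ?Z (prod_topology (top_of_set {0..1}) (nsphere d)) (\<lambda>z. (fst z, c (snd z)))"
    using continuous_map_compose[OF continuous_map_snd c]
    by (intro continuous_map_pairedI continuous_map_fst) (simp add: o_def)
  from continuous_map_compose[OF this continuous_map_compose[OF continuous_map_push j]]
  have "continuous_map ?Z X (\<lambda>z. j (push (fst z) (c (snd z))))" by (simp add: o_def)
  then show "continuous_map (subtopology ?Z (?Z closure_of {z \<in> topspace ?Z. snd z \<notin> rest})) X
      (\<lambda>z. j (push (fst z) (c (snd z))))"
    by (rule continuous_map_from_subtopology)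
  show "continuous_map (subtopology ?Z (?Z closure_of {z \<in> topspace ?Z. snd z \<in> rest})) X snd"
    by (rule continuous_map_from_subtopology) (rule continuous_map_snd)
  fix z assume z: "z \<in> ?Z frontier_of {z \<in> topspace ?Z. snd z \<in> rest}"
  have "{z \<in> topspace ?Z. snd z \<in> rest} = {0..1} \<times> rest"
    using closedin_subset[OF closed_rest] by auto
  then have "closedin ?Z {z \<in> topspace ?Z. snd z \<in> rest}"
    using closed_rest by (simp add: closedin_prod_Times_iff)
  then have r: "z \<in> topspace ?Z" "snd z \<in> rest"
    using z closure_of_closedin unfolding frontier_of_def by fastforce+
  have "closedin ?Z ({0..1} \<times> j ` sphere_set d)"
    using petal_closed by (simp add: closedin_prod_Times_iff)
  moreover have "topspace ?Z - {z \<in> topspace ?Z. snd z \<in> rest} \<subseteq> {0..1} \<times> j ` sphere_set d"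
  proof
    fix z assume "z \<in> topspace ?Z - {z \<in> topspace ?Z. snd z \<in> rest}"
    then have *: "fst z \<in> {0..1}" "snd z \<in> topspace X" "c (snd z) \<noteq> corner" by (auto simp: rest_def)
    then have "snd z \<in> j ` sphere_set d" using jc c_in by (metis imageI)
    then show "z \<in> {0..1} \<times> j ` sphere_set d" using *(1) by (metis SigmaI prod.collapse)
  qed
  ultimately have "?Z closure_of (topspace ?Z - {z \<in> topspace ?Z. snd z \<in> rest}) \<subseteq> {0..1} \<times> j ` sphere_set d"
    by (rule closure_of_minimal[rotated])
  then have "z \<in> {0..1} \<times> j ` sphere_set d" using z unfolding frontier_of_closures by blast
  then obtain x where x: "x \<in> sphere_set d" "snd z = j x" by auto
  then have "x = corner" using r(2) cj by (auto simp: rest_def)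
  then show "snd z = j (push (fst z) (c (snd z)))" using x cj push_corner by simp
qed

text \<open>At time 1 \<open>squeeze\<close> maps the collar into the rest, and at all times it
  preserves both subspaces. It is therefore a homotopy equivalence of pairs, inverse to the identity
  map.\<close>

lemma rest_homology: "relative_homology_group p X rest \<cong> relative_homology_group p X collar"
proof -
  have 0: "squeeze (0, w) = w" if "w \<in> topspace X" for w
    using that jc push_0[OF c_in] by (auto simp: squeeze_def rest_def)
  have rest_st: "squeeze (t, w) = w" if "w \<in> rest" for t w
    using that by (simp add: squeeze_def)
  have collar_st: "squeeze (t, w) \<in> collar" if "w \<in> collar" "t \<in> {0..1}" for t w
  proof (cases "w \<in> rest")
    case True
    then show ?thesis using that by (simp add: squeeze_def)
  next
    case False
    then have "push t (c w) \<in> cap d" using push_cap that by (simp add: collar_def)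
    then show ?thesis using False cj j_in by (auto simp: squeeze_def collar_def cap_def)
  qed
  have 1: "squeeze (1, w) \<in> rest" if "w \<in> collar" for w
  proof (cases "w \<in> rest")
    case False
    then have "squeeze (1, w) = j corner"
      using that push_1_cap[of "c w" d] by (simp add: squeeze_def collar_def)
    then show ?thesis using cj j_in corner_in_sphere by (simp add: rest_def)
  qed (simp add: squeeze_def)
  let ?g = "\<lambda>w. squeeze (1, w)"
  have "continuous_map X X (squeeze \<circ> (\<lambda>w. (1, w)))"
    by (rule continuous_map_compose[OF _ continuous_squeeze]) (auto intro!: continuous_map_pairedI)
  then have g: "continuous_map X X ?g" by (simp add: o_def)
  have hom: "homotopic_with Q X X id ?g"
    if Q: "\<And>h k. (\<And>w. w \<in> topspace X \<Longrightarrow> h w = k w) \<Longrightarrow> Q h = Q k" "\<And>t. t \<in> {0..1} \<Longrightarrow> Q (\<lambda>w. squeeze (t, w))" for Q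
    by (subst homotopic_with, erule Q(1), intro exI[of _ squeeze]) (use continuous_squeeze 0 Q(2) in auto)
  have subs: "rest \<subseteq> topspace X" "collar \<subseteq> topspace X" by (auto simp: rest_def collar_def)
  show ?thesis
  proof (rule homotopy_equivalent_space_imp_isomorphic_relative_homology_groups[OF continuous_map_id _ g])
    show "homotopic_with (\<lambda>h. h \<in> rest \<rightarrow> rest) X X (?g \<circ> id) id"
      unfolding o_id
    proof (rule homotopic_with_symD, rule hom)
      show "(h \<in> rest \<rightarrow> rest) = (k \<in> rest \<rightarrow> rest)" if "\<And>w. w \<in> topspace X \<Longrightarrow> h w = k w" for h k :: "'x \<Rightarrow> 'x"
        using that subs(1) by (metis (no_types, lifting) Pi_cong in_mono)
    qed (use rest_st in auto)
    show "homotopic_with (\<lambda>h. h \<in> collar \<rightarrow> collar) X X (id \<circ> ?g) id"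
      unfolding id_o
    proof (rule homotopic_with_symD, rule hom)
      show "(h \<in> collar \<rightarrow> collar) = (k \<in> collar \<rightarrow> collar)" if "\<And>w. w \<in> topspace X \<Longrightarrow> h w = k w" for h k :: "'x \<Rightarrow> 'x"
        using that subs(2) by (metis (no_types, lifting) Pi_cong in_mono)
    qed (use collar_st in auto)
  qed (use 1 rest_collar in auto)
qed

text \<open>Excision applies because the rest is closed and the collar is an open set around
  it.\<close>

lemma excision_rest:
  "relative_homology_group p (subtopology X (topspace X - rest)) (collar - rest) \<cong> relative_homology_group p X collar"
proof -
  have "X closure_of rest \<subseteq> X interior_of collar"
    using closed_rest open_collar rest_collar by (simp add: closure_of_closedin interior_of_openin)
  from homology_excision_axiom[OF this, of "topspace X" p]
  show ?thesis unfolding is_iso_def by (auto simp: collar_def)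
qed

lemma petal_homology:
  "relative_homology_group p (subtopology X (topspace X - rest)) (collar - rest) \<cong>
   relative_homology_group p (subtopology (nsphere d) (sphere_set d - {corner})) (cap d - {corner})"
proof -
  let ?Y = "subtopology X (topspace X - rest)" and ?S = "subtopology (nsphere d) (sphere_set d - {corner})"
  have "homeomorphic_maps ?Y ?S c j"
    unfolding homeomorphic_maps_def
  proof (intro conjI ballI)
    show "continuous_map ?Y ?S c"
      using c c_in by (auto simp: continuous_map_in_subtopology rest_def intro: continuous_map_from_subtopology)
    show "continuous_map ?S ?Y j"
      using j j_in cj by (auto simp: continuous_map_in_subtopology rest_def nsphere_eq intro: continuous_map_from_subtopology)
  qed (use jc cj in \<open>auto simp: rest_def nsphere_eq\<close>)
  moreover have "c \<in> (collar - rest) \<rightarrow> (cap d - {corner})"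
    by (auto simp: collar_def rest_def)
  moreover have "j \<in> (cap d - {corner}) \<rightarrow> (collar - rest)"
    using cj j_in by (auto simp: collar_def rest_def cap_def)
  ultimately show ?thesis
    using homeomorphic_maps_relative_homology_group_isomorphisms group_isomorphisms_imp_iso is_isoI by metis
qed

lemma relative_homology_rest:
  "relative_homology_group p X rest \<cong>
   relative_homology_group p (subtopology (nsphere d) (sphere_set d - {corner})) (cap d - {corner})"
proof -
  have "relative_homology_group p X rest \<cong> relative_homology_group p X collar" by (rule rest_homology)
  also have "\<dots> \<cong> relative_homology_group p (subtopology X (topspace X - rest)) (collar - rest)"
    by (rule group.iso_sym[OF _ excision_rest]) simp
  also note petal_homology
  finally show ?thesis .
qed

text \<open>The sphere is a petal of itself, with the single point \<open>corner\<close> as its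
  rest. The comparison is used once for \<open>X\<close> and once backwards for the sphere, so only
  the known homology of the sphere enters.\<close>

lemma relative_homology_rest_integer: "relative_homology_group (int d) X rest \<cong> integer_group"
proof -
  interpret S: petal "nsphere d" d id id
    by unfold_locales (auto simp: nsphere_eq closed_subset closedin_topspace[of "top_of_set (sphere_set d)", simplified])
  have r: "S.rest = {corner}" using corner_in_sphere unfolding S.rest_def by (auto simp: nsphere_eq)
  have "relative_homology_group (int d) X rest \<cong>
    relative_homology_group (int d) (subtopology (nsphere d) (sphere_set d - {corner})) (cap d - {corner})"
    by (rule relative_homology_rest)
  also have "\<dots> \<cong> relative_homology_group (int d) (nsphere d) {corner}"
    by (rule group.iso_sym[OF _ S.relative_homology_rest[unfolded r]]) simp
  also have "\<dots> \<cong> reduced_homology_group (int d) (nsphere d)"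
    using corner_in_sphere by (intro isomorphic_relative_homology_by_singleton) (simp add: nsphere_eq)
  also have "\<dots> \<cong> integer_group" by (rule reduced_homology_group_nsphere)
  finally show ?thesis .
qed

end

section \<open>Splitting off the last sphere of a wedge\<close>

lemma continuous_map_from_wedge:
  assumes "f None \<in> topspace Z" "\<And>i. i < N \<Longrightarrow> continuous_map (nsphere d) Z (\<lambda>x. f (winj i x))"
  shows "continuous_map (wedge_of_spheres N d) Z f"
  unfolding continuous_map_def
proof (intro conjI allI impI funcsetI)
  fix w assume "w \<in> topspace (wedge_of_spheres N d)"
  then consider "w = None" | i x where "i < N" "x \<in> sphere_set d" "w = winj i x"
    unfolding topspace_wedge_of_spheres by blast
  then show "f w \<in> topspace Z"
  proof cases
    case 2
    then show ?thesis using continuous_map_funspace[OF assms(2)] by (auto simp: nsphere_eq)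
  qed (use assms(1) in simp)
next
  fix U assume U: "openin Z U"
  show "openin (wedge_of_spheres N d) {w \<in> topspace (wedge_of_spheres N d). f w \<in> U}"
    unfolding openin_wedge_of_spheres
  proof (intro conjI allI impI)
    fix i assume i: "i < N"
    have "openin (nsphere d) {x \<in> topspace (nsphere d). f (winj i x) \<in> U}"
      by (rule openin_continuous_map_preimage[OF assms(2)[OF i] U])
    moreover have "{x \<in> topspace (nsphere d). f (winj i x) \<in> U} =
        {x \<in> sphere_set d. winj i x \<in> {w \<in> topspace (wedge_of_spheres N d). f w \<in> U}}"
      using i by (auto simp: nsphere_eq topspace_wedge_of_spheres)
    ultimately show "openin (nsphere d) {x \<in> sphere_set d. winj i x \<in> {w \<in> topspace (wedge_of_spheres N d). f w \<in> U}}"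
      by simp
  qed auto
qed

lemma continuous_map_winj:
  assumes "i < N"
  shows "continuous_map (nsphere d) (wedge_of_spheres N d) (winj i)"
  unfolding continuous_map_def
proof (intro conjI allI impI funcsetI)
  show "winj i x \<in> topspace (wedge_of_spheres N d)" if "x \<in> topspace (nsphere d)" for x
    using that assms by (auto simp: topspace_wedge_of_spheres nsphere_eq)
  show "openin (nsphere d) {x \<in> topspace (nsphere d). winj i x \<in> U}" if "openin (wedge_of_spheres N d) U" for U
    using that assms by (simp add: openin_wedge_of_spheres nsphere_eq)
qed

lemma None_in_wedge: "None \<in> topspace (wedge_of_spheres N d)"
  by (simp add: topspace_wedge_of_spheres)

definition last_petal :: "nat \<Rightarrow> (nat \<times> (nat \<Rightarrow> real)) option \<Rightarrow> nat \<Rightarrow> real" where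
  "last_petal N w = (case w of None \<Rightarrow> corner | Some (i, x) \<Rightarrow> if i = N then x else corner)"

lemma last_petal_winj: "last_petal N (winj i x) = (if i = N then x else corner)"
  by (simp add: last_petal_def wedge_inj_corner)

lemma openin_nsphere_minus_corner: "openin (nsphere d) (sphere_set d - {corner})"
  using openin_diff[OF openin_topspace closedin_corner[of d]] by (simp add: nsphere_eq)

interpretation wedge_petal: petal "wedge_of_spheres (Suc N) d" d "last_petal N" "winj N" for N d
proof
  let ?W = "wedge_of_spheres (Suc N) d"
  show "continuous_map ?W (nsphere d) (last_petal N)"
  proof (rule continuous_map_from_wedge)
    show "last_petal N None \<in> topspace (nsphere d)"
      using corner_in_sphere by (simp add: last_petal_def nsphere_eq)
    show "continuous_map (nsphere d) (nsphere d) (\<lambda>x. last_petal N (winj i x))" for i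
      using corner_in_sphere by (cases "i = N") (simp_all add: last_petal_winj nsphere_eq)
  qed
  show "continuous_map (nsphere d) ?W (winj N)" by (rule continuous_map_winj) simp
  show "last_petal N (winj N x) = x" if "x \<in> sphere_set d" for x by (simp add: last_petal_winj)
  show "winj N (last_petal N w) = w" if "w \<in> topspace ?W" "last_petal N w \<noteq> corner" for w
    using that by (auto simp: last_petal_def wedge_inj_corner split: option.splits if_splits)
  have "openin ?W (topspace ?W - winj N ` sphere_set d)"
    unfolding openin_wedge_of_spheres
  proof (intro conjI allI impI)
    fix i assume i: "i < Suc N"
    have "{x \<in> sphere_set d. winj i x \<in> topspace ?W - winj N ` sphere_set d} =
        (if i = N then {} else sphere_set d - {corner})"
      using i corner_in_sphere by (auto simp: topspace_wedge_of_spheres wedge_inj_corner image_iff split: if_splits)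
    then show "openin (nsphere d) {x \<in> sphere_set d. winj i x \<in> topspace ?W - winj N ` sphere_set d}"
      by (simp add: openin_nsphere_minus_corner)
  qed auto
  moreover have "winj N ` sphere_set d \<subseteq> topspace ?W"
    unfolding topspace_wedge_of_spheres by blast
  ultimately show "closedin ?W (winj N ` sphere_set d)" by (simp add: closedin_def)
qed

text \<open>Points keep their labels when a sphere is added, so the smaller wedge is literally a
  subset of the larger one; that the topologies agree is the content of
  \<open>wedge_subspace\<close>.\<close>

lemma wedge_petal_rest: "wedge_petal.rest N d = topspace (wedge_of_spheres N d)"
proof (intro equalityI subsetI)
  fix w assume "w \<in> wedge_petal.rest N d"
  then have w: "w \<in> topspace (wedge_of_spheres (Suc N) d)" "last_petal N w = corner"
    by (simp_all add: wedge_petal.rest_def)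
  then consider "w = None" | i x where "i < Suc N" "x \<in> sphere_set d" "w = winj i x"
    unfolding topspace_wedge_of_spheres by blast
  then show "w \<in> topspace (wedge_of_spheres N d)"
  proof cases
    case 2
    then have "i = N \<Longrightarrow> x = corner" using w(2) by (simp add: last_petal_winj)
    then have "w = None \<or> i < N" using 2 by (cases "i = N") (simp_all add: wedge_inj_corner)
    then show ?thesis using 2(2,3) unfolding topspace_wedge_of_spheres by blast
  qed (simp add: None_in_wedge)
next
  fix w assume "w \<in> topspace (wedge_of_spheres N d)"
  then show "w \<in> wedge_petal.rest N d"
    unfolding wedge_petal.rest_def
    by (auto simp: topspace_wedge_of_spheres last_petal_winj) (auto simp: last_petal_def)
qed

definition drop_last :: "nat \<Rightarrow> (nat \<times> (nat \<Rightarrow> real)) option \<Rightarrow> (nat \<times> (nat \<Rightarrow> real)) option" where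
  "drop_last N w = (case w of None \<Rightarrow> None | Some (i, x) \<Rightarrow> if i = N then None else w)"

lemma drop_last_winj: "drop_last N (winj i x) = (if i = N then None else winj i x)"
  by (simp add: drop_last_def wedge_inj_corner)

lemma drop_last_id:
  assumes "w \<in> topspace (wedge_of_spheres N d)"
  shows "drop_last N w = w"
  using assms by (auto simp: topspace_wedge_of_spheres drop_last_winj) (simp add: drop_last_def)

lemma continuous_map_drop_last:
  "continuous_map (wedge_of_spheres (Suc N) d) (wedge_of_spheres N d) (drop_last N)"
proof (rule continuous_map_from_wedge)
  show "drop_last N None \<in> topspace (wedge_of_spheres N d)"
    by (simp add: drop_last_def None_in_wedge)
  show "continuous_map (nsphere d) (wedge_of_spheres N d) (\<lambda>x. drop_last N (winj i x))" if "i < Suc N" for i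
    using that continuous_map_winj[of i N d] None_in_wedge by (cases "i = N") (simp_all add: drop_last_winj)
qed

lemma continuous_map_wedge_inclusion:
  "continuous_map (wedge_of_spheres N d) (wedge_of_spheres (Suc N) d) id"
  by (rule continuous_map_from_wedge) (simp_all add: None_in_wedge continuous_map_winj)

lemma wedge_subspace:
  "subtopology (wedge_of_spheres (Suc N) d) (topspace (wedge_of_spheres N d)) homeomorphic_space wedge_of_spheres N d"
proof -
  let ?A = "topspace (wedge_of_spheres N d)"
  have "homeomorphic_maps (subtopology (wedge_of_spheres (Suc N) d) ?A) (wedge_of_spheres N d) (drop_last N) id"
    unfolding homeomorphic_maps_def
  proof (intro conjI ballI)
    show "continuous_map (subtopology (wedge_of_spheres (Suc N) d) ?A) (wedge_of_spheres N d) (drop_last N)"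
      by (rule continuous_map_from_subtopology[OF continuous_map_drop_last])
    show "continuous_map (wedge_of_spheres N d) (subtopology (wedge_of_spheres (Suc N) d) ?A) id"
      using continuous_map_wedge_inclusion by (simp add: continuous_map_in_subtopology)
  qed (use drop_last_id in auto)
  then show ?thesis unfolding homeomorphic_space_def by blast
qed

lemma wedge_retract:
  "topspace (wedge_of_spheres N d) retract_of_space wedge_of_spheres (Suc N) d"
  unfolding retract_of_space_def
proof (intro conjI exI[of _ "drop_last N"] ballI)
  have "continuous_map (wedge_of_spheres (Suc N) d) (wedge_of_spheres (Suc N) d) (id \<circ> drop_last N)"
    by (rule continuous_map_compose[OF continuous_map_drop_last continuous_map_wedge_inclusion])
  then show "continuous_map (wedge_of_spheres (Suc N) d)
      (subtopology (wedge_of_spheres (Suc N) d) (topspace (wedge_of_spheres N d))) (drop_last N)"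
    using continuous_map_funspace[OF continuous_map_drop_last, of N d] by (auto simp: continuous_map_in_subtopology)
  show "topspace (wedge_of_spheres N d) \<subseteq> topspace (wedge_of_spheres (Suc N) d)"
    using continuous_map_funspace[OF continuous_map_wedge_inclusion, of N d] by auto
qed (rule drop_last_id)

text \<open>The retraction that crushes the last sphere splits the homology into that of the smaller
  wedge and the relative part, which is infinite cyclic.\<close>

lemma homology_wedge_Suc:
  "homology_group (int d) (wedge_of_spheres (Suc N) d) \<cong> homology_group (int d) (wedge_of_spheres N d) \<times>\<times> integer_group"
proof -
  let ?W = "wedge_of_spheres (Suc N) d" and ?A = "topspace (wedge_of_spheres N d)"
  have "homology_group (int d) ?W \<cong> homology_group (int d) (subtopology ?W ?A) \<times>\<times> relative_homology_group (int d) ?W ?A"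
    using wedge_retract by (intro isomorphic_group_homology_group_prod_retract disjI2)
  also have "\<dots> \<cong> homology_group (int d) (wedge_of_spheres N d) \<times>\<times> integer_group"
  proof (rule group.DirProd_iso_trans)
    show "homology_group (int d) (subtopology ?W ?A) \<cong> homology_group (int d) (wedge_of_spheres N d)"
      by (rule homeomorphic_space_imp_isomorphic_homology_groups[OF wedge_subspace])
    show "relative_homology_group (int d) ?W ?A \<cong> integer_group"
      using wedge_petal.relative_homology_rest_integer[of d N] by (simp add: wedge_petal_rest)
  qed simp
  finally show ?thesis .
qed

text \<open>The integer factor becomes the coefficient of the new generator \<open>m\<close>, which
  does not occur in elements over \<open>T\<close>.\<close>

lemma free_Abelian_group_insert:
  assumes "m \<notin> T"
  shows "free_Abelian_group T \<times>\<times> integer_group \<cong> free_Abelian_group (insert m T)"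
proof -
  let ?f = "\<lambda>(x, n). x + frag_cmul n (frag_of m)"
  have lookup: "Poly_Mapping.lookup (x + frag_cmul n (frag_of m)) i = (if i = m then n else Poly_Mapping.lookup x i)"
    if "Poly_Mapping.keys x \<subseteq> T" for x n i
  proof -
    have "Poly_Mapping.lookup x m = 0" using that assms by (meson in_keys_iff subsetD)
    then show ?thesis by (auto simp: lookup_add)
  qed
  have "?f \<in> iso (free_Abelian_group T \<times>\<times> integer_group) (free_Abelian_group (insert m T))"
  proof (rule isoI[OF homI])
    show "?f z \<in> carrier (free_Abelian_group (insert m T))"
      if zc: "z \<in> carrier (free_Abelian_group T \<times>\<times> integer_group)" for z
    proof -
      obtain x n where z: "z = (x, n)" "Poly_Mapping.keys x \<subseteq> T" using zc by (auto simp: DirProd_def)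
      show ?thesis using lookup[OF z(2)] z by (auto simp: in_keys_iff split: if_splits)
    qed
    show "?f (z \<otimes>\<^bsub>free_Abelian_group T \<times>\<times> integer_group\<^esub> z') = ?f z \<otimes>\<^bsub>free_Abelian_group (insert m T)\<^esub> ?f z'" for z z'
      by (cases z; cases z') (simp add: DirProd_def frag_cmul_distrib integer_group_def)
    show "bij_betw ?f (carrier (free_Abelian_group T \<times>\<times> integer_group)) (carrier (free_Abelian_group (insert m T)))"
      unfolding bij_betw_def
    proof (intro conjI equalityI subsetI)
      show "inj_on ?f (carrier (free_Abelian_group T \<times>\<times> integer_group))"
      proof (rule inj_onI, clarsimp simp: DirProd_def)
        fix x n x' n'
        assume k: "Poly_Mapping.keys x \<subseteq> T" "Poly_Mapping.keys x' \<subseteq> T"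
          and eq: "x + frag_cmul n (frag_of m) = x' + frag_cmul n' (frag_of m)"
        have "n = n'" using lookup[OF k(1), of n m] lookup[OF k(2), of n' m] eq by simp
        then show "x = x' \<and> n = n'" using eq by simp
      qed
    next
      fix y assume y: "y \<in> carrier (free_Abelian_group (insert m T))"
      let ?n = "Poly_Mapping.lookup y m"
      let ?x = "y - frag_cmul ?n (frag_of m)"
      have "Poly_Mapping.keys ?x \<subseteq> T"
      proof
        fix i assume i: "i \<in> Poly_Mapping.keys ?x"
        have "i \<noteq> m" using i by (auto simp: in_keys_iff lookup_minus)
        then have "i \<in> Poly_Mapping.keys y" using i by (auto simp: in_keys_iff lookup_minus)
        then show "i \<in> T" using y \<open>i \<noteq> m\<close> by auto
      qed
      then show "y \<in> ?f ` carrier (free_Abelian_group T \<times>\<times> integer_group)"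
        by (intro image_eqI[of _ _ "(?x, ?n)"]) (auto simp: DirProd_def)
    next
      fix y assume "y \<in> ?f ` carrier (free_Abelian_group T \<times>\<times> integer_group)"
      then obtain x n where z: "y = x + frag_cmul n (frag_of m)" "Poly_Mapping.keys x \<subseteq> T" by (auto simp: DirProd_def)
      show "y \<in> carrier (free_Abelian_group (insert m T))"
        using lookup[OF z(2)] z by (auto simp: in_keys_iff split: if_splits)
    qed
  qed
  then show ?thesis by (rule is_isoI)
qed

text \<open>The empty wedge is a point. Its unreduced homology in degree 0 is infinite cyclic, which
  is the source of the extra generator for \<open>d = 0\<close>.\<close>

lemma homology_wedge_0:
  "homology_group (int d) (wedge_of_spheres 0 d) \<cong> free_Abelian_group {..<if d = 0 then 1 else 0 :: nat}"
proof -
  have top: "topspace (wedge_of_spheres 0 d) = {None}" by (simp add: topspace_wedge_of_spheres)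
  show ?thesis
  proof (cases "d = 0")
    case True
    have "homology_group 0 (wedge_of_spheres 0 d) \<cong> integer_group" by (rule homology_coefficients[OF top])
    also have "integer_group \<cong> free_Abelian_group {0::nat}"
      by (rule isomorphic_group_integer_free_Abelian_group_singleton)
    finally show ?thesis using True by (simp add: lessThan_Suc)
  next
    case False
    then have "trivial_group (homology_group (int d) (wedge_of_spheres 0 d))"
      using homology_dimension_axiom[OF top, of "int d"] by simp
    then have "(\<lambda>_. 0) \<in> iso (homology_group (int d) (wedge_of_spheres 0 d)) (free_Abelian_group ({} :: nat set))"
      by (auto simp: trivial_group_def iso_def hom_def bij_betw_def)
    then show ?thesis using False by (auto simp: is_iso_def)
  qed
qed

lemma homology_wedge:
  "homology_group (int d) (wedge_of_spheres N d) \<cong> free_Abelian_group {..<(if d = 0 then 1 else 0) + N}"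
proof (induction N)
  case 0
  then show ?case using homology_wedge_0 by simp
next
  case (Suc N)
  let ?m = "(if d = 0 then 1 else 0) + N :: nat"
  have "homology_group (int d) (wedge_of_spheres (Suc N) d) \<cong> homology_group (int d) (wedge_of_spheres N d) \<times>\<times> integer_group"
    by (rule homology_wedge_Suc)
  also have "\<dots> \<cong> free_Abelian_group {..<?m} \<times>\<times> integer_group"
    by (rule group.DirProd_iso_trans) (simp_all add: Suc.IH)
  also have "\<dots> \<cong> free_Abelian_group (insert ?m {..<?m})"
    by (rule free_Abelian_group_insert) simp
  finally show ?case by (simp add: lessThan_Suc)
qed

lemma wedge_of_spheres_unique:
  assumes "wedge_of_spheres M d homotopy_equivalent_space wedge_of_spheres N d"
  shows "M = N"
proof -
  let ?e = "if d = 0 then 1 else 0 :: nat"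
  have "free_Abelian_group {..<?e + M} \<cong> homology_group (int d) (wedge_of_spheres M d)"
    by (rule group.iso_sym[OF _ homology_wedge]) simp
  also have "\<dots> \<cong> homology_group (int d) (wedge_of_spheres N d)"
    using assms by (rule homotopy_equivalent_space_imp_isomorphic_homology_groups)
  also have "\<dots> \<cong> free_Abelian_group {..<?e + N}" by (rule homology_wedge)
  finally have "{..<?e + M} \<approx> {..<?e + N}" by (simp add: isomorphic_free_Abelian_groups)
  then have "card {..<?e + M} = card {..<?e + N}" by (simp add: eqpoll_iff_card)
  then show ?thesis by simp
qed

section \<open>Partition complexes\<close>

lemma finite_complex_order_complex:
  assumes "finite Q"
  shows "finite_complex (order_complex Q R)" "order_complex Q R \<noteq> {}"
proof -
  show "finite_complex (order_complex Q R)"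
    unfolding finite_complex_def
  proof (intro conjI ballI allI impI)
    show "finite (order_complex Q R)"
      by (rule finite_subset[of _ "Pow Q"]) (use assms in \<open>auto simp: order_complex_def\<close>)
    show "\<tau> \<in> order_complex Q R" if "\<sigma> \<in> order_complex Q R" "\<tau> \<subseteq> \<sigma>" for \<sigma> \<tau>
      using that finite_subset unfolding order_complex_def Chains_def by blast
  qed (simp add: order_complex_def)
  have "{} \<in> order_complex Q R" by (simp add: order_complex_def Chains_def)
  then show "order_complex Q R \<noteq> {}" by blast
qed

text \<open>Any decomposition yields the homotopy type, and uniqueness of the number of spheres then
  evaluates the definite description. In particular, two decompositions of the same partition
  complex have the same count.\<close>

lemma partition_complex_wedge:
  assumes fin: "finite P" and po: "partial_order_on P r" and card: "card P \<ge> 3"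
    and dec: "decomposable (finite_chains (proper_congruences P r)) (card P - 2) N"
  shows "partition_complex P r homotopy_equivalent_space wedge_of_spheres N (card P - 3)"
    and "num_spheres P r = N"
proof -
  have rP: "r \<subseteq> P \<times> P" using po by (simp add: order_on_defs)
  have ne: "P \<noteq> {}" using card by auto
  have finQ: "finite (proper_order_preserving_partitions P r)"
    using finite_proper_congruences[OF fin] by (simp add: proper_order_preserving_partitions_eq[OF rP ne])
  have "card P - 2 = Suc (card P - 3)" using card by simp
  with decomposable_order_complex[OF rP ne dec]
  show *: "partition_complex P r homotopy_equivalent_space wedge_of_spheres N (card P - 3)"
    unfolding partition_complex_def
    by (intro geometric_realization_homotopy_equivalent finite_complex_order_complex finQ) simp
  show "num_spheres P r = N"
    unfolding num_spheres_def
  proof (rule the_equality)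
    show "partition_complex P r homotopy_equivalent_space wedge_of_spheres N (card P - 3)" by (rule *)
  next
    fix k assume "partition_complex P r homotopy_equivalent_space wedge_of_spheres k (card P - 3)"
    then have "wedge_of_spheres k (card P - 3) homotopy_equivalent_space wedge_of_spheres N (card P - 3)"
      using * homotopy_eqv_trans[OF homotopy_equivalent_space_sym[THEN iffD1]] by blast
    then show "k = N" by (rule wedge_of_spheres_unique)
  qed
qed

text \<open>Here the quotient is the literal poset of classes, so that its
  \<open>num_spheres\<close> is the one in the recursion. With more than three points in
  \<open>P\<close> the quotient has at least three, and the dimension in \<open>num_spheres\<close>
  is not truncated.\<close>

lemma decomposable_pair_partition:
  assumes fin: "finite P" and po: "partial_order_on P r" and card: "card P > 3"
    and ab: "a \<in> P" "b \<in> P" "b \<noteq> a" and cong: "pair_rel P a b \<in> congruences P r"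
  shows "decomposable (finite_chains {\<rho> \<in> proper_congruences P r. pair_rel P a b \<subset> \<rho>}) (card P - 3)
    (num_spheres (pair_partition P a b) (quotient_order P r (partition_rel (pair_partition P a b))))"
proof -
  let ?P = "pair_partition P a b" and ?\<kappa> = "pair_rel P a b"
  let ?r = "quotient_order P r (partition_rel ?P)"
  have rP: "r \<subseteq> P \<times> P" using po by (simp add: order_on_defs)
  have eq: "equiv P ?\<kappa>" by (rule equiv_pair_rel[OF ab(1,2)])
  have Q: "P // ?\<kappa> = ?P" by (rule quotient_pair_rel[OF ab(1,2)])
  have r: "?r = {(?\<kappa> `` {x}, ?\<kappa> `` {y}) | x y. (x, y) \<in> (?\<kappa> \<union> r)\<^sup>+}"
    unfolding partition_rel_pair_partition[OF ab(1,2)] by (rule quotient_order_eq[OF eq rP])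
  have T: "(?\<kappa> \<union> r)\<^sup>+ \<subseteq> P \<times> P"
    by (rule trancl_subset[OF rP congruences_subset[OF cong]])
  interpret quotient_map_poset P r ?P ?r "\<lambda>x. ?\<kappa> `` {x}" ?\<kappa>
  proof
    show "(\<lambda>x. ?\<kappa> `` {x}) ` P = ?P" unfolding Q[symmetric] quotient_def by auto
    show "?r \<subseteq> ?P \<times> ?P"
    proof
      fix z assume "z \<in> ?r"
      then obtain x y where "z = (?\<kappa> `` {x}, ?\<kappa> `` {y})" "(x, y) \<in> (?\<kappa> \<union> r)\<^sup>+" unfolding r by blast
      then show "z \<in> ?P \<times> ?P" using T unfolding Q[symmetric] by (auto intro: quotientI)
    qed
    show "?\<kappa> `` {x} = ?\<kappa> `` {y} \<longleftrightarrow> (x, y) \<in> ?\<kappa>" if "x \<in> P" "y \<in> P" for x y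
      using eq_equiv_class_iff[OF eq that] .
    show "(?\<kappa> `` {x}, ?\<kappa> `` {y}) \<in> ?r \<longleftrightarrow> (x, y) \<in> (?\<kappa> \<union> r)\<^sup>+" if xy: "x \<in> P" "y \<in> P" for x y
    proof
      assume "(?\<kappa> `` {x}, ?\<kappa> `` {y}) \<in> ?r"
      then obtain x' y' where *: "?\<kappa> `` {x} = ?\<kappa> `` {x'}" "?\<kappa> `` {y} = ?\<kappa> `` {y'}" "(x', y') \<in> (?\<kappa> \<union> r)\<^sup>+"
        unfolding r by blast
      then have "x' \<in> P" "y' \<in> P" using T by blast+
      \<comment> \<open>The witnesses of the quotient order are other representatives of the same
        classes; a step of \<open>pair_rel\<close> at either end corrects this.\<close>
      then have "(x, x') \<in> ?\<kappa>" "(y', y) \<in> ?\<kappa>"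
        using *(1) *(2)[symmetric] eq_equiv_class_iff[OF eq] xy by simp_all
      then show "(x, y) \<in> (?\<kappa> \<union> r)\<^sup>+" using *(3) by (meson UnI1 r_into_trancl' trancl_trans)
    qed (use r in blast)
  qed (use po cong in auto)
  have finP: "finite ?P" unfolding pair_partition_def using fin by simp
  have cardP: "card ?P = card P - 1" using card_pair_partition[OF fin ab(1,2)] ab(3) by simp
  then have "card ?P \<ge> 3" using card by simp
  then obtain N where N: "decomposable (finite_chains (proper_congruences ?P ?r)) (card ?P - 2) N"
    using decomposable_proper_congruences[OF finP partial_order_quotient] by auto
  have "num_spheres ?P ?r = N"
    by (rule partition_complex_wedge(2)[OF finP partial_order_quotient \<open>card ?P \<ge> 3\<close> N])
  moreover have "?\<kappa> \<noteq> Id_on P" using ab by (auto simp: pair_rel_def)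
  ultimately show ?thesis
    using decomposable_upper[OF _ N] cardP by (simp add: numeral_3_eq_3 numeral_2_eq_2)
qed

theorem theorem11:
  fixes P :: "'a set" and r :: "'a rel"
  assumes "finite P" and "partial_order_on P r" and "card P \<ge> 3"
  shows "partition_complex P r homotopy_equivalent_space
           wedge_of_spheres (num_spheres P r) (card P - 3) \<and>
         (card P > 3 \<longrightarrow>
           (\<forall>a\<in>P. (\<forall>x\<in>P. (x, a) \<in> r \<longrightarrow> x = a) \<longrightarrow>
             num_spheres P r =
               (\<Sum>b | b \<in> P \<and> b \<noteq> a \<and> pair_partition P a b \<in> order_preserving_partitions P r.
                  num_spheres (pair_partition P a b)
                    (quotient_order P r (partition_rel (pair_partition P a b))))))"
proof (intro conjI impI ballI)
  obtain N where N: "decomposable (finite_chains (proper_congruences P r)) (card P - 2) N"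
    using decomposable_proper_congruences[OF assms(1,2)] assms(3) by auto
  show "partition_complex P r homotopy_equivalent_space wedge_of_spheres (num_spheres P r) (card P - 3)"
    using partition_complex_wedge[OF assms N] by simp
next
  fix a
  assume card: "card P > 3" and a: "a \<in> P" and min: "\<forall>x\<in>P. (x, a) \<in> r \<longrightarrow> x = a"
  have rP: "r \<subseteq> P \<times> P" using assms(2) by (simp add: order_on_defs)
  let ?N = "\<lambda>b. num_spheres (pair_partition P a b) (quotient_order P r (partition_rel (pair_partition P a b)))"
  \<comment> \<open>The sum of the \<open>num_spheres\<close> of the quotients is itself the count
    of a decomposition of \<open>P\<close>, and every such count equals
    \<open>num_spheres P r\<close>.\<close>
  have "decomposable (finite_chains (proper_congruences P r)) (card P - 2)
      (\<Sum>b | b \<in> P \<and> b \<noteq> a \<and> pair_rel P a b \<in> congruences P r. ?N b)"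
    using decomposable_step[OF assms a, of ?N] min decomposable_pair_partition[OF assms(1,2) card a] by blast
  moreover have "{b. b \<in> P \<and> b \<noteq> a \<and> pair_rel P a b \<in> congruences P r} =
      {b. b \<in> P \<and> b \<noteq> a \<and> pair_partition P a b \<in> order_preserving_partitions P r}"
    using pair_partition_preserving_iff[OF rP a] by blast
  ultimately show "num_spheres P r = (\<Sum>b | b \<in> P \<and> b \<noteq> a \<and> pair_partition P a b \<in> order_preserving_partitions P r. ?N b)"
    using partition_complex_wedge(2)[OF assms] by simp
qed

end
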